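(* Let $n\ge 1$ and let $(M,\mathcal{D},g)$ be one of the $(2n+1)$-dimensional contact sub-Riemannian model spaces: the Heisenberg group $\mathbb{H}^n$ ($M=\mathbb{R}^{2n+1}$), the sphere $M=S^{2n+1}$ with parameter $k>0$, or the anti-de Sitter space $M=H^{2n+1}$ with parameter $k>0$. Set $I=(0,\frac{\pi}{k})$ if $M=S^{2n+1}$ and $I=(0,\infty)$ otherwise. Define $h_k\colon I\to\mathbb{R}$ by $$h_k(r)=\begin{cases} r & \text{if } M=\mathbb{R}^{2n+1},\\ k^{-1}\sin(kr) & \text{if } M=S^{2n+1},\\ k^{-1}\sinh(kr) & \text{if } M=H^{2n+1}.\end{cases}$$ For the model hypersurface $S$ in $(M,\mathcal{D},g)$, with set of characteristic points $C(S)$, and in the spherical coordinates $(r,\varphi_1,\dots,\varphi_{2n-1})$ for $S\setminus C(S)$ with $r\in I$, $\varphi_1,\dots,\varphi_{2n-2}\in[0,\pi]$ and $\varphi_{2n-1}\in[0,2\pi)$ described in the context, the volume form $\mu$ on $S\setminus C(S)$ is given by $$\mu=\frac{n!}{2}\left(h_k(r)\right)^{2n}\left(\prod_{i=1}^{2n-2}\left(\sin(\varphi_i)\right)^{2n-i-1}\right)\mathrm{d}r\wedge\mathrm{d}\varphi_1\wedge\dots\wedge\mathrm{d}\varphi_{2n-1}.$$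
   Context: General definitions. For a contact form $\omega$ on $M$ ($\dim M=2n+1$) with contact structure $\mathcal{D}=\ker\omega$ and fibre inner product $g$ on $\mathcal{D}$, $M$ is oriented by $\Omega=\omega\wedge(\mathrm{d}\omega)^n$. For an oriented hypersurface $S\subset M$, $C(S)=\{x\in S:T_xS=\mathcal{D}_x\}$ and $\mathcal{F}=\mathcal{D}\cap TS$ on $S\setminus C(S)$. The sub-Riemannian normal $N$ along $S\setminus C(S)$ is the vector field with $\omega(N)=0$, $g(N,N)=1$, $g(N,Y)=0$ for all $Y$ in $\mathcal{F}$, such that $(N,Z_1,\dots,Z_{2n})$ is positively oriented in $M$ for every positively oriented local frame $(Z_1,\dots,Z_{2n})$ of $S\setminus C(S)$. The volume form on $S\setminus C(S)$ is $\mu=\iota_N\Omega$ (restricted to $S\setminus C(S)$). Below, $S$ is oriented so that $(r,\varphi_1,\dots,\varphi_{2n-1})$ is a positively oriented coordinate system. Model spaces and model hypersurfaces (all contact forms below satisfy the normalisation $(\mathrm{d}\omega)^n|_{\mathcal{D}}=n!\,\mathrm{vol}_g$). Write $\sigma_i=\cos(\varphi_i)\prod_{l=1}^{i-1}\sin(\varphi_l)$ for $1\le i\le 2n-1$ and $\sigma_{2n}=\prod_{l=1}^{2n-1}\sin(\varphi_l)$. (1) Heisenberg group: $M=\mathbb{R}^{2n+1}$ with coordinates $(x_1,\dots,x_{2n+1})$, $\omega=\frac12\sum_{m=1}^n(x_{2m-1}\mathrm{d}x_{2m}-x_{2m}\mathrm{d}x_{2m-1})-\mathrm{d}x_{2n+1}$,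 $\mathcal{D}=\ker\omega$, $g=\sum_{i=1}^{2n}\mathrm{d}x_i\otimes\mathrm{d}x_i$ on $\mathcal{D}$. Model hypersurface: $S=\{x_{2n+1}=0\}$, with $C(S)=\{0\}$. Coordinates: $x_i=r\sigma_i$ for $1\le i\le 2n$. (2) Sphere with parameter $k>0$: $M=S^{2n+1}=\{x\in\mathbb{R}^{2n+2}:\sum_{i=1}^{2n+2}x_i^2=1\}$, $\omega=\frac{1}{2k^2}\sum_{m=1}^{n+1}(x_{2m-1}\mathrm{d}x_{2m}-x_{2m}\mathrm{d}x_{2m-1})$ restricted to $S^{2n+1}$, $\mathcal{D}=\ker\omega$, $g=\frac{1}{k^2}\langle\cdot,\cdot\rangle|_{\mathcal{D}}$ with $\langle\cdot,\cdot\rangle$ the Euclidean inner product. Model hypersurface: $S=S^{2n+1}\cap\{x_{2n+2}=0\}$; $C(S)$ consists of the two points with $x_1=\dots=x_{2n}=0$, $x_{2n+1}=\pm1$. Coordinates: $x_i=\sin(kr)\sigma_i$ for $1\le i\le 2n$, $x_{2n+1}=\cos(kr)$. (3) Anti-de Sitter space with parameter $k>0$: $M=H^{2n+1}=\{x\in\mathbb{R}^{2n+2}:\sum_{i=1}^{2n}x_i^2-x_{2n+1}^2-x_{2n+2}^2=-1\}$, $\omega=\frac{1}{2k^2}\sum_{m=1}^{n+1}(x_{2m-1}\mathrm{d}x_{2m}-x_{2m}\mathrm{d}x_{2m-1})$ restricted to $H^{2n+1}$, $\mathcal{D}=\ker\omega$, $g=\frac1{k^2}\eta|_{\mathcal{D}}$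 with $\eta=\sum_{i=1}^{2n}\mathrm{d}x_i\otimes\mathrm{d}x_i-\mathrm{d}x_{2n+1}\otimes\mathrm{d}x_{2n+1}-\mathrm{d}x_{2n+2}\otimes\mathrm{d}x_{2n+2}$ (which is positive definite on $\mathcal{D}$). Model hypersurface: $S=H^{2n+1}\cap\{x_{2n+2}=0,\ x_{2n+1}>0\}$; $C(S)$ is the single point with $x_1=\dots=x_{2n}=0$, $x_{2n+1}=1$. Coordinates: $x_i=\sinh(kr)\sigma_i$ for $1\le i\le 2n$, $x_{2n+1}=\cosh(kr)$. As usual for spherical coordinates, the coordinates are understood away from their degenerate locus; empty products equal $1$. *)

theory Defs
  imports "HOL-Analysis.Analysis"
begin

(* A differential form of degree k takes a point and a tuple of tangent vectors, of which only the
   entries with index < k are read. *)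
type_synonym 'a form = "'a \<Rightarrow> (nat \<Rightarrow> 'a) \<Rightarrow> real"

definition is_form :: "nat \<Rightarrow> ('a::euclidean_space) form \<Rightarrow> bool" where
  "is_form k \<alpha> \<longleftrightarrow>
     (\<forall>x v w. (\<forall>i<k. v i = w i) \<longrightarrow> \<alpha> x v = \<alpha> x w) \<and>
     (\<forall>x v. \<forall>i<k. linear (\<lambda>u. \<alpha> x (v(i := u)))) \<and>
     (\<forall>x v. \<forall>i<k. \<forall>j<k. i \<noteq> j \<and> v i = v j \<longrightarrow> \<alpha> x v = 0)"

(* Determinant convention: dx \<and> dy is 1 on the coordinate frame. *)
definition wedge :: "nat \<Rightarrow> nat \<Rightarrow> 'a form \<Rightarrow> 'a form \<Rightarrow> 'a form" where
  "wedge k l \<alpha> \<beta> = (\<lambda>x v.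
     (\<Sum>p | p permutes {..<k + l}.
        of_int (sign p) * \<alpha> x (\<lambda>i. v (p i)) * \<beta> x (\<lambda>i. v (p (k + i)))) / (fact k * fact l))"

primrec form_power :: "nat \<Rightarrow> 'a form \<Rightarrow> nat \<Rightarrow> 'a form" where
  "form_power k \<alpha> 0 = (\<lambda>x v. 1)"
| "form_power k \<alpha> (Suc m) = wedge k (k * m) \<alpha> (form_power k \<alpha> m)"

(* \<theta> 0 \<and> \<dots> \<and> \<theta> (m - 1) for 1-forms \<theta> i *)
primrec wedge_upto :: "(nat \<Rightarrow> 'a form) \<Rightarrow> nat \<Rightarrow> 'a form" where
  "wedge_upto \<theta> 0 = (\<lambda>x v. 1)"
| "wedge_upto \<theta> (Suc m) = wedge m 1 (wedge_upto \<theta> m) (\<theta> m)"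

(* The invariant formula for constant vector fields v 0, \<dots>, v k, whose Lie brackets vanish. *)
definition ext_deriv :: "nat \<Rightarrow> ('a::euclidean_space) form \<Rightarrow> 'a form" where
  "ext_deriv k \<alpha> = (\<lambda>x v.
     \<Sum>i\<le>k. (-1) ^ i *
       frechet_derivative (\<lambda>y. \<alpha> y (\<lambda>j. if j < i then v j else v (Suc j))) (at x) (v i))"

definition interior_product :: "('a \<Rightarrow> 'a) \<Rightarrow> 'a form \<Rightarrow> 'a form" where
  "interior_product X \<alpha> = (\<lambda>x v. \<alpha> x (case_nat (X x) v))"

definition pullback ::
  "('p::euclidean_space \<Rightarrow> 'a::euclidean_space) \<Rightarrow> 'a form \<Rightarrow> 'p form" where
  "pullback f \<alpha> = (\<lambda>q v. \<alpha> (f q) (\<lambda>i. frechet_derivative f (at q) (v i)))"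

definition coord_form :: "(nat \<Rightarrow> 'a::euclidean_space) \<Rightarrow> nat \<Rightarrow> 'a form" where
  "coord_form e i = (\<lambda>x v. v 0 \<bullet> e i)"

(* Velocities at x of curves in A; for an embedded submanifold A this is the usual tangent space. *)
definition tangent_space :: "'a::euclidean_space set \<Rightarrow> 'a \<Rightarrow> 'a set" where
  "tangent_space A x =
     {v. \<exists>\<gamma> \<epsilon>. 0 < \<epsilon> \<and> (\<forall>t\<in>{-\<epsilon><..<\<epsilon>}. \<gamma> t \<in> A) \<and> \<gamma> 0 = x \<and>
            (\<gamma> has_vector_derivative v) (at (0::real))}"

definition frame_at :: "nat \<Rightarrow> 'a::euclidean_space set \<Rightarrow> 'a \<Rightarrow> (nat \<Rightarrow> 'a) \<Rightarrow> bool" where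
  "frame_at m A x Z \<longleftrightarrow>
     inj_on Z {..<m} \<and> independent (Z ` {..<m}) \<and> span (Z ` {..<m}) = tangent_space A x"

(* An orientation of an m-dimensional submanifold is given by a continuous nowhere vanishing m-form
   on it. The form is defined on all ambient vectors, but only its values on the tangent spaces of A
   enter below. *)
definition orientation_form :: "nat \<Rightarrow> 'a::euclidean_space set \<Rightarrow> 'a form \<Rightarrow> bool" where
  "orientation_form m A \<nu> \<longleftrightarrow>
     is_form m \<nu> \<and> (\<forall>v. continuous_on A (\<lambda>x. \<nu> x v)) \<and>
     (\<forall>x\<in>A. \<forall>Z. frame_at m A x Z \<longrightarrow> \<nu> x Z \<noteq> 0)"

definition positive_frame_at ::
  "nat \<Rightarrow> 'a::euclidean_space set \<Rightarrow> 'a form \<Rightarrow> 'a \<Rightarrow> (nat \<Rightarrow> 'a) \<Rightarrow> bool" where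
  "positive_frame_at m A \<nu> x Z \<longleftrightarrow> frame_at m A x Z \<and> 0 < \<nu> x Z"

definition contact_plane :: "'a::euclidean_space set \<Rightarrow> 'a form \<Rightarrow> 'a \<Rightarrow> 'a set" where
  "contact_plane M \<omega> x = {v \<in> tangent_space M x. \<omega> x (\<lambda>_. v) = 0}"

(* A contact form on M \<subseteq> 'a is given by a form \<omega> on 'a, restricted to M. As the exterior derivative
   commutes with restriction, it is taken in 'a. *)
definition contact_volume :: "nat \<Rightarrow> ('a::euclidean_space) form \<Rightarrow> 'a form" where
  "contact_volume n \<omega> = wedge 1 (2 * n) \<omega> (form_power 2 (ext_deriv 1 \<omega>) n)"

definition characteristic_points ::
  "'a::euclidean_space set \<Rightarrow> 'a form \<Rightarrow> 'a set \<Rightarrow> 'a set" where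
  "characteristic_points M \<omega> S = {x \<in> S. tangent_space S x = contact_plane M \<omega> x}"

definition characteristic_foliation ::
  "'a::euclidean_space set \<Rightarrow> 'a form \<Rightarrow> 'a set \<Rightarrow> 'a \<Rightarrow> 'a set" where
  "characteristic_foliation M \<omega> S x = contact_plane M \<omega> x \<inter> tangent_space S x"

(* S is oriented by \<nu>. Every positive basis of a tangent space is the value of a positively oriented
   local frame, so the condition on frames is stated pointwise. *)
definition sub_riemannian_normal ::
  "nat \<Rightarrow> 'a::euclidean_space set \<Rightarrow> 'a form \<Rightarrow> ('a \<Rightarrow> 'a \<Rightarrow> real) \<Rightarrow> 'a set \<Rightarrow> 'a form \<Rightarrow>
     ('a \<Rightarrow> 'a) \<Rightarrow> bool" where
  "sub_riemannian_normal n M \<omega> g S \<nu> N \<longleftrightarrow>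
     (\<forall>x \<in> S - characteristic_points M \<omega> S.
        N x \<in> tangent_space M x \<and> \<omega> x (\<lambda>_. N x) = 0 \<and> g (N x) (N x) = 1 \<and>
        (\<forall>Y \<in> characteristic_foliation M \<omega> S x. g (N x) Y = 0) \<and>
        (\<forall>Z. positive_frame_at (2 * n) S \<nu> x Z \<longrightarrow>
             positive_frame_at (2 * n + 1) M (contact_volume n \<omega>) x (case_nat (N x) Z)))"

definition hypersurface_volume ::
  "nat \<Rightarrow> ('a::euclidean_space) form \<Rightarrow> ('a \<Rightarrow> 'a) \<Rightarrow> 'a form" where
  "hypersurface_volume n \<omega> N = interior_product N (contact_volume n \<omega>)"

(* Below, e 1, e 2, \<dots> enumerates the basis of the Euclidean space containing the model space, so
   that x \<bullet> e i is the coordinate x_i. *)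
datatype model_space = Heisenberg | Sphere real | Anti_de_Sitter real

fun valid_model :: "model_space \<Rightarrow> bool" where
  "valid_model Heisenberg = True"
| "valid_model (Sphere k) = (k > 0)"
| "valid_model (Anti_de_Sitter k) = (k > 0)"

fun ambient_dim :: "model_space \<Rightarrow> nat \<Rightarrow> nat" where
  "ambient_dim Heisenberg n = 2 * n + 1"
| "ambient_dim (Sphere k) n = 2 * n + 2"
| "ambient_dim (Anti_de_Sitter k) n = 2 * n + 2"

fun model_manifold :: "model_space \<Rightarrow> nat \<Rightarrow> (nat \<Rightarrow> 'a::euclidean_space) \<Rightarrow> 'a set" where
  "model_manifold Heisenberg n e = UNIV"
| "model_manifold (Sphere k) n e = {x. (\<Sum>i=1..2*n+2. (x \<bullet> e i)\<^sup>2) = 1}"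
| "model_manifold (Anti_de_Sitter k) n e =
     {x. (\<Sum>i=1..2*n. (x \<bullet> e i)\<^sup>2) - (x \<bullet> e (2*n+1))\<^sup>2 - (x \<bullet> e (2*n+2))\<^sup>2 = -1}"

definition rotation_form :: "nat \<Rightarrow> (nat \<Rightarrow> 'a::euclidean_space) \<Rightarrow> 'a form" where
  "rotation_form j e = (\<lambda>x v. \<Sum>m=1..j.
     (x \<bullet> e (2*m-1)) * coord_form e (2*m) x v - (x \<bullet> e (2*m)) * coord_form e (2*m-1) x v)"

fun model_form :: "model_space \<Rightarrow> nat \<Rightarrow> (nat \<Rightarrow> 'a::euclidean_space) \<Rightarrow> 'a form" where
  "model_form Heisenberg n e =
     (\<lambda>x v. 1/2 * rotation_form n e x v - coord_form e (2*n+1) x v)"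
| "model_form (Sphere k) n e = (\<lambda>x v. 1 / (2 * k\<^sup>2) * rotation_form (n+1) e x v)"
| "model_form (Anti_de_Sitter k) n e = (\<lambda>x v. 1 / (2 * k\<^sup>2) * rotation_form (n+1) e x v)"

(* The inner product on the contact planes is the restriction of this bilinear form, which does not
   depend on the base point. *)
fun model_metric ::
  "model_space \<Rightarrow> nat \<Rightarrow> (nat \<Rightarrow> 'a::euclidean_space) \<Rightarrow> 'a \<Rightarrow> 'a \<Rightarrow> real" where
  "model_metric Heisenberg n e = (\<lambda>u v. \<Sum>i=1..2*n. (u \<bullet> e i) * (v \<bullet> e i))"
| "model_metric (Sphere k) n e = (\<lambda>u v. 1 / k\<^sup>2 * (u \<bullet> v))"
| "model_metric (Anti_de_Sitter k) n e = (\<lambda>u v. 1 / k\<^sup>2 *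
     ((\<Sum>i=1..2*n. (u \<bullet> e i) * (v \<bullet> e i))
        - (u \<bullet> e (2*n+1)) * (v \<bullet> e (2*n+1)) - (u \<bullet> e (2*n+2)) * (v \<bullet> e (2*n+2))))"

fun model_hypersurface ::
  "model_space \<Rightarrow> nat \<Rightarrow> (nat \<Rightarrow> 'a::euclidean_space) \<Rightarrow> 'a set" where
  "model_hypersurface Heisenberg n e = {x. x \<bullet> e (2*n+1) = 0}"
| "model_hypersurface (Sphere k) n e =
     model_manifold (Sphere k) n e \<inter> {x. x \<bullet> e (2*n+2) = 0}"
| "model_hypersurface (Anti_de_Sitter k) n e =
     model_manifold (Anti_de_Sitter k) n e \<inter> {x. x \<bullet> e (2*n+2) = 0 \<and> x \<bullet> e (2*n+1) > 0}"

(* Below, c 0, \<dots>, c (2n-1) enumerates the basis of the coordinate space: a point q of it has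
   r = q \<bullet> c 0 and \<phi>_i = q \<bullet> c i for 1 \<le> i \<le> 2n-1. *)
definition sigma :: "nat \<Rightarrow> (nat \<Rightarrow> real) \<Rightarrow> nat \<Rightarrow> real" where
  "sigma n \<phi> i =
     (if i = 2*n then \<Prod>l=1..2*n-1. sin (\<phi> l) else cos (\<phi> i) * (\<Prod>l=1..i-1. sin (\<phi> l)))"

fun spherical_coords ::
  "model_space \<Rightarrow> nat \<Rightarrow> (nat \<Rightarrow> 'a::euclidean_space) \<Rightarrow> (nat \<Rightarrow> 'p::euclidean_space) \<Rightarrow> 'p \<Rightarrow> 'a"
where
  "spherical_coords Heisenberg n e c q =
     (\<Sum>i=1..2*n. ((q \<bullet> c 0) * sigma n (\<lambda>l. q \<bullet> c l) i) *\<^sub>R e i)"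
| "spherical_coords (Sphere k) n e c q =
     (\<Sum>i=1..2*n. (sin (k * (q \<bullet> c 0)) * sigma n (\<lambda>l. q \<bullet> c l) i) *\<^sub>R e i)
       + cos (k * (q \<bullet> c 0)) *\<^sub>R e (2*n+1)"
| "spherical_coords (Anti_de_Sitter k) n e c q =
     (\<Sum>i=1..2*n. (sinh (k * (q \<bullet> c 0)) * sigma n (\<lambda>l. q \<bullet> c l) i) *\<^sub>R e i)
       + cosh (k * (q \<bullet> c 0)) *\<^sub>R e (2*n+1)"

fun radial_range :: "model_space \<Rightarrow> real set" where
  "radial_range Heisenberg = {0<..}"
| "radial_range (Sphere k) = {0<..<pi / k}"
| "radial_range (Anti_de_Sitter k) = {0<..}"

definition coord_domain :: "model_space \<Rightarrow> nat \<Rightarrow> (nat \<Rightarrow> 'p::euclidean_space) \<Rightarrow> 'p set" where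
  "coord_domain X n c =
     {q. q \<bullet> c 0 \<in> radial_range X \<and> (\<forall>i\<in>{1..2*n-2}. q \<bullet> c i \<in> {0..pi}) \<and>
         q \<bullet> c (2*n-1) \<in> {0..<2*pi}}"

definition degenerate_locus :: "nat \<Rightarrow> (nat \<Rightarrow> 'p::euclidean_space) \<Rightarrow> 'p set" where
  "degenerate_locus n c = {q. \<exists>i\<in>{1..2*n-2}. sin (q \<bullet> c i) = 0}"

fun radial_function :: "model_space \<Rightarrow> real \<Rightarrow> real" where
  "radial_function Heisenberg r = r"
| "radial_function (Sphere k) r = sin (k * r) / k"
| "radial_function (Anti_de_Sitter k) r = sinh (k * r) / k"

end

theory Submission
  imports Defs "Jordan_Normal_Form.Determinant"
begin

text \<open>
  At a point \<open>x = \<Phi> q\<close> let \<open>Z\<^sub>0, \<dots>, Z\<^sub>2\<^sub>n\<^sub>-\<^sub>1\<close> be the coordinate frame, and let \<open>\<Omega>\<close> be the contact volume form.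
  Both sides of the formula are alternating \<open>2n\<close>-forms on a space of dimension \<open>2n\<close>, so it
  suffices to find the number \<open>\<Omega>(N, Z\<^sub>0, \<dots>, Z\<^sub>2\<^sub>n\<^sub>-\<^sub>1)\<close>. Where the coordinates do not degenerate,
  its sign is known: the frame is positive in \<open>S\<close>, so the normal makes \<open>(N, Z)\<close> positive in
  \<open>M\<close>. Hence only its absolute value is needed, and this is found from three facts.

  First, \<open>\<Omega>\<close> is a determinant. The \<open>m\<close>-th power of the standard symplectic form on \<open>2m\<close> coordinates is
  \<open>m!\<close> times the determinant. On the sphere and on anti-de Sitter space, \<open>\<omega>\<close> is a multiple of the
  contraction of the symplectic form with the position vector \<open>x\<close>, and contraction is a derivation, so
  \<open>\<Omega>(w\<^sub>0, \<dots>)\<close> is \<open>n! / (2 k\<^bsup>2n+2\<^esup>)\<close> times \<open>det(x, w\<^sub>0, \<dots>)\<close>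
  (\<open>contact_volume_homogeneous\<close>). In the Heisenberg group it is \<open>-n!\<close> times the determinant with
  the vertical coordinate in the first row (\<open>contact_volume_Heisenberg\<close>).

  Secondly, the last coordinate vanishes on \<open>x\<close> and on all \<open>Z\<^sub>j\<close>. So \<open>N\<close> enters this determinant
  only through its last coordinate and may be replaced by that multiple of the last basis vector
  (\<open>frame_det_column\<close>). The vectors \<open>x\<close>, \<open>e\<close> (the last basis vector), \<open>Z\<^sub>0, \<dots>, Z\<^sub>2\<^sub>n\<^sub>-\<^sub>1\<close> are then
  orthogonal for the ambient symmetric form of the model, and up to sign the square of the determinant is the
  product of their squared lengths (\<open>frame_det_Gram\<close>); in the Heisenberg group \<open>x\<close> does not belong to
  this list. The product vanishes where the coordinates degenerate, and there both sides are zero.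

  Thirdly, the last coordinate of \<open>N\<close> is known up to sign. In the contact plane there is an explicit
  vector \<open>E\<close>, on the sphere and on anti-de Sitter space a multiple of the projection of \<open>e\<close>,
  whose inner product with a vector of the plane is a constant times the last coordinate of that vector. As \<open>N\<close> has length one and is orthogonal to
  the vectors of the plane with last coordinate zero, it is a multiple of \<open>E\<close>, and \<open>g(N, N) = 1\<close> fixes the
  square of its last coordinate (\<open>normal_component\<close>). It equals \<open>(k\<^sup>2 h\<^sub>k(r))\<^sup>2\<close> on the sphere and on
  anti-de Sitter space and \<open>(r / 2)\<^sup>2\<close> in the Heisenberg group.

  \<open>volume_from_normal\<close> combines these facts. The sphere and anti-de Sitter space are treated together
  in \<open>curved_volume\<close>, where a sign \<open>s = \<plusminus>1\<close> distinguishes them: the model is the set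
  \<open>B x x = s\<close> for the form \<open>B\<close> whose last two squares carry the sign \<open>s\<close>.
\<close>

text \<open>
  In what follows the determinant is that of matrices with natural number indices, and the bullet is
  the inner product of a Euclidean space.
\<close>

hide_const (open) Determinants.det
no_notation scalar_prod (infix "\<bullet>" 70)

section \<open>Exterior products as alternations\<close>

text \<open>
  There is no division by \<open>m!\<close>, so that the alternation of a product of linear functions is exactly their
  exterior product in the determinant convention.
\<close>

definition alternation :: "nat \<Rightarrow> ((nat \<Rightarrow> 'a) \<Rightarrow> real) \<Rightarrow> (nat \<Rightarrow> 'a) \<Rightarrow> real" where
  "alternation m f v = (\<Sum>p | p permutes {..<m}. of_int (sign p) * f (\<lambda>i. v (p i)))"

lemma alternation_permute:
  assumes "r permutes {..<m}"
  shows "(\<Sum>p | p permutes {..<m}. of_int (sign p * sign r) * f (\<lambda>i. v (p (r i)))) = alternation m f v"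
proof -
  have "alternation m f v = (\<Sum>p | p permutes {..<m}. of_int (sign (p \<circ> r)) * f (\<lambda>i. v ((p \<circ> r) i)))"
    unfolding alternation_def by (rule sum_permutations_compose_right[OF assms])
  also have "\<dots> = (\<Sum>p | p permutes {..<m}. of_int (sign p * sign r) * f (\<lambda>i. v (p (r i))))"
  proof (rule sum.cong[OF refl])
    fix p assume "p \<in> {p. p permutes {..<m}}"
    then have "sign (p \<circ> r) = sign p * sign r"
      using assms by (intro sign_compose) (auto intro: permutation_permutes[THEN iffD2] simp: permutation_permutes)
    then show "of_int (sign (p \<circ> r)) * f (\<lambda>i. v ((p \<circ> r) i)) = of_int (sign p * sign r) * f (\<lambda>i. v (p (r i)))"
      by simp
  qed
  finally show ?thesis by simp
qed

text \<open>
  The inner alternations of \<open>\<alpha>\<close> and \<open>\<beta>\<close> are absorbed by the outer one: permutations \<open>a\<close> of the first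
  \<open>k\<close> and \<open>b\<close> of the last \<open>l\<close> places combine to one of all places, and shifting the summation by it
  shows that every pair \<open>(a, b)\<close> contributes the same. The number \<open>k! l!\<close> of pairs cancels the
  denominator of the exterior product.
\<close>

lemma wedge_alternation:
  assumes local: "\<And>v w. (\<And>i. i < k \<Longrightarrow> v i = w i) \<Longrightarrow> f v = f w"
    and \<alpha>: "\<And>v. \<alpha> x v = alternation k f v" and \<beta>: "\<And>v. \<beta> x v = alternation l g v"
  shows "wedge k l \<alpha> \<beta> x v = alternation (k + l) (\<lambda>v. f v * g (\<lambda>i. v (k + i))) v"
proof -
  define F where "F = (\<lambda>v. f v * g (\<lambda>i. v (k + i)))"
  let ?P = "\<lambda>m. {p. p permutes {..<m::nat}}"
  have term_eq: "(\<Sum>p\<in>?P (k+l). of_int (sign p) * (of_int (sign a) * f (\<lambda>i. v (p (a i)))) *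
       (of_int (sign b) * g (\<lambda>i. v (p (k + b i))))) = alternation (k+l) F v"
    if a: "a permutes {..<k}" and b: "b permutes {..<l}" for a b
  proof -
    \<comment> \<open>The permutation b, moved from the first l places to the places from k on.\<close>
    define b' where "b' = map_permutation {..<l} (\<lambda>i. k + i) b"
    have inj: "inj_on (\<lambda>i. k + i) {..<l}" by simp
    have img: "(\<lambda>i. k + i) ` {..<l} = {k..<k+l}"
      using image_add_atLeastLessThan[of k 0 l] by (simp add: lessThan_atLeast0 add.commute)
    have b'p: "b' permutes {k..<k+l}"
      unfolding b'_def using b inj img by (intro map_permutation_permutes) (auto simp: bij_betw_def)
    have b'P: "b' permutes {..<k+l}" using b'p by (rule permutes_subset) auto
    have aP: "a permutes {..<k+l}" using a by (rule permutes_subset) auto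
    have b'k: "b' i = i" if "i < k" for i using permutes_not_in[OF b'p] that by auto
    have b'l: "b' (k + i) = k + b i" for i
    proof (cases "i < l")
      case True then show ?thesis unfolding b'_def using map_permutation_apply[OF inj] by simp
    next
      case False then show ?thesis using permutes_not_in[OF b'p, of "k+i"] permutes_not_in[OF b, of i] by auto
    qed
    have al: "a (k + j) = k + j" for j using permutes_not_in[OF a] by auto
    have sgn: "sign (a \<circ> b') = sign a * sign b"
    proof -
      have "sign (a \<circ> b') = sign a * sign b'" using aP b'P 
        by (intro sign_compose) (auto simp: permutation_permutes)
      then show ?thesis unfolding b'_def using sign_map_permutation[OF inj b] by simp
    qed
    have rP: "(a \<circ> b') permutes {..<k+l}" using aP b'P by (rule permutes_compose[rotated])
    have step: "of_int (sign p) * (of_int (sign a) * f (\<lambda>i. v (p (a i)))) * (of_int (sign b) * g (\<lambda>i. v (p (k + b i))))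
      = of_int (sign p * sign (a \<circ> b')) * F (\<lambda>i. v (p ((a \<circ> b') i)))" for p
    proof -
      have "f (\<lambda>i. v (p (a i))) = f (\<lambda>i. v (p ((a \<circ> b') i)))"
        by (rule local) (simp add: b'k)
      then show ?thesis unfolding F_def by (simp add: sgn b'l al)
    qed
    show ?thesis unfolding step by (rule alternation_permute[OF rP])
  qed
  have "wedge k l \<alpha> \<beta> x v = (\<Sum>p\<in>?P (k+l). of_int (sign p) * alternation k f (\<lambda>i. v (p i)) *
          alternation l g (\<lambda>i. v (p (k + i)))) / (fact k * fact l)"
    by (simp add: wedge_def \<alpha> \<beta>)
  also have "(\<Sum>p\<in>?P (k+l). of_int (sign p) * alternation k f (\<lambda>i. v (p i)) *
          alternation l g (\<lambda>i. v (p (k + i)))) =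
      (\<Sum>p\<in>?P (k+l). \<Sum>a\<in>?P k. \<Sum>b\<in>?P l. of_int (sign p) * (of_int (sign a) * f (\<lambda>i. v (p (a i)))) *
       (of_int (sign b) * g (\<lambda>i. v (p (k + b i)))))"
    unfolding alternation_def
    by (simp add: sum_distrib_left sum_distrib_right mult.assoc) (intro sum.cong[OF refl] sum.swap)
  also have "\<dots> = (\<Sum>a\<in>?P k. \<Sum>b\<in>?P l. \<Sum>p\<in>?P (k+l). of_int (sign p) * (of_int (sign a) * f (\<lambda>i. v (p (a i)))) *
       (of_int (sign b) * g (\<lambda>i. v (p (k + b i)))))"
    by (subst sum.swap) (intro sum.cong[OF refl] sum.swap)
  also have "\<dots> = (\<Sum>a\<in>?P k. \<Sum>b\<in>?P l. alternation (k+l) F v)"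
    by (intro sum.cong[OF refl] term_eq) auto
  also have "\<dots> = fact k * fact l * alternation (k+l) F v"
    by (simp add: card_permutations)
  finally show ?thesis by (simp add: F_def)
qed

lemma alternation_cmult: "alternation m (\<lambda>v. c * f v) v = c * alternation m f v"
  by (simp add: alternation_def sum_distrib_left mult_ac)

lemma alternation_diff: "alternation m (\<lambda>v. f v - g v) v = alternation m f v - alternation m g v"
  by (simp add: alternation_def sum_subtractf algebra_simps)

lemma alternation_sum: "alternation m (\<lambda>v. \<Sum>i\<in>A. f i v) v = (\<Sum>i\<in>A. alternation m (f i) v)"
  unfolding alternation_def by (subst sum.swap) (simp add: sum_distrib_left)

lemma alternation_1: 
  assumes "\<And>v w. v 0 = w 0 \<Longrightarrow> f v = f w"
  shows "alternation 1 f v = f v"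
proof -
  have "{..<1::nat} = {0}" by auto
  then show ?thesis by (simp add: alternation_def)
qed

lemma alternation_2: "alternation 2 f v = f v - f (\<lambda>i. v (Transposition.transpose 0 1 i))"
proof -
  have e: "{..<2::nat} = insert 0 {1}" by auto
  have s: "{p. p permutes {1::nat}} = {id}" by (auto simp: permutes_sing)
  show ?thesis unfolding alternation_def e
    by (subst sum_over_permutations_insert) (auto simp: s sign_swap_id)
qed

lemma alternation_prod_eq_det:
  "alternation m (\<lambda>v. \<Prod>j<m. y j (v j)) v = det (mat m m (\<lambda>(i,j). y i (v j)))"
proof -
  have "det (mat m m (\<lambda>(i,j). y i (v j))) = (\<Sum>p\<in>{p. p permutes {0..<m}}.
      of_int (sign p) * (\<Prod>i=0..<m. mat m m (\<lambda>(i,j). y i (v j)) $$ (i, p i)))"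
    by (subst det_def'[where n = m]) auto
  also have "\<dots> = alternation m (\<lambda>v. \<Prod>j<m. y j (v j)) v"
    unfolding alternation_def lessThan_atLeast0
  proof (intro sum.cong[OF refl] arg_cong2[where f="(*)"] refl prod.cong)
    fix p i assume "p \<in> {p. p permutes {0..<m}}" "i \<in> {0..<m}"
    then have "i < m" "p i < m" using permutes_in_image[of p "{0..<m}" i] by auto
    then show "mat m m (\<lambda>(i,j). y i (v j)) $$ (i, p i) = y i (v (p i))" by simp
  qed
  finally show ?thesis ..
qed

lemma alternation_prod_repeated:
  assumes "i < m" "j < m" "i \<noteq> j" "y i = y j"
  shows "alternation m (\<lambda>v. \<Prod>j<m. y j (v j)) v = 0"
  unfolding alternation_prod_eq_det
  by (rule det_identical_rows[where n = m and i = i and j = j])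
     (use assms in \<open>auto simp: row_def\<close>)

lemma alternation_prod_permute:
  assumes q: "q permutes {..<m}"
  shows "alternation m (\<lambda>v. \<Prod>j<m. y (q j) (v j)) v = of_int (sign q) * alternation m (\<lambda>v. \<Prod>j<m. y j (v j)) v"
proof -
  let ?A = "mat m m (\<lambda>(i,j). y i (v j))"
  have "mat m m (\<lambda>(i,j). y (q i) (v j)) = mat m m (\<lambda>(i,j). ?A $$ (q i, j))"
    using permutes_in_image[OF q] by (intro eq_matI) auto
  moreover have "det (mat m m (\<lambda>(i,j). ?A $$ (q i, j))) = of_int (sign q) * det ?A"
    by (rule det_permute_rows) (use q in \<open>auto simp: lessThan_atLeast0\<close>)
  ultimately show ?thesis
    by (simp add: alternation_prod_eq_det[of m y] alternation_prod_eq_det[of m "\<lambda>j. y (q j)"])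
qed

text \<open>
  A two-form may be the alternation of a function \<open>s\<close> that is not antisymmetric itself. This freedom is
  used twice: with half of the form for \<open>s\<close>, and with half of the terms of the symplectic form for \<open>s\<close>.
\<close>

lemma form_power_alternation:
  assumes \<sigma>: "\<And>v. \<sigma> x v = alternation 2 s v"
    and local: "\<And>v w. v 0 = w 0 \<Longrightarrow> v 1 = w 1 \<Longrightarrow> s v = s w"
  shows "form_power 2 \<sigma> N x v = alternation (2 * N) (\<lambda>v. \<Prod>i<N. s (\<lambda>j. v (2 * i + j))) v"
proof (induction N arbitrary: v)
  case 0
  show ?case by (simp add: alternation_def)
next
  case (Suc N)
  have "form_power 2 \<sigma> (Suc N) x v = 
    alternation (2 + 2 * N) (\<lambda>v. s v * (\<Prod>i<N. s (\<lambda>j. v (2 + (2 * i + j))))) v"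
    unfolding form_power.simps
    by (rule wedge_alternation[where \<alpha> = \<sigma> and \<beta> = "form_power 2 \<sigma> N" and x = x]) (rule local \<sigma> Suc; simp)+
  also have "\<dots> = alternation (2 * Suc N) (\<lambda>v. \<Prod>i<Suc N. s (\<lambda>j. v (2 * i + j))) v"
    by (simp add: prod.lessThan_Suc_shift del: prod.lessThan_Suc)
  finally show ?case .
qed

lemma prod_pairs: "(\<Prod>j<2*N. h j) = (\<Prod>i<N. h (2 * i) * h (2 * i + 1))" for h :: "nat \<Rightarrow> real"
  by (induction N) (simp_all add: mult_ac)

text \<open>
  The map on places \<open>2i\<close> and \<open>2i+1\<close> that moves the \<open>i\<close>-th pair to the \<open>f i\<close>-th pair.
\<close>

definition pair_map :: "(nat \<Rightarrow> nat) \<Rightarrow> nat \<Rightarrow> nat" where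
  "pair_map f j = 2 * f (j div 2) + j mod 2"

lemma pair_map_compose: "pair_map (f \<circ> g) = pair_map f \<circ> pair_map g"
  by (auto simp: pair_map_def fun_eq_iff)

lemma pair_map_transpose:
  assumes "a \<noteq> b"
  shows "pair_map (Transposition.transpose a b) =
    Transposition.transpose (2*a) (2*b) \<circ> Transposition.transpose (2*a+1) (2*b+1)"
proof
  fix j :: nat
  consider "j = 2*a" | "j = 2*a+1" | "j = 2*b" | "j = 2*b+1" | "j div 2 \<noteq> a" "j div 2 \<noteq> b"
    by (metis add.commute mod2_eq_if mult_div_mod_eq add_0_right)
  then show "pair_map (Transposition.transpose a b) j =
    (Transposition.transpose (2*a) (2*b) \<circ> Transposition.transpose (2*a+1) (2*b+1)) j"
  proof cases
    case 5
    then have "j \<noteq> 2*a" "j \<noteq> 2*a+1" "j \<noteq> 2*b" "j \<noteq> 2*b+1" by auto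
    then show ?thesis using 5 by (simp add: pair_map_def)
  next
    case 1 
    have "2 * a \<noteq> 2 * b + 1" by presburger
    then show ?thesis using 1 assms by (simp add: pair_map_def transpose_eq_iff)
  next
    case 2
    have "2 * a \<noteq> 2 * b + 1" "2 * b + 1 \<noteq> 2 * a" by presburger+
    then show ?thesis using 2 assms by (simp add: pair_map_def transpose_eq_iff)
  next
    case 3
    have "2 * b \<noteq> 2 * a + 1" by presburger
    then show ?thesis using 3 assms by (simp add: pair_map_def transpose_eq_iff)
  next
    case 4
    have "2 * a + 1 \<noteq> 2 * b" by presburger
    then show ?thesis using 4 assms by (simp add: pair_map_def transpose_eq_iff)
  qed
qed

text \<open>
  A transposition of two pairs is a product of two transpositions of places, hence even. This is why
  two-forms commute.
\<close>

lemma pair_map_even_permutation: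
  assumes "f permutes {..<N}"
  shows "pair_map f permutes {..<2*N} \<and> sign (pair_map f) = 1"
  using assms finite_lessThan
proof (induction rule: permutes_induct)
  case id
  have "pair_map id = id" by (auto simp: pair_map_def fun_eq_iff)
  then show ?case by (metis permutes_id sign_id)
next
  case (swap a b p)
  let ?t = "Transposition.transpose (2*a) (2*b)" and ?u = "Transposition.transpose (2*a+1) (2*b+1)"
  have t: "?t permutes {..<2*N}" and u: "?u permutes {..<2*N}"
    using swap by (auto intro!: permutes_swap_id)
  have e: "pair_map (Transposition.transpose a b \<circ> p) = ?t \<circ> (?u \<circ> pair_map p)"
    using swap by (simp add: pair_map_compose pair_map_transpose o_assoc)
  have pu: "(?u \<circ> pair_map p) permutes {..<2*N}" using swap u by (auto intro: permutes_compose)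
  have "sign (?t \<circ> (?u \<circ> pair_map p)) = sign ?t * (sign ?u * sign (pair_map p))"
    using t u pu swap by (subst sign_compose, force simp: permutation_permutes, force simp: permutation_permutes,
       subst sign_compose) (auto simp: permutation_permutes)
  moreover have "sign ?t * (sign ?u * sign (pair_map p)) = 1"
    using swap by (simp add: sign_swap_id)
  ultimately have "sign (?t \<circ> (?u \<circ> pair_map p)) = 1" by (simp only:)
  then show ?case unfolding e using permutes_compose[OF pu t] by blast
qed

text \<open>
  Expanding the product gives one term for each choice \<open>f\<close> of a summand in each factor. A choice that
  repeats a summand repeats a row of the determinant and vanishes. The others are the \<open>N!\<close>
  permutations of the pairs, and these are even.
\<close>

lemma alternation_symplectic_power:
  fixes y :: "nat \<Rightarrow> 'a \<Rightarrow> real"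
  shows "alternation (2*N) (\<lambda>v. \<Prod>i<N. \<Sum>m<N. y (2*m) (v (2*i)) * y (2*m+1) (v (2*i+1))) v =
         fact N * alternation (2*N) (\<lambda>v. \<Prod>j<2*N. y j (v j)) v"
proof -
  let ?D = "alternation (2*N) (\<lambda>v. \<Prod>j<2*N. y j (v j)) v"
  let ?T = "\<lambda>f. alternation (2*N) (\<lambda>v. \<Prod>j<2*N. y (pair_map f j) (v j)) v"
  have eq: "(\<Prod>i<N. \<Sum>m<N. y (2*m) (v (2*i)) * y (2*m+1) (v (2*i+1))) =
        (\<Sum>f\<in>PiE {..<N} (\<lambda>_. {..<N}). \<Prod>j<2*N. y (pair_map f j) (v j))" for v
    by (subst prod_sum_PiE) (simp_all add: prod_pairs pair_map_def)
  have "?T f = 0" if f: "f \<in> PiE {..<N} (\<lambda>_. {..<N})" "\<not> inj_on f {..<N}" for f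
  proof -
    obtain a b where ab: "a < N" "b < N" "a \<noteq> b" "f a = f b" using f by (auto simp: inj_on_def)
    show ?thesis
      by (rule alternation_prod_repeated[where i = "2*a" and j = "2*b"]) (use ab in \<open>auto simp: pair_map_def\<close>)
  qed
  then have "(\<Sum>f\<in>PiE {..<N} (\<lambda>_. {..<N}). ?T f) = (\<Sum>f\<in>{f\<in>PiE {..<N} (\<lambda>_. {..<N}). inj_on f {..<N}}. ?T f)"
    by (intro sum.mono_neutral_right) (auto intro: finite_PiE)
  also have "\<dots> = (\<Sum>f | f permutes {..<N}. ?T f)"
  proof (rule sum.reindex_bij_witness[where j = "\<lambda>f i. if i < N then f i else i" and i = "\<lambda>f. restrict f {..<N}"])
    fix f assume f: "f \<in> {f \<in> PiE {..<N} (\<lambda>_. {..<N}). inj_on f {..<N}}"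
    show "restrict (\<lambda>i. if i < N then f i else i) {..<N} = f"
      using f by (auto simp: fun_eq_iff PiE_def extensional_def)
    have "f ` {..<N} = {..<N}" using f by (intro endo_inj_surj) auto
    then have "bij_betw f {..<N} {..<N}" using f by (simp add: bij_betw_def)
    then have "bij_betw (\<lambda>i. if i < N then f i else i) {..<N} {..<N}"
      by (rule bij_betw_cong[THEN iffD1, rotated]) auto
    then show "(\<lambda>i. if i < N then f i else i) \<in> {f. f permutes {..<N}}"
      by (auto intro!: bij_imp_permutes split: if_splits)
    have "(\<Prod>j<2*N. y (pair_map (\<lambda>i. if i < N then f i else i) j) (v j)) = (\<Prod>j<2*N. y (pair_map f j) (v j))" for v :: "nat \<Rightarrow> 'a"
      by (intro prod.cong) (auto simp: pair_map_def)
    then show "?T (\<lambda>i. if i < N then f i else i) = ?T f" by simp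
  next
    fix f assume f: "f \<in> {f. f permutes {..<N}}"
    then show "(\<lambda>i. if i < N then restrict f {..<N} i else i) = f"
      using permutes_not_in[of f "{..<N}"] by (auto simp: fun_eq_iff)
    show "restrict f {..<N} \<in> {f \<in> PiE {..<N} (\<lambda>_. {..<N}). inj_on f {..<N}}"
      using f permutes_in_image[of f "{..<N}"] permutes_inj[of f "{..<N}"]
      by (auto simp: inj_def inj_on_def)
  qed
  also have "\<dots> = (\<Sum>f | f permutes {..<N}. ?D)"
    using pair_map_even_permutation by (intro sum.cong) (auto simp: alternation_prod_permute)
  also have "\<dots> = fact N * ?D" by (simp add: card_permutations)
  finally show ?thesis unfolding eq alternation_sum .
qed

text \<open>
  The permutations are sorted by the place \<open>b\<close> which is mapped to \<open>0\<close>.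
\<close>

lemma sum_permutations_Suc:
  "(\<Sum>p | p permutes {..<Suc m}. F p) =
    (\<Sum>b<Suc m. \<Sum>q | q permutes {1..<Suc m}. F (q \<circ> Transposition.transpose 0 b))"
proof -
  have e: "{..<Suc m} = insert 0 {1..<Suc m}" by auto
  have "(\<Sum>p | p permutes {..<Suc m}. F p) = (\<Sum>p | p permutes {..<Suc m}. F (inv_into UNIV p))"
    by (rule sum_permutations_inverse)
  also have "\<dots> = (\<Sum>b<Suc m. \<Sum>q | q permutes {1..<Suc m}. F (inv_into UNIV (Transposition.transpose 0 b \<circ> q)))"
    unfolding e by (subst sum_over_permutations_insert) auto
  also have "\<dots> = (\<Sum>b<Suc m. \<Sum>q | q permutes {1..<Suc m}. F (inv_into UNIV q \<circ> Transposition.transpose 0 b))"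
    by (intro sum.cong refl arg_cong[where f = F]) (auto simp: o_inv_distrib permutes_bij)
  also have "\<dots> = (\<Sum>b<Suc m. \<Sum>q | q permutes {1..<Suc m}. F (q \<circ> Transposition.transpose 0 b))"
    by (intro sum.cong refl sum_permutations_inverse[symmetric])
  finally show ?thesis .
qed

lemma alternation_shift:
  "(\<Sum>q | q permutes {1..<Suc m}. of_int (sign q) * f (\<lambda>i. case_nat x w (q i))) =
   alternation m (\<lambda>w. f (case_nat x w)) w"
proof -
  let ?S = "map_permutation {..<m} Suc" and ?P = "map_permutation {1..<Suc m} (\<lambda>i. i - 1)"
  have S: "bij_betw Suc {..<m} {1..<Suc m}" 
    by (auto simp: bij_betw_def lessThan_atLeast0 image_Suc_atLeastLessThan)
  have P: "bij_betw (\<lambda>i. i - 1) {1..<Suc m} {..<m}"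
    by (rule bij_betw_byWitness[where f' = Suc]) auto
  have "alternation m (\<lambda>w. f (case_nat x w)) w = 
    (\<Sum>q | q permutes {1..<Suc m}. of_int (sign q) * f (\<lambda>i. case_nat x w (q i)))"
    unfolding alternation_def
  proof (rule sum.reindex_bij_witness[where i = ?P and j = ?S])
    fix p assume p: "p \<in> {p. p permutes {..<m}}"
    show "?P (?S p) = p"
      by (rule map_permutation_compose_inv[OF S]) (use p in auto)
    show "?S p \<in> {q. q permutes {1..<Suc m}}"
      using map_permutation_permutes[OF S, of p] p by simp
    have sg: "sign (?S p) = sign p" using p by (intro sign_map_permutation) auto
    have "case_nat x w (?S p i) = case_nat x (\<lambda>i. w (p i)) i" for i
    proof (cases i)
      case 0
      have "?S p 0 = 0" using map_permutation_permutes[OF S, of p] p by (intro permutes_not_in) auto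
      then show ?thesis using 0 by simp
    next
      case (Suc k)
      have "?S p (Suc k) = Suc (p k)"
      proof (cases "k < m")
        case True then show ?thesis by (intro map_permutation_apply) auto
      next
        case False
        then have "p k = k" using p permutes_not_in[of p "{..<m}" k] by auto
        moreover have "?S p (Suc k) = Suc k" using map_permutation_permutes[OF S, of p] p False
          by (intro permutes_not_in) auto
        ultimately show ?thesis by simp
      qed
      then show ?thesis using Suc by simp
    qed
    then show "of_int (sign (?S p)) * f (\<lambda>i. case_nat x w (?S p i)) = of_int (sign p) * f (case_nat x (\<lambda>i. w (p i)))"
      using sg by presburger
  next
    fix q assume q: "q \<in> {q. q permutes {1..<Suc m}}"
    show "?S (?P q) = q"
      by (rule map_permutation_compose_inv[OF P]) (use q in auto)
    show "?P q \<in> {p. p permutes {..<m}}"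
      using map_permutation_permutes[OF P, of q] q by simp
  qed
  then show ?thesis by simp
qed

text \<open>
  Contraction of the power of a two-form with a vector \<open>x\<close>. In each term of the alternation \<open>x\<close>
  stands at some place \<open>b\<close>. Exchanging the pair of places that contains \<open>b\<close> with the first pair does not
  change the product, and exchanging the two places of one pair changes its sign, as does the
  permutation. So each of the \<open>2N + 2\<close> places contributes the same as the first.
\<close>

lemma alternation_interior:
  fixes h :: "'a \<Rightarrow> 'a \<Rightarrow> real"
  assumes antisym: "\<And>u v. h u v = - h v u"
  shows "alternation (2 * Suc N) (\<lambda>v. \<Prod>i<Suc N. h (v (2*i)) (v (2*i+1))) (case_nat x w) =
     real (2 * Suc N) * alternation (2*N+1) (\<lambda>w. h x (w 0) * (\<Prod>i<N. h (w (2*i+1)) (w (2*i+2)))) w"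
proof -
  define T where "T = (\<lambda>v. \<Prod>i<Suc N. h (v (2*i)) (v (2*i+1)))"
  let ?v = "case_nat x w"
  let ?Q = "{q. q permutes {1..<Suc (2*N+1)}}"
  let ?t = "Transposition.transpose :: nat \<Rightarrow> nat \<Rightarrow> nat \<Rightarrow> nat"
  have sgn: "sign (q \<circ> ?t a b) = (if a = b then sign q else - sign q)" if "q \<in> ?Q" for q a b
    using that by (subst sign_compose) (auto simp: sign_swap_id permutation_swap_id intro: permutation_permutes[THEN iffD2])
  have b: "(\<Sum>q\<in>?Q. of_int (sign (q \<circ> ?t 0 b)) * T (\<lambda>i. ?v ((q \<circ> ?t 0 b) i))) =
        (\<Sum>q\<in>?Q. of_int (sign q) * T (\<lambda>i. ?v (q i)))" if b: "b < 2 * Suc N" for b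
  proof -
    consider "b = 0" | "b = 1" | "b \<ge> 2" by linarith
    then show ?thesis
    proof cases
      case 1 then show ?thesis by simp
    next
      case 2
      have eq: "T (\<lambda>i. u (?t 0 1 i)) = - T u" for u
      proof -
        have "(\<Prod>i<N. h (u (?t 0 1 (2 * Suc i))) (u (?t 0 1 (2 * Suc i + 1)))) = (\<Prod>i<N. h (u (2 * Suc i)) (u (2 * Suc i+1)))"
          by (intro prod.cong) simp_all
        then show ?thesis unfolding T_def prod.lessThan_Suc_shift using antisym[of "u 1" "u 0"] by simp
      qed
      show ?thesis
      proof (intro sum.cong refl)
        fix q assume q: "q \<in> ?Q"
        show "of_int (sign (q \<circ> ?t 0 b)) * T (\<lambda>i. ?v ((q \<circ> ?t 0 b) i)) = of_int (sign q) * T (\<lambda>i. ?v (q i))"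
          using eq[of "\<lambda>i. ?v (q i)"] sgn[OF q, of 0 1] 2 by simp
      qed
    next
      case 3
      \<comment> \<open>The other place of the pair i0 that contains b. The transposition of 0 and b has on the product
        the same effect as the transposition of 1 and b'.\<close>
      define b' where "b' = (if even b then b + 1 else b - 1)"
      define i0 where "i0 = b div 2"
      have b'r: "2 \<le> b'" "b' < 2 * Suc N" using 3 b unfolding b'_def by presburger+
      have i0: "i0 \<noteq> 0" "i0 < Suc N" using 3 b unfolding i0_def by auto
      have split: "(\<Prod>i<Suc N. g i) = g 0 * (g i0 * (\<Prod>i\<in>{..<Suc N}-{0}-{i0}. g i))" for g :: "nat \<Rightarrow> real"
        using i0 by (subst prod.remove[of _ 0], simp, simp, subst prod.remove[of _ i0]) auto
      have "T (\<lambda>i. u (?t 0 b i)) = T (\<lambda>i. u (?t 1 b' i))" for u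
      proof -
        have rest: "(\<Prod>i\<in>{..<Suc N}-{0}-{i0}. h (u (?t 0 b (2*i))) (u (?t 0 b (2*i+1)))) =
              (\<Prod>i\<in>{..<Suc N}-{0}-{i0}. h (u (?t 1 b' (2*i))) (u (?t 1 b' (2*i+1))))"
        proof (intro prod.cong refl)
          fix i assume "i \<in> {..<Suc N}-{0}-{i0}"
          then have i: "i \<noteq> 0" "i \<noteq> i0" by auto
          then have "2*i \<noteq> b" "2*i+1 \<noteq> b" "2*i \<noteq> b'" "2*i+1 \<noteq> b'" "2*i \<noteq> 1"
            unfolding b'_def i0_def using 3 by (auto elim!: evenE oddE)
          with i show "h (u (?t 0 b (2*i))) (u (?t 0 b (2*i+1))) = h (u (?t 1 b' (2*i))) (u (?t 1 b' (2*i+1)))"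
            by simp
        qed
        show ?thesis
        proof (cases "even b")
          case True
          then have "b = 2 * i0" "b' = 2 * i0 + 1" unfolding b'_def i0_def by auto
          then show ?thesis unfolding T_def split rest using i0
            by (simp add: Transposition.transpose_def)
        next
          case False
          then have "b = 2 * i0 + 1" "b' = 2 * i0" unfolding b'_def i0_def by auto
          then show ?thesis unfolding T_def split rest using i0 antisym[of "u (2*i0+1)" "u 1"] antisym[of "u (2*i0)" "u 0"]
            by (simp add: Transposition.transpose_def)
        qed
      qed
      note eq = this
      have "(\<Sum>q\<in>?Q. of_int (sign (q \<circ> ?t 0 b)) * T (\<lambda>i. ?v ((q \<circ> ?t 0 b) i))) =
         (\<Sum>q\<in>?Q. of_int (sign (q \<circ> ?t 1 b')) * T (\<lambda>i. ?v ((q \<circ> ?t 1 b') i)))"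
      proof (intro sum.cong refl)
        fix q assume q: "q \<in> ?Q"
        show "of_int (sign (q \<circ> ?t 0 b)) * T (\<lambda>i. ?v ((q \<circ> ?t 0 b) i)) =
            of_int (sign (q \<circ> ?t 1 b')) * T (\<lambda>i. ?v ((q \<circ> ?t 1 b') i))"
          using eq[of "\<lambda>i. ?v (q i)"] sgn[OF q, of 0 b] sgn[OF q, of 1 b'] b'r 3 by simp
      qed
      also have "\<dots> = (\<Sum>q\<in>?Q. of_int (sign q) * T (\<lambda>i. ?v (q i)))"
        using b'r by (intro sum_permutations_compose_right[symmetric] permutes_swap_id) auto
      finally show ?thesis .
    qed
  qed
  have "alternation (2 * Suc N) T ?v =
      (\<Sum>b<Suc (2*N+1). \<Sum>q\<in>?Q. of_int (sign (q \<circ> ?t 0 b)) * T (\<lambda>i. ?v ((q \<circ> ?t 0 b) i)))"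
    using sum_permutations_Suc[where m = "2*N+1" and F = "\<lambda>p. of_int (sign p) * T (\<lambda>i. ?v (p i))"]
    by (simp add: alternation_def)
  also have "\<dots> = (\<Sum>b<Suc (2*N+1). \<Sum>q\<in>?Q. of_int (sign q) * T (\<lambda>i. ?v (q i)))"
    by (intro sum.cong b refl) auto
  also have "\<dots> = real (2 * Suc N) * (\<Sum>q\<in>?Q. of_int (sign q) * T (\<lambda>i. ?v (q i)))"
    by simp
  also have "\<dots> = real (2 * Suc N) * alternation (2*N+1) (\<lambda>w. T (case_nat x w)) w"
    by (subst alternation_shift) simp
  also have "(\<lambda>w. T (case_nat x w)) = (\<lambda>w. h x (w 0) * (\<Prod>i<N. h (w (2*i+1)) (w (2*i+2))))"
    unfolding T_def prod.lessThan_Suc_shift by simp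
  finally show ?thesis unfolding T_def .
qed
section \<open>The contact volume form as a determinant\<close>

text \<open>
  The determinant of \<open>v 0, \<dots>, v (m - 1)\<close> in the coordinates \<open>\<epsilon> 0, \<dots>, \<epsilon> (m - 1)\<close>.
\<close>

definition frame_det :: "nat \<Rightarrow> (nat \<Rightarrow> 'a::euclidean_space) \<Rightarrow> (nat \<Rightarrow> 'a) \<Rightarrow> real" where
  "frame_det m \<epsilon> = alternation m (\<lambda>v. \<Prod>j<m. v j \<bullet> \<epsilon> j)"

lemma wedge_upto_coord_form: "wedge_upto (coord_form c) m q v = frame_det m c v"
proof (induction m arbitrary: v)
  case 0
  show ?case by (simp add: frame_det_def alternation_def)
next
  case (Suc m)
  have "wedge_upto (coord_form c) (Suc m) q v = alternation (m + 1) (\<lambda>v. (\<Prod>j<m. v j \<bullet> c j) * (v (m + 0) \<bullet> c m)) v"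
    unfolding wedge_upto.simps
  proof (rule wedge_alternation[where g = "\<lambda>v. v 0 \<bullet> c m"])
    show "(\<Prod>j<m. v j \<bullet> c j) = (\<Prod>j<m. w j \<bullet> c j)" if "\<And>i. i < m \<Longrightarrow> v i = w i" for v w
      using that by simp
    show "wedge_upto (coord_form c) m q v = alternation m (\<lambda>v. \<Prod>j<m. v j \<bullet> c j) v" for v
      using Suc by (simp add: frame_det_def)
    show "coord_form c m q v = alternation 1 (\<lambda>v. v 0 \<bullet> c m) v" for v
      by (subst alternation_1) (simp_all add: coord_form_def)
  qed
  then show ?case by (simp add: frame_det_def mult.commute)
qed

lemma rotation_form_shift:
  "rotation_form j e x v = (\<Sum>m<j. (x \<bullet> e (Suc (2*m))) * (v 0 \<bullet> e (Suc (2*m+1))) - (x \<bullet> e (Suc (2*m+1))) * (v 0 \<bullet> e (Suc (2*m))))"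
  unfolding rotation_form_def coord_form_def by (simp add: sum.atLeast1_atMost_eq)

lemma rotation_form_antisym: "rotation_form j e u (\<lambda>_. v) = - rotation_form j e v (\<lambda>_. u)"
  unfolding rotation_form_def coord_form_def sum_negf[symmetric] by (intro sum.cong) simp_all

lemma rotation_form_const: "rotation_form j e x v = rotation_form j e x (\<lambda>_. v 0)"
  unfolding rotation_form_def coord_form_def by simp

text \<open>
  The rotation form is bilinear and antisymmetric in the point and the vector. Hence the two terms of
  the exterior derivative agree, and a form \<open>f\<close> with constant coefficients contributes nothing.
\<close>

lemma ext_deriv_rotation:
  "ext_deriv 1 (\<lambda>x v. c * rotation_form j e x v - f (v 0)) x v = 2 * c * rotation_form j e (v 0) (\<lambda>_. v 1)"
proof -
  have D: "frechet_derivative (\<lambda>y. c * rotation_form j e y w - a) (at x) = (\<lambda>y. c * rotation_form j e y w)" for w a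
  proof (rule frechet_derivative_at[symmetric])
    have "linear (\<lambda>y. c * rotation_form j e y w)"
      by (rule linearI)
         (simp_all add: rotation_form_def coord_form_def inner_left_distrib sum_distrib_left sum.distrib[symmetric] algebra_simps)
    then show "((\<lambda>y. c * rotation_form j e y w - a) has_derivative (\<lambda>y. c * rotation_form j e y w)) (at x)"
      using has_derivative_diff[OF linear_imp_has_derivative has_derivative_const] by simp
  qed
  have e: "{..1::nat} = {0,1}" by auto
  show ?thesis unfolding ext_deriv_def e
    using rotation_form_antisym[of j e "v 1" "v 0"]
    by (simp add: D rotation_form_const[of j e _ "\<lambda>j. v (Suc j)"] rotation_form_const[of j e _ "\<lambda>j. if j = 0 then v j else v (Suc j)"])
qed

lemma rotation_form_alternation:
  "c * rotation_form j e (v 0) (\<lambda>_. v 1) =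
    alternation 2 (\<lambda>v. \<Sum>m<j. c * (v 0 \<bullet> e (Suc (2*m))) * (v 1 \<bullet> e (Suc (2*m+1)))) v"
  by (simp add: alternation_2 rotation_form_shift sum_subtractf sum_distrib_left algebra_simps)

lemma form_power_rotation:
  "form_power 2 (\<lambda>x v. rotation_form N e (v 0) (\<lambda>_. v 1)) N x v = fact N * frame_det (2*N) (\<lambda>i. e (Suc i)) v"
proof -
  have "form_power 2 (\<lambda>x v. rotation_form N e (v 0) (\<lambda>_. v 1)) N x v =
    alternation (2 * N) (\<lambda>v. \<Prod>i<N. \<Sum>m<N. 1 * (v (2*i+0) \<bullet> e (Suc (2*m))) * (v (2*i+1) \<bullet> e (Suc (2*m+1)))) v"
    by (rule form_power_alternation[where s = "\<lambda>v. \<Sum>m<N. 1 * (v 0 \<bullet> e (Suc (2*m))) * (v 1 \<bullet> e (Suc (2*m+1)))"])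
       (use rotation_form_alternation[of 1] in auto)
  also have "\<dots> = fact N * frame_det (2*N) (\<lambda>i. e (Suc i)) v"
    using alternation_symplectic_power[of N "\<lambda>i u. u \<bullet> e (Suc i)" v] by (simp add: frame_det_def)
  finally show ?thesis .
qed

text \<open>
  The rotation form is the contraction of the symplectic form with the position vector \<open>x\<close>. So
  \<open>\<omega> \<and> (d\<omega>)\<^sup>n\<close> is, up to a factor, the contraction with \<open>x\<close> of the \<open>(n+1)\<close>-st power of the symplectic
  form in \<open>2n + 2\<close> coordinates, which is a multiple of the determinant.
\<close>

lemma contact_volume_homogeneous:
  assumes \<omega>: "\<omega> = (\<lambda>x v. c * rotation_form (n + 1) e x v)"
  shows "contact_volume n \<omega> x w =
    fact n * c * (2 * c) ^ n * frame_det (2 * n + 2) (\<lambda>i. e (Suc i)) (case_nat x w)"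
proof -
  define h where "h = (\<lambda>u v. rotation_form (n+1) e u (\<lambda>_. v) / 2)"
  have h: "h u v = - h v u" for u v
    unfolding h_def using rotation_form_antisym[of "n+1" e u v] by simp
  have alt: "a * rotation_form (n+1) e (v 0) (\<lambda>_. v 1) = alternation 2 (\<lambda>v. a * h (v 0) (v 1)) v" for a v
    using rotation_form_antisym[of "n+1" e "v 1" "v 0"]
    by (simp add: alternation_2 h_def field_simps)
  have d: "ext_deriv 1 \<omega> x v = 2 * c * rotation_form (n+1) e (v 0) (\<lambda>_. v 1)" for x v
    using ext_deriv_rotation[of c "n+1" e "\<lambda>_. 0" x v] by (simp add: \<omega>)
  have "form_power 2 (ext_deriv 1 \<omega>) n x v = alternation (2 * n) (\<lambda>v. \<Prod>i<n. 2 * c * h (v (2*i+0)) (v (2*i+1))) v" for v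
    
    by (rule form_power_alternation[where s = "\<lambda>v. 2 * c * h (v 0) (v 1)"]) (simp_all only: d alt)
  moreover have "\<omega> x v = alternation 1 (\<lambda>v. 2 * c * h x (v 0)) v" for v
    by (subst alternation_1) (simp_all add: \<omega> h_def rotation_form_const[of _ _ x v])
  ultimately have "contact_volume n \<omega> x w = alternation (1 + 2*n)
     (\<lambda>v. 2 * c * h x (v 0) * (\<Prod>i<n. 2 * c * h (v (1 + (2*i+0))) (v (1 + (2*i+1))))) w"
    unfolding contact_volume_def
    by (intro wedge_alternation[where f = "\<lambda>v. 2 * c * h x (v 0)"
          and g = "\<lambda>v. \<Prod>i<n. 2 * c * h (v (2*i+0)) (v (2*i+1))"]) simp_all
  also have "\<dots> = alternation (2*n+1) (\<lambda>v. (2 * c * (2 * c) ^ n) * (h x (v 0) * (\<Prod>i<n. h (v (2*i+1)) (v (2*i+2))))) w"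
    by (simp add: prod.distrib mult_ac)
  also have "\<dots> = (2 * c * (2 * c) ^ n) * alternation (2*n+1) (\<lambda>v. h x (v 0) * (\<Prod>i<n. h (v (2*i+1)) (v (2*i+2)))) w"
    by (rule alternation_cmult)
  also have "alternation (2*n+1) (\<lambda>v. h x (v 0) * (\<Prod>i<n. h (v (2*i+1)) (v (2*i+2)))) w = 
     alternation (2 * Suc n) (\<lambda>v. \<Prod>i<Suc n. h (v (2*i)) (v (2*i+1))) (case_nat x w) / real (2 * Suc n)"
    using alternation_interior[of h n x w, OF h] by simp
  also have "alternation (2 * Suc n) (\<lambda>v. \<Prod>i<Suc n. h (v (2*i)) (v (2*i+1))) (case_nat x w) =
      form_power 2 (\<lambda>x v. rotation_form (Suc n) e (v 0) (\<lambda>_. v 1)) (Suc n) x (case_nat x w)"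
    by (subst form_power_alternation[where s = "\<lambda>v. h (v 0) (v 1)"]) (use alt[of 1] in auto)
  also have "\<dots> = fact (Suc n) * frame_det (2 * Suc n) (\<lambda>i. e (Suc i)) (case_nat x w)"
    by (rule form_power_rotation)
  also have "2 * c * (2 * c) ^ n * (\<dots> / real (2 * Suc n)) =
    fact n * c * (2 * c) ^ n * frame_det (2 * n + 2) (\<lambda>i. e (Suc i)) (case_nat x w)"
    by (simp add: divide_simps)
  finally show ?thesis .
qed

text \<open>
  Here \<open>(d\<omega>)\<^sup>n\<close> is already \<open>n!\<close> times the product of the first \<open>2n\<close> coordinate forms, so of \<open>\<omega>\<close> only the
  vertical term survives: the others repeat one of these coordinate forms.
\<close>

lemma contact_volume_Heisenberg:
  assumes \<omega>: "\<omega> = (\<lambda>x v. 1/2 * rotation_form n e x v - coord_form e (2*n+1) x v)"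
  shows "contact_volume n \<omega> x w = - fact n * frame_det (2*n+1) (case_nat (e (2*n+1)) (\<lambda>i. e (Suc i))) w"
proof -
  let ?A = "\<lambda>a. alternation (1 + 2*n) (\<lambda>v. (v 0 \<bullet> a) * (\<Prod>j<2*n. v (1 + j) \<bullet> e (Suc j))) w"
  have row: "?A a = frame_det (2*n+1) (case_nat a (\<lambda>i. e (Suc i))) w" for a
    unfolding frame_det_def by (simp add: prod.lessThan_Suc_shift del: prod.lessThan_Suc)
  have zero: "?A (e (Suc i)) = 0" if "i < 2*n" for i
    unfolding row frame_det_def
    by (rule alternation_prod_repeated[where i = 0 and j = "Suc i" and y = "\<lambda>j u. u \<bullet> case_nat (e (Suc i)) (\<lambda>i. e (Suc i)) j"])
       (use that in auto)
  have d: "ext_deriv 1 \<omega> x v = rotation_form n e (v 0) (\<lambda>_. v 1)" for x v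
    using ext_deriv_rotation[of "1/2" n e "\<lambda>u. u \<bullet> e (2*n+1)" x v] by (simp add: \<omega> coord_form_def)
  have "ext_deriv 1 \<omega> = (\<lambda>x v. rotation_form n e (v 0) (\<lambda>_. v 1))" using d by blast
  then have "form_power 2 (ext_deriv 1 \<omega>) n x v = alternation (2 * n) (\<lambda>v. fact n * (\<Prod>j<2*n. v j \<bullet> e (Suc j))) v" for v
    unfolding alternation_cmult by (simp only: form_power_rotation frame_det_def)
  moreover have \<omega>loc: "\<omega> x v = \<omega> x w" if "v 0 = w 0" for v w
    unfolding \<omega> coord_form_def rotation_form_const[of _ _ x v] rotation_form_const[of _ _ x w] that ..
  moreover have "\<omega> x v = alternation 1 (\<omega> x) v" for v
    by (rule alternation_1[symmetric]) (rule \<omega>loc)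
  ultimately have "contact_volume n \<omega> x w = alternation (1 + 2*n)
     (\<lambda>v. \<omega> x v * (fact n * (\<Prod>j<2*n. v (1 + j) \<bullet> e (Suc j)))) w"
    unfolding contact_volume_def
    by (intro wedge_alternation[where f = "\<lambda>v. \<omega> x v" and g = "\<lambda>v. fact n * (\<Prod>j<2*n. v j \<bullet> e (Suc j))"])
       (blast intro: zero_less_one)+
  also have "(\<lambda>v. \<omega> x v * (fact n * (\<Prod>j<2*n. v (1 + j) \<bullet> e (Suc j)))) =
    (\<lambda>v. (\<Sum>m<n. (fact n / 2 * (x \<bullet> e (Suc (2*m)))) * ((v 0 \<bullet> e (Suc (2*m+1))) * (\<Prod>j<2*n. v (1 + j) \<bullet> e (Suc j))) -
        (fact n / 2 * (x \<bullet> e (Suc (2*m+1)))) * ((v 0 \<bullet> e (Suc (2*m))) * (\<Prod>j<2*n. v (1 + j) \<bullet> e (Suc j))))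
        - fact n * ((v 0 \<bullet> e (2*n+1)) * (\<Prod>j<2*n. v (1 + j) \<bullet> e (Suc j))))"
    by (simp add: \<omega> rotation_form_shift coord_form_def fun_eq_iff left_diff_distrib right_diff_distrib
         sum_distrib_left sum_distrib_right sum_subtractf mult_ac)
  also have "alternation (1 + 2*n) \<dots> w = (\<Sum>m<n. (fact n / 2 * (x \<bullet> e (Suc (2*m)))) * ?A (e (Suc (2*m+1))) -
        (fact n / 2 * (x \<bullet> e (Suc (2*m+1)))) * ?A (e (Suc (2*m)))) - fact n * ?A (e (2*n+1))"
    unfolding alternation_diff alternation_sum alternation_cmult ..
  also have "\<dots> = - fact n * ?A (e (2*n+1))"
    using zero by simp
  finally show ?thesis unfolding row .
qed
section \<open>Determinants of frames\<close>

lemma frame_det_eq_det: "frame_det m \<epsilon> w = det (mat m m (\<lambda>(i,j). w j \<bullet> \<epsilon> i))"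
  unfolding frame_det_def by (rule alternation_prod_eq_det)

lemma orthonormal_enumeration:
  fixes f :: "nat \<Rightarrow> 'a::euclidean_space"
  assumes "bij_betw f A Basis" "i \<in> A" "j \<in> A"
  shows "f i \<bullet> f j = (if i = j then 1 else 0)"
proof -
  have "f i \<in> Basis" "f j \<in> Basis" using assms by (auto simp: bij_betw_def)
  moreover have "f i = f j \<longleftrightarrow> i = j" using assms by (auto simp: bij_betw_def inj_on_def)
  ultimately show ?thesis by (simp add: inner_Basis)
qed

lemma det_diagonal:
  "det (mat m m (\<lambda>(i,j). if i = j then d i else 0)) = (\<Prod>i<m. d i :: real)"
proof -
  have "det (mat m m (\<lambda>(i,j). if i = j then d i else 0)) = prod_list (diag_mat (mat m m (\<lambda>(i,j). if i = j then d i else 0)))"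
    by (rule det_upper_triangular[where n = m]) auto
  also have "diag_mat (mat m m (\<lambda>(i,j). if i = j then d i else 0)) = map d [0..<m]"
    by (auto simp: diag_mat_def)
  also have "prod_list (map d [0..<m]) = (\<Prod>i\<in>set [0..<m]. d i)"
    by (rule prod.distinct_set_conv_list[symmetric]) simp
  also have "set [0..<m] = {..<m}" by auto
  finally show ?thesis .
qed

text \<open>
  Expansion along row \<open>d\<close>, whose only entry is in column \<open>p\<close>. The cofactor of this entry does not involve
  column \<open>p\<close>.
\<close>

lemma frame_det_column:
  assumes on: "\<And>i. i < m \<Longrightarrow> \<epsilon> d \<bullet> \<epsilon> i = (if i = d then 1 else 0)"
    and "p < m" "d < m" and zero: "\<And>j. j < m \<Longrightarrow> j \<noteq> p \<Longrightarrow> w j \<bullet> \<epsilon> d = 0"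
  shows "frame_det m \<epsilon> w = (w p \<bullet> \<epsilon> d) * frame_det m \<epsilon> (w(p := \<epsilon> d))"
proof -
  let ?A = "\<lambda>w. mat m m (\<lambda>(i,j). w j \<bullet> \<epsilon> i)"
  let ?w = "w(p := \<epsilon> d)"
  have lap: "det (?A w) = (w p \<bullet> \<epsilon> d) * cofactor (?A w) d p" if "\<And>j. j < m \<Longrightarrow> j \<noteq> p \<Longrightarrow> w j \<bullet> \<epsilon> d = 0" for w
  proof -
    have "det (?A w) = (\<Sum>j<m. ?A w $$ (d,j) * cofactor (?A w) d j)"
      by (rule laplace_expansion_row) (use assms in auto)
    also have "\<dots> = (\<Sum>j<m. if j = p then (w p \<bullet> \<epsilon> d) * cofactor (?A w) d p else 0)"
      by (intro sum.cong refl) (use that assms in auto)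
    also have "\<dots> = (w p \<bullet> \<epsilon> d) * cofactor (?A w) d p" using assms by simp
    finally show ?thesis .
  qed
  have "mat_delete (?A w) d p = mat_delete (?A ?w) d p"
    unfolding mat_delete_def by (intro eq_matI) (auto simp: less_diff_conv)
  then have "cofactor (?A w) d p = cofactor (?A ?w) d p" by (simp add: cofactor_def)
  moreover have "\<epsilon> d \<bullet> \<epsilon> d = 1" using on[of d] assms by simp
  ultimately show ?thesis unfolding frame_det_eq_det using lap[of w] lap[of ?w] zero by simp
qed

text \<open>
  As a function of \<open>v\<close> the left side is an alternating form of top degree, hence a multiple of the
  determinant. As matrices, the vectors \<open>u, L \<circ> v\<close> arise from \<open>u, L \<circ> c\<close> by multiplication with a block
  matrix which is the identity on the first \<open>p\<close> columns.
\<close>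

lemma frame_det_linear_image:
  fixes L :: "'p::euclidean_space \<Rightarrow> 'a::euclidean_space"
  assumes L: "linear L" and c: "bij_betw c {0..<m} Basis"
  shows "frame_det (p + m) \<epsilon> (\<lambda>i. if i < p then u i else L (v (i - p))) =
     frame_det (p + m) \<epsilon> (\<lambda>i. if i < p then u i else L (c (i - p))) * frame_det m c v"
proof -
  let ?A = "\<lambda>w. mat (p+m) (p+m) (\<lambda>(i,j). w j \<bullet> \<epsilon> i)"
  let ?w = "\<lambda>v i. if i < p then u i else L (v (i - p))"
  let ?V = "mat m m (\<lambda>(i,j). v j \<bullet> c i)"
  let ?W = "four_block_mat (1\<^sub>m p) (0\<^sub>m p m) (0\<^sub>m m p) ?V"
  have Lrep: "L x \<bullet> a = (\<Sum>l<m. (L (c l) \<bullet> a) * (x \<bullet> c l))" for x a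
  proof -
    have "x = (\<Sum>b\<in>Basis. (x \<bullet> b) *\<^sub>R b)" by (simp add: euclidean_representation)
    also have "\<dots> = (\<Sum>l<m. (x \<bullet> c l) *\<^sub>R c l)"
      using sum.reindex_bij_betw[OF c, of "\<lambda>b. (x \<bullet> b) *\<^sub>R b"] by (simp add: lessThan_atLeast0)
    finally have "L x = L (\<Sum>l<m. (x \<bullet> c l) *\<^sub>R c l)" by (rule arg_cong)
    also have "\<dots> = (\<Sum>l<m. (x \<bullet> c l) *\<^sub>R L (c l))"
      by (simp only: linear_sum[OF L] linear_scale[OF L])
    finally have "L x = (\<Sum>l<m. (x \<bullet> c l) *\<^sub>R L (c l))" .
    then show ?thesis by (simp add: inner_sum_left mult.commute)
  qed
  have split: "(\<Sum>k<p+r. f k) = (\<Sum>k<p. f k) + (\<Sum>k<r. f (p + k))" for f :: "nat \<Rightarrow> real" and r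
    by (induction r) simp_all
  have "?A (?w v) = ?A (?w c) * ?W"
  proof (rule eq_matI)
    fix i j assume ij: "i < dim_row (?A (?w c) * ?W)" "j < dim_col (?A (?w c) * ?W)"
    then have i: "i < p + m" and j: "j < p + m" by auto
    have "(?A (?w c) * ?W) $$ (i,j) = (\<Sum>k<p+m. ?A (?w c) $$ (i,k) * ?W $$ (k,j))"
      using i j by (simp add: scalar_prod_def lessThan_atLeast0)
    also have "\<dots> = (\<Sum>k<p. ?A (?w c) $$ (i,k) * ?W $$ (k,j)) + (\<Sum>k<m. ?A (?w c) $$ (i,p+k) * ?W $$ (p+k,j))"
      by (rule split)
    also have "\<dots> = ?A (?w v) $$ (i,j)"
    proof (cases "j < p")
      case True
      then have "(\<Sum>k<p. ?A (?w c) $$ (i,k) * ?W $$ (k,j)) = (\<Sum>k<p. if k = j then u j \<bullet> \<epsilon> i else 0)"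
        using i by (intro sum.cong) auto
      then show ?thesis using True i by simp
    next
      case False
      then have "(\<Sum>k<m. ?A (?w c) $$ (i,p+k) * ?W $$ (p+k,j)) = L (v (j - p)) \<bullet> \<epsilon> i"
        unfolding Lrep[of "v (j - p)"] using i j by (intro sum.cong) auto
      then show ?thesis using False i j by simp
    qed
    finally show "?A (?w v) $$ (i,j) = (?A (?w c) * ?W) $$ (i,j)" ..
  qed auto
  moreover have "det ?W = det ?V"
    by (subst det_four_block_mat_lower_left_zero[where n = p and m = m]) auto
  ultimately show ?thesis unfolding frame_det_eq_det
    by (simp add: det_mult[where n = "p+m"])
qed

text \<open>
  If \<open>A\<close> has the columns \<open>w\<close> and \<open>S\<close> is the diagonal matrix of the signs \<open>s\<close>, then \<open>A\<^sup>T S A\<close> is the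
  diagonal matrix of the \<open>d i\<close>.
\<close>

lemma frame_det_Gram:
  assumes s: "\<And>l. l < m \<Longrightarrow> \<bar>s l\<bar> = 1"
    and orth: "\<And>i j. i < m \<Longrightarrow> j < m \<Longrightarrow>
       (\<Sum>l<m. s l * (w i \<bullet> \<epsilon> l) * (w j \<bullet> \<epsilon> l)) = (if i = j then d i else 0)"
  shows "(frame_det m \<epsilon> w)\<^sup>2 = \<bar>\<Prod>i<m. d i\<bar>"
proof -
  let ?A = "mat m m (\<lambda>(i,j). w j \<bullet> \<epsilon> i)"
  let ?S = "mat m m (\<lambda>(i,j). if i = j then s i else 0)"
  have SA: "?S * ?A = mat m m (\<lambda>(i,j). s i * (w j \<bullet> \<epsilon> i))"
  proof (rule eq_matI)
    fix i j assume "i < dim_row (mat m m (\<lambda>(i,j). s i * (w j \<bullet> \<epsilon> i)))" "j < dim_col (mat m m (\<lambda>(i,j). s i * (w j \<bullet> \<epsilon> i)))"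
    then have ij: "i < m" "j < m" by auto
    then have "(?S * ?A) $$ (i,j) = (\<Sum>k\<in>{0..<m}. (if i = k then s i else 0) * (w j \<bullet> \<epsilon> k))"
      by (simp add: scalar_prod_def)
    also have "\<dots> = (\<Sum>k\<in>{0..<m}. if k = i then s i * (w j \<bullet> \<epsilon> i) else 0)"
      by (intro sum.cong) auto
    also have "\<dots> = s i * (w j \<bullet> \<epsilon> i)" using ij by simp
    finally show "(?S * ?A) $$ (i,j) = mat m m (\<lambda>(i,j). s i * (w j \<bullet> \<epsilon> i)) $$ (i,j)" using ij by simp
  qed auto
  have "transpose_mat ?A * (?S * ?A) = mat m m (\<lambda>(i,j). if i = j then d i else 0)"
    unfolding SA
  proof (rule eq_matI)
    fix i j assume "i < dim_row (mat m m (\<lambda>(i,j). if i = j then d i else 0))" "j < dim_col (mat m m (\<lambda>(i,j). if i = j then d i else 0))"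
    then have ij: "i < m" "j < m" by auto
    then have "(transpose_mat ?A * mat m m (\<lambda>(i,j). s i * (w j \<bullet> \<epsilon> i))) $$ (i,j) =
        (\<Sum>k\<in>{0..<m}. (w i \<bullet> \<epsilon> k) * (s k * (w j \<bullet> \<epsilon> k)))"
      by (simp add: scalar_prod_def)
    also have "\<dots> = (\<Sum>k<m. s k * (w i \<bullet> \<epsilon> k) * (w j \<bullet> \<epsilon> k))"
      unfolding lessThan_atLeast0 by (intro sum.cong) (auto simp: mult_ac)
    also have "\<dots> = (if i = j then d i else 0)" by (rule orth[OF ij])
    finally show "(transpose_mat ?A * mat m m (\<lambda>(i,j). s i * (w j \<bullet> \<epsilon> i))) $$ (i,j) =
       mat m m (\<lambda>(i,j). if i = j then d i else 0) $$ (i,j)" using ij by simp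
  qed auto
  then have "det (transpose_mat ?A * (?S * ?A)) = (\<Prod>i<m. d i)" by (simp add: det_diagonal)
  moreover have "det (transpose_mat ?A * (?S * ?A)) = det ?A * (det ?S * det ?A)"
  proof -
    have A: "?A \<in> carrier_mat m m" and S: "?S \<in> carrier_mat m m" by simp_all
    then have T: "transpose_mat ?A \<in> carrier_mat m m" and SA': "?S * ?A \<in> carrier_mat m m" by auto
    show ?thesis by (simp only: det_mult[OF T SA'] det_mult[OF S A] det_transpose[OF A])
  qed
  ultimately have "(\<Prod>i<m. d i) = (\<Prod>i<m. s i) * (frame_det m \<epsilon> w)\<^sup>2"
    by (simp only: det_diagonal frame_det_eq_det power2_eq_square mult_ac)
  moreover have "\<bar>\<Prod>i<m. s i\<bar> = 1" unfolding abs_prod using s by simp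
  ultimately show ?thesis by (simp add: abs_mult)
qed
section \<open>Spherical coordinates\<close>

text \<open>
  Spherical coordinates of the unit sphere in the coordinates \<open>a, \<dots>, 2n\<close>, with the angles
  \<open>\<phi> a, \<dots>, \<phi> (2n - 1)\<close>. The functions \<open>sigma\<close> are the case \<open>a = 1\<close>. The recursion from \<open>a\<close> to \<open>a + 1\<close>
  below reduces all inner products to \<open>sin\<^sup>2 + cos\<^sup>2 = 1\<close>.
\<close>

definition sphere_tail :: "nat \<Rightarrow> (nat \<Rightarrow> real) \<Rightarrow> nat \<Rightarrow> nat \<Rightarrow> real" where
  "sphere_tail n \<phi> a i = (if i < a then 0 else if i = 2*n then \<Prod>l=a..2*n-1. sin (\<phi> l)
     else cos (\<phi> i) * (\<Prod>l=a..i-1. sin (\<phi> l)))"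

text \<open>
  The derivative of \<open>sphere_tail n \<phi> j\<close> with respect to \<open>\<phi> j\<close>. It is a unit vector also where the
  derivative of \<open>sigma\<close>, which carries the factor \<open>sine_product \<phi> j\<close>, vanishes.
\<close>

definition sphere_tangent :: "nat \<Rightarrow> (nat \<Rightarrow> real) \<Rightarrow> nat \<Rightarrow> nat \<Rightarrow> real" where
  "sphere_tangent n \<phi> j i = (if i = j then - sin (\<phi> j) else cos (\<phi> j) * sphere_tail n \<phi> (Suc j) i)"

definition sine_product :: "(nat \<Rightarrow> real) \<Rightarrow> nat \<Rightarrow> real" where
  "sine_product \<phi> j = (\<Prod>l=1..j-1. sin (\<phi> l))"

lemma sphere_tail_before: "i < a \<Longrightarrow> sphere_tail n \<phi> a i = 0"
  by (simp add: sphere_tail_def)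

lemma sphere_tail_rec:
  assumes "1 \<le> a" "a < 2*n" "i \<le> 2*n"
  shows "sphere_tail n \<phi> a i = (if i = a then cos (\<phi> a) else 0) + sin (\<phi> a) * sphere_tail n \<phi> (Suc a) i"
proof -
  consider "i < a" | "i = a" | "i > a" by linarith
  then show ?thesis
  proof cases
    case 1 then show ?thesis by (simp add: sphere_tail_def)
  next
    case 2
    have "{a..a-1} = {}" using assms by auto
    then show ?thesis using 2 assms by (simp add: sphere_tail_def)
  next
    case 3
    have "(\<Prod>l=a..m. sin (\<phi> l)) = sin (\<phi> a) * (\<Prod>l=Suc a..m. sin (\<phi> l))" if "a \<le> m" for m
      using that by (simp add: prod.atLeast_Suc_atMost)
    then show ?thesis using 3 assms by (simp add: sphere_tail_def)
  qed
qed

lemma sphere_tail_top: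
  assumes "1 \<le> n" "i \<le> 2*n"
  shows "sphere_tail n \<phi> (2*n) i = (if i = 2*n then 1 else 0)"
proof -
  have "{2*n..2*n-1} = {}" using assms by auto
  then show ?thesis using assms(2) by (simp add: sphere_tail_def)
qed

lemma sum_delta_combination:
  fixes A B :: real
  assumes "a \<in> {1..K::nat}" "\<And>i. i \<in> {1..K} \<Longrightarrow> f i = (if i = a then A else 0) + B * t i"
  shows "(\<Sum>i=1..K. f i * g i) = A * g a + B * (\<Sum>i=1..K. t i * g i)"
proof -
  have "(\<Sum>i=1..K. f i * g i) = (\<Sum>i=1..K. (if i = a then A * g a else 0) + B * (t i * g i))"
    by (intro sum.cong refl) (simp add: assms algebra_simps)
  then show ?thesis using assms(1) by (simp add: sum.distrib sum_distrib_left)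
qed

lemma sphere_tangent_alt:
  "sphere_tangent n \<phi> j i = (if i = j then - sin (\<phi> j) else 0) + cos (\<phi> j) * sphere_tail n \<phi> (Suc j) i"
  by (simp add: sphere_tangent_def sphere_tail_before)

lemma sphere_tail_unit:
  assumes "1 \<le> a" "a \<le> 2*n"
  shows "(\<Sum>i=1..2*n. sphere_tail n \<phi> a i * sphere_tail n \<phi> a i) = 1"
  using assms(2,1)
proof (induction a rule: inc_induct)
  case base
  have "(\<Sum>i=1..2*n. sphere_tail n \<phi> (2*n) i * sphere_tail n \<phi> (2*n) i) = (\<Sum>i=1..2*n. if i = 2*n then 1 else 0)"
    by (intro sum.cong) (use base in \<open>auto simp: sphere_tail_top\<close>)
  then show ?case using base by simp
next
  case (step a)
  let ?t = "sphere_tail n \<phi>"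
  have rec: "?t a i = (if i = a then cos (\<phi> a) else 0) + sin (\<phi> a) * ?t (Suc a) i" if "i \<in> {1..2*n}" for i
    using sphere_tail_rec[of a n i] step that by simp
  have a: "a \<in> {1..2*n}" using step by simp
  have "(\<Sum>i=1..2*n. ?t (Suc a) i * ?t a i) = (\<Sum>i=1..2*n. ?t a i * ?t (Suc a) i)"
    by (simp add: mult.commute)
  also have "\<dots> = sin (\<phi> a)"
    using step by (subst sum_delta_combination[OF a rec]) (simp_all add: sphere_tail_before)
  finally have "(\<Sum>i=1..2*n. ?t a i * ?t a i) = cos (\<phi> a) * ?t a a + sin (\<phi> a) * sin (\<phi> a)"
    by (subst sum_delta_combination[OF a rec]) simp_all
  also have "?t a a = cos (\<phi> a)" using rec[OF a] by (simp add: sphere_tail_before)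
  finally show ?case using sin_cos_squared_add[of "\<phi> a"] by (simp add: power2_eq_square)
qed

lemma sphere_tangent_unit:
  assumes "1 \<le> j" "j < 2*n"
  shows "(\<Sum>i=1..2*n. sphere_tangent n \<phi> j i * sphere_tangent n \<phi> j i) = 1"
proof -
  let ?t = "sphere_tail n \<phi>" and ?\<kappa> = "sphere_tangent n \<phi>"
  have j: "j \<in> {1..2*n}" using assms by simp
  have "(\<Sum>i=1..2*n. ?t (Suc j) i * ?\<kappa> j i) = (\<Sum>i=1..2*n. ?\<kappa> j i * ?t (Suc j) i)"
    by (simp add: mult.commute)
  also have "\<dots> = cos (\<phi> j)"
    using sphere_tail_unit[of "Suc j" n \<phi>] assms
    by (subst sum_delta_combination[OF j sphere_tangent_alt]) (simp_all add: sphere_tail_before)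
  finally have "(\<Sum>i=1..2*n. ?\<kappa> j i * ?\<kappa> j i) = - sin (\<phi> j) * ?\<kappa> j j + cos (\<phi> j) * cos (\<phi> j)"
    by (subst sum_delta_combination[OF j sphere_tangent_alt]) simp_all
  then show ?thesis using sin_cos_squared_add[of "\<phi> j"]
    by (simp add: power2_eq_square sphere_tangent_def)
qed

text \<open>
  For \<open>b = j\<close> this is the orthogonality of \<open>(cos, sin)\<close> and \<open>(-sin, cos)\<close>. Lowering \<open>b\<close> multiplies
  the vector by a sine and adds a multiple of a basis vector in front of the entries of the tangent
  vector.
\<close>

lemma sphere_tail_tangent_orthogonal:
  assumes "1 \<le> b" "b \<le> j" "j < 2*n"
  shows "(\<Sum>i=1..2*n. sphere_tail n \<phi> b i * sphere_tangent n \<phi> j i) = 0"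
  using assms(2,1)
proof (induction b rule: inc_induct)
  case base
  let ?t = "sphere_tail n \<phi>" and ?\<kappa> = "sphere_tangent n \<phi>"
  have j: "j \<in> {1..2*n}" using assms base by simp
  have rec: "?t j i = (if i = j then cos (\<phi> j) else 0) + sin (\<phi> j) * ?t (Suc j) i" if "i \<in> {1..2*n}" for i
    using sphere_tail_rec[of j n i] base assms that by simp
  have "(\<Sum>i=1..2*n. ?t (Suc j) i * ?\<kappa> j i) = (\<Sum>i=1..2*n. ?\<kappa> j i * ?t (Suc j) i)"
    by (simp add: mult.commute)
  also have "\<dots> = cos (\<phi> j)"
    using sphere_tail_unit[of "Suc j" n \<phi>] assms
    by (subst sum_delta_combination[OF j sphere_tangent_alt]) (simp_all add: sphere_tail_before)
  finally show ?case
    by (subst sum_delta_combination[OF j rec]) (simp_all add: sphere_tangent_def)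
next
  case (step b)
  have b: "b \<in> {1..2*n}" using step assms by simp
  have rec: "sphere_tail n \<phi> b i = (if i = b then cos (\<phi> b) else 0) + sin (\<phi> b) * sphere_tail n \<phi> (Suc b) i" if "i \<in> {1..2*n}" for i
    using sphere_tail_rec[of b n i] step assms that by simp
  show ?case using step
    by (subst sum_delta_combination[OF b rec]) (simp_all add: sphere_tangent_def sphere_tail_before)
qed

lemma sphere_tangent_orthogonal:
  assumes "1 \<le> a" "a < j" "j < 2*n"
  shows "(\<Sum>i=1..2*n. sphere_tangent n \<phi> a i * sphere_tangent n \<phi> j i) = 0"
proof -
  have a: "a \<in> {1..2*n}" using assms by simp
  show ?thesis
    using sphere_tail_tangent_orthogonal[of "Suc a" j n \<phi>] assms
    by (subst sum_delta_combination[OF a sphere_tangent_alt]) (simp_all add: sphere_tangent_def sphere_tail_before)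
qed

lemma sigma_eq_sphere_tail: "1 \<le> i \<Longrightarrow> sigma n \<phi> i = sphere_tail n \<phi> 1 i"
  by (auto simp: sigma_def sphere_tail_def)

lemma sigma_split:
  assumes "1 \<le> j" "j \<le> i" "i \<le> 2*n"
  shows "sigma n \<phi> i = sine_product \<phi> j * sphere_tail n \<phi> j i"
proof -
  have split: "(\<Prod>l=1..m. sin (\<phi> l)) = sine_product \<phi> j * (\<Prod>l=j..m. sin (\<phi> l))" if "j - 1 \<le> m" for m
  proof -
    have "{1..m} = {1..j-1} \<union> {j..m}" "{1..j-1} \<inter> {j..m} = {}" using that assms by auto
    then show ?thesis unfolding sine_product_def by (metis finite_atLeastAtMost prod.union_disjoint)
  qed
  show ?thesis using assms split[of "2*n-1"] split[of "i-1"] by (simp add: sigma_def sphere_tail_def)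
qed

lemma sphere_tail_cong: "(\<And>l. a \<le> l \<Longrightarrow> \<phi> l = \<psi> l) \<Longrightarrow> sphere_tail n \<phi> a i = sphere_tail n \<psi> a i"
  by (auto simp: sphere_tail_def intro!: prod.cong)

text \<open>
  The entries before \<open>j\<close> do not depend on \<open>\<phi> j\<close>, and the others are \<open>sine_product \<phi> j\<close>, which does not
  depend on it either, times \<open>sphere_tail n \<phi> j\<close>.
\<close>

lemma sigma_has_derivative_angle:
  assumes j: "1 \<le> j" "j < 2*n" and i: "1 \<le> i" "i \<le> 2*n"
  shows "((\<lambda>t. sigma n (\<lambda>l. \<phi> l + (if l = j then t else 0)) i) has_real_derivative
            sine_product \<phi> j * sphere_tangent n \<phi> j i) (at 0)"
proof (cases "i < j")
  case True
  have "sigma n (\<lambda>l. \<phi> l + (if l = j then t else 0)) i = sigma n \<phi> i" for t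
    using True j by (auto simp: sigma_def intro!: prod.cong)
  then show ?thesis using True by (simp add: sphere_tangent_def sphere_tail_before)
next
  case False
  have "sine_product (\<lambda>l. \<phi> l + (if l = j then t else 0)) j = sine_product \<phi> j" for t
    using j by (auto simp: sine_product_def intro!: prod.cong)
  moreover have "sphere_tail n (\<lambda>l. \<phi> l + (if l = j then t else 0)) (Suc j) i = sphere_tail n \<phi> (Suc j) i" for t
    by (rule sphere_tail_cong) auto
  ultimately have eq: "sigma n (\<lambda>l. \<phi> l + (if l = j then t else 0)) i =
      sine_product \<phi> j * ((if i = j then cos (\<phi> j + t) else 0) + sin (\<phi> j + t) * sphere_tail n \<phi> (Suc j) i)" for t
    using False i j by (subst sigma_split[of j i n]) (auto simp: sphere_tail_rec)
  show ?thesis unfolding eq sphere_tangent_alt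
    by (cases "i = j") (auto intro!: derivative_eq_intros simp: algebra_simps)
qed

text \<open>
  The common form of the three coordinate systems. The radial profile \<open>\<rho>\<close> is \<open>r\<close>, \<open>sin (k r)\<close> or
  \<open>sinh (k r)\<close>, and the axial profile \<open>\<zeta>\<close> is \<open>0\<close>, \<open>cos (k r)\<close> or \<open>cosh (k r)\<close>.
\<close>

definition polar_map :: "(real \<Rightarrow> real) \<Rightarrow> (real \<Rightarrow> real) \<Rightarrow> nat \<Rightarrow> (nat \<Rightarrow> 'a::euclidean_space) \<Rightarrow>
    (nat \<Rightarrow> 'p::euclidean_space) \<Rightarrow> 'p \<Rightarrow> 'a" where
  "polar_map \<rho> \<zeta> n e c q = (\<Sum>i=1..2*n. (\<rho> (q \<bullet> c 0) * sigma n (\<lambda>l. q \<bullet> c l) i) *\<^sub>R e i)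
     + \<zeta> (q \<bullet> c 0) *\<^sub>R e (2*n+1)"

lemma differentiable_prod_sin:
  "finite A \<Longrightarrow> (\<lambda>q. \<Prod>l\<in>A. sin (q \<bullet> c l)) differentiable (at q)"
proof (induction A rule: finite_induct)
  case (insert l A)
  have "(\<lambda>q. sin (q \<bullet> c l)) differentiable (at q)"
    unfolding differentiable_def
    by (rule exI[of _ "\<lambda>h. cos (q \<bullet> c l) * (h \<bullet> c l)"]) (auto intro!: derivative_eq_intros)
  then show ?case using insert by (simp add: differentiable_mult)
qed simp

lemma differentiable_sigma: "(\<lambda>q. sigma n (\<lambda>l. q \<bullet> c l) i) differentiable (at q)"
proof -
  have "(\<lambda>q. cos (q \<bullet> c i)) differentiable (at q)"
    unfolding differentiable_def
    by (rule exI[of _ "\<lambda>h. - sin (q \<bullet> c i) * (h \<bullet> c i)"]) (auto intro!: derivative_eq_intros)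
  then show ?thesis by (cases "i = 2*n") (auto simp: sigma_def intro!: differentiable_mult differentiable_prod_sin)
qed

lemma differentiable_polar_map:
  assumes "(\<rho> has_real_derivative \<rho>') (at (q \<bullet> c 0))" "(\<zeta> has_real_derivative \<zeta>') (at (q \<bullet> c 0))"
  shows "polar_map \<rho> \<zeta> n e c differentiable (at q)"
proof -
  have *: "(\<lambda>q. f (q \<bullet> c 0)) differentiable (at q)" if "(f has_real_derivative f') (at (q \<bullet> c 0))" for f f'
  proof -
    have "((\<lambda>q. q \<bullet> c 0) has_derivative (\<lambda>h. h \<bullet> c 0)) (at q)" by (auto intro!: derivative_eq_intros)
    from has_derivative_compose[OF this that[unfolded has_field_derivative_def]] show ?thesis
      unfolding differentiable_def by blast
  qed
  show ?thesis unfolding polar_map_def[abs_def]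
    by (intro differentiable_add differentiable_sum differentiable_scaleR differentiable_mult differentiable_sigma
         *[OF assms(1)] *[OF assms(2)] differentiable_const ballI finite_atLeastAtMost)
qed

lemma has_vector_derivative_along_line:
  assumes "f differentiable (at q)"
  shows "((\<lambda>t. f (q + t *\<^sub>R u)) has_vector_derivative frechet_derivative f (at q) u) (at 0)"
proof -
  have f: "(f has_derivative frechet_derivative f (at q)) (at (q + 0 *\<^sub>R u))"
    using assms by (simp add: frechet_derivative_works)
  have "((\<lambda>t. q + t *\<^sub>R u) has_derivative (\<lambda>t. t *\<^sub>R u)) (at 0)" by (auto intro!: derivative_eq_intros)
  from has_derivative_compose[OF this f]
  show ?thesis unfolding has_vector_derivative_def
    using linear_frechet_derivative[OF assms] by (simp add: linear_scale)
qed

text \<open>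
  Along the line through \<open>q\<close> in the direction of a basis vector only one coordinate varies, so the
  derivative in that direction is found in one variable.
\<close>

lemma polar_map_derivative:
  fixes c :: "nat \<Rightarrow> 'p::euclidean_space" and e :: "nat \<Rightarrow> 'a::euclidean_space"
  assumes \<rho>: "(\<rho> has_real_derivative \<rho>') (at (q \<bullet> c 0))" and \<zeta>: "(\<zeta> has_real_derivative \<zeta>') (at (q \<bullet> c 0))"
    and c: "bij_betw c {0..<2*n} Basis" and n: "n \<ge> 1"
  shows "frechet_derivative (polar_map \<rho> \<zeta> n e c) (at q) (c 0) =
      (\<Sum>i=1..2*n. (\<rho>' * sigma n (\<lambda>l. q \<bullet> c l) i) *\<^sub>R e i) + \<zeta>' *\<^sub>R e (2*n+1)" (is ?radial)
    and "1 \<le> j \<Longrightarrow> j < 2*n \<Longrightarrow> frechet_derivative (polar_map \<rho> \<zeta> n e c) (at q) (c j) =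
      (\<Sum>i=1..2*n. (\<rho> (q \<bullet> c 0) * (sine_product (\<lambda>l. q \<bullet> c l) j * sphere_tangent n (\<lambda>l. q \<bullet> c l) j i)) *\<^sub>R e i)"
      (is "_ \<Longrightarrow> _ \<Longrightarrow> ?angular j")
proof -
  note line = has_vector_derivative_along_line[OF differentiable_polar_map[where n = n and e = e and q = q and c = c, OF \<rho> \<zeta>]]
  have on: "c i \<bullet> c j = (if i = j then 1 else 0)" if "i < 2*n" "j < 2*n" for i j
    using orthonormal_enumeration[OF c, of i j] that by simp
  have sig_cong: "sigma n \<phi> i = sigma n \<psi> i" if "i \<in> {1..2*n}" "\<And>l. l \<in> {1..<2*n} \<Longrightarrow> \<phi> l = \<psi> l" for \<phi> \<psi> i
    using that by (auto simp: sigma_def intro!: prod.cong arg_cong2[where f = "(*)"] arg_cong[where f=cos] arg_cong[where f=sin])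
  show ?radial
  proof (rule vector_derivative_unique_at[OF line])
    have eq: "polar_map \<rho> \<zeta> n e c (q + t *\<^sub>R c 0) = (\<Sum>i=1..2*n. (\<rho> (q \<bullet> c 0 + t) * sigma n (\<lambda>l. q \<bullet> c l) i) *\<^sub>R e i)
       + \<zeta> (q \<bullet> c 0 + t) *\<^sub>R e (2*n+1)" for t
    proof -
      have "sigma n (\<lambda>l. (q + t *\<^sub>R c 0) \<bullet> c l) i = sigma n (\<lambda>l. q \<bullet> c l) i" if "i \<in> {1..2*n}" for i
        by (rule sig_cong[OF that]) (simp add: inner_left_distrib on)
      moreover have "(q + t *\<^sub>R c 0) \<bullet> c 0 = q \<bullet> c 0 + t" using n by (simp add: inner_left_distrib on)
      ultimately show ?thesis by (simp add: polar_map_def)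
    qed
    have sh: "((\<lambda>t. f (q \<bullet> c 0 + t)) has_real_derivative f') (at 0)" if "(f has_real_derivative f') (at (q \<bullet> c 0))" for f f'
      using that DERIV_shift[of f f' 0 "q \<bullet> c 0"] by (simp add: add.commute)
    note sh[OF \<rho>, derivative_intros] and sh[OF \<zeta>, derivative_intros]
    show "((\<lambda>t. polar_map \<rho> \<zeta> n e c (q + t *\<^sub>R c 0)) has_vector_derivative
       (\<Sum>i=1..2*n. (\<rho>' * sigma n (\<lambda>l. q \<bullet> c l) i) *\<^sub>R e i) + \<zeta>' *\<^sub>R e (2*n+1)) (at 0)"
      unfolding eq by (auto intro!: derivative_eq_intros sh[OF \<rho>] sh[OF \<zeta>])
  qed
  show "?angular j" if j: "1 \<le> j" "j < 2*n"
  proof (rule vector_derivative_unique_at[OF line])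
    let ?\<phi> = "\<lambda>l. q \<bullet> c l"
    have eq: "polar_map \<rho> \<zeta> n e c (q + t *\<^sub>R c j) = (\<Sum>i=1..2*n. (\<rho> (q \<bullet> c 0) * sigma n (\<lambda>l. ?\<phi> l + (if l = j then t else 0)) i) *\<^sub>R e i)
       + \<zeta> (q \<bullet> c 0) *\<^sub>R e (2*n+1)" for t
    proof -
      have "sigma n (\<lambda>l. (q + t *\<^sub>R c j) \<bullet> c l) i = sigma n (\<lambda>l. ?\<phi> l + (if l = j then t else 0)) i" if "i \<in> {1..2*n}" for i
        by (rule sig_cong[OF that]) (use j in \<open>auto simp: inner_left_distrib on\<close>)
      moreover have "(q + t *\<^sub>R c j) \<bullet> c 0 = q \<bullet> c 0" using j by (simp add: inner_left_distrib on)
      ultimately show ?thesis by (simp add: polar_map_def)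
    qed
    show "((\<lambda>t. polar_map \<rho> \<zeta> n e c (q + t *\<^sub>R c j)) has_vector_derivative
       (\<Sum>i=1..2*n. (\<rho> (q \<bullet> c 0) * (sine_product ?\<phi> j * sphere_tangent n ?\<phi> j i)) *\<^sub>R e i)) (at 0)"
      unfolding eq
      by (auto intro!: derivative_eq_intros has_vector_derivative_sum sigma_has_derivative_angle[OF j]
          simp: mult.commute mult.left_commute)
  qed
qed

text \<open>
  The product of the lengths of the angular coordinate vectors: the factor \<open>sin (\<phi> l)\<close> occurs for each
  \<open>j\<close> with \<open>l < j \<le> m\<close>.
\<close>

lemma prod_sine_product:
  "(\<Prod>j=1..m. sine_product \<phi> j) = (\<Prod>l=1..m-1. sin (\<phi> l) ^ (m - l))"
proof (induction m)
  case (Suc m)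
  show ?case
  proof (cases "m = 0")
    case False
    have "(\<Prod>l=1..m. sin (\<phi> l) ^ (Suc m - l)) = (\<Prod>l=1..m. sin (\<phi> l) ^ (m - l) * sin (\<phi> l))"
      by (intro prod.cong) (auto simp: Suc_diff_le)
    also have "\<dots> = (\<Prod>l=1..m. sin (\<phi> l) ^ (m - l)) * sine_product \<phi> (Suc m)"
      by (simp add: prod.distrib sine_product_def)
    also have "(\<Prod>l=1..m. sin (\<phi> l) ^ (m - l)) = (\<Prod>l=1..m-1. sin (\<phi> l) ^ (m - l))"
      using False by (cases m) simp_all
    finally show ?thesis using Suc by simp
  qed (simp add: sine_product_def)
qed simp

definition polar_vec :: "nat \<Rightarrow> (nat \<Rightarrow> 'a::euclidean_space) \<Rightarrow> (nat \<Rightarrow> real) \<Rightarrow> real \<Rightarrow> 'a" where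
  "polar_vec n e a \<alpha> = (\<Sum>i=1..2*n. a i *\<^sub>R e i) + \<alpha> *\<^sub>R e (2*n+1)"

lemma polar_vec_coord:
  assumes e: "bij_betw e {1..D} Basis" and D: "2*n+1 \<le> D" and k: "1 \<le> k" "k \<le> D"
  shows "polar_vec n e a \<alpha> \<bullet> e k = (if k \<le> 2*n then a k else if k = 2*n+1 then \<alpha> else 0)"
proof -
  have on: "e i \<bullet> e k = (if i = k then 1 else 0)" if "1 \<le> i" "i \<le> D" for i
    using orthonormal_enumeration[OF e, of i k] that k by simp
  have "(\<Sum>i=1..2*n. a i *\<^sub>R e i) \<bullet> e k = (\<Sum>i=1..2*n. if i = k then a k else 0)"
    unfolding inner_sum_left using D by (intro sum.cong) (auto simp: on)
  then show ?thesis using k D by (auto simp: polar_vec_def inner_left_distrib on)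
qed

text \<open>
  The first \<open>2n\<close> coordinates of the \<open>j\<close>-th coordinate vector field of \<open>polar_map\<close>.
\<close>

definition frame_coeff :: "real \<Rightarrow> real \<Rightarrow> nat \<Rightarrow> (nat \<Rightarrow> real) \<Rightarrow> nat \<Rightarrow> nat \<Rightarrow> real" where
  "frame_coeff \<rho> \<rho>' n \<phi> j i = (if j = 0 then \<rho>' * sigma n \<phi> i else \<rho> * (sine_product \<phi> j * sphere_tangent n \<phi> j i))"

lemma sum_sigma_squares:
  assumes "n \<ge> 1"
  shows "(\<Sum>i=1..2*n. sigma n \<phi> i * sigma n \<phi> i) = 1"
proof -
  have "(\<Sum>i=1..2*n. sigma n \<phi> i * sigma n \<phi> i) = (\<Sum>i=1..2*n. sphere_tail n \<phi> 1 i * sphere_tail n \<phi> 1 i)"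
    by (intro sum.cong) (auto simp: sigma_eq_sphere_tail)
  then show ?thesis using sphere_tail_unit[of 1 n \<phi>] assms by simp
qed

lemma sum_sigma_tangent:
  assumes "1 \<le> j" "j < 2*n"
  shows "(\<Sum>i=1..2*n. sigma n \<phi> i * sphere_tangent n \<phi> j i) = 0"
proof -
  have "(\<Sum>i=1..2*n. sigma n \<phi> i * sphere_tangent n \<phi> j i) = (\<Sum>i=1..2*n. sphere_tail n \<phi> 1 i * sphere_tangent n \<phi> j i)"
    by (intro sum.cong) (auto simp: sigma_eq_sphere_tail)
  then show ?thesis using sphere_tail_tangent_orthogonal[of 1 j n \<phi>] assms by simp
qed

lemma sum_scaled_products:
  "(\<Sum>i=1..m. (a * f i) * (b * g i)) = a * b * (\<Sum>i=1..m. f i * g i :: real)"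
  by (simp add: sum_distrib_left mult_ac)

lemma frame_coeff_products:
  assumes n: "n \<ge> 1" and i: "i < 2*n" and j: "j < 2*n"
  shows "(\<Sum>l=1..2*n. frame_coeff \<rho> \<rho>' n \<phi> i l * frame_coeff \<rho> \<rho>' n \<phi> j l) =
    (if i = j then if i = 0 then \<rho>'\<^sup>2 else (\<rho> * sine_product \<phi> i)\<^sup>2 else 0)"
proof -
  have fc: "frame_coeff \<rho> \<rho>' n \<phi> 0 l = \<rho>' * sigma n \<phi> l"
    "j \<noteq> 0 \<Longrightarrow> frame_coeff \<rho> \<rho>' n \<phi> j l = (\<rho> * sine_product \<phi> j) * sphere_tangent n \<phi> j l" for j l
    by (simp_all add: frame_coeff_def)
  have tang: "(\<Sum>l=1..2*n. sphere_tangent n \<phi> i l * sphere_tangent n \<phi> j l) = (if i = j then 1 else 0)"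
    if "i \<noteq> 0" "j \<noteq> 0"
  proof -
    consider "i = j" | "i < j" | "j < i" by linarith
    then show ?thesis
    proof cases
      case 3
      then show ?thesis using sphere_tangent_orthogonal[of j i n \<phi>] that i by (simp add: mult.commute)
    qed (use sphere_tangent_orthogonal[of i j n \<phi>] sphere_tangent_unit[of i n \<phi>] that i j in auto)
  qed
  have comm: "(\<Sum>l=1..2*n. sphere_tangent n \<phi> i l * sigma n \<phi> l) = (\<Sum>l=1..2*n. sigma n \<phi> l * sphere_tangent n \<phi> i l)"
    by (simp add: mult.commute)
  consider "i = 0" "j = 0" | "i = 0" "j \<noteq> 0" | "i \<noteq> 0" "j = 0" | "i \<noteq> 0" "j \<noteq> 0" by blast
  then show ?thesis
  proof cases
    case 1
    show ?thesis unfolding 1 fc(1) sum_scaled_products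
      using sum_sigma_squares[OF n, of \<phi>] by (simp add: power2_eq_square)
  next
    case 2
    show ?thesis unfolding 2(1) fc(1) fc(2)[OF 2(2)] sum_scaled_products
      using sum_sigma_tangent[of j n \<phi>] j 2 by simp
  next
    case 3
    show ?thesis unfolding 3(2) fc(1) fc(2)[OF 3(1)] sum_scaled_products comm
      using sum_sigma_tangent[of i n \<phi>] i 3 by simp
  next
    case 4
    show ?thesis unfolding fc(2)[OF 4(1)] fc(2)[OF 4(2)] sum_scaled_products tang[OF 4]
      using 4 by (simp add: power2_eq_square)
  qed
qed

lemma sum_sigma_frame_coeff:
  assumes "n \<ge> 1" "j < 2*n"
  shows "(\<Sum>i=1..2*n. (a * sigma n \<phi> i) * frame_coeff \<rho> \<rho>' n \<phi> j i) = (if j = 0 then a * \<rho>' else 0)"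
proof (cases "j = 0")
  case True
  then have "(\<Sum>i=1..2*n. (a * sigma n \<phi> i) * frame_coeff \<rho> \<rho>' n \<phi> j i) = (\<Sum>i=1..2*n. (a * sigma n \<phi> i) * (\<rho>' * sigma n \<phi> i))"
    by (simp add: frame_coeff_def)
  then show ?thesis unfolding sum_scaled_products using sum_sigma_squares[OF assms(1), of \<phi>] True by simp
next
  case False
  then have "(\<Sum>i=1..2*n. (a * sigma n \<phi> i) * frame_coeff \<rho> \<rho>' n \<phi> j i) =
      (\<Sum>i=1..2*n. (a * sigma n \<phi> i) * ((\<rho> * sine_product \<phi> j) * sphere_tangent n \<phi> j i))"
    by (simp add: frame_coeff_def mult.assoc)
  then show ?thesis unfolding sum_scaled_products using sum_sigma_tangent[of j n \<phi>] False assms by simp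
qed

lemma polar_map_frame:
  fixes c :: "nat \<Rightarrow> 'p::euclidean_space" and e :: "nat \<Rightarrow> 'a::euclidean_space"
  assumes "(\<rho> has_real_derivative \<rho>') (at (q \<bullet> c 0))" "(\<zeta> has_real_derivative \<zeta>') (at (q \<bullet> c 0))"
    and "bij_betw c {0..<2*n} Basis" "n \<ge> 1" "j < 2*n"
  shows "frechet_derivative (polar_map \<rho> \<zeta> n e c) (at q) (c j) =
    polar_vec n e (frame_coeff (\<rho> (q \<bullet> c 0)) \<rho>' n (\<lambda>l. q \<bullet> c l) j) (if j = 0 then \<zeta>' else 0)"
  using polar_map_derivative[where e = e and q = q and c = c, OF assms(1-4)] assms(5)
  by (cases "j = 0") (simp_all add: polar_vec_def frame_coeff_def)

lemma polar_map_eq_vec: "polar_map \<rho> \<zeta> n e c q = polar_vec n e (\<lambda>i. \<rho> (q \<bullet> c 0) * sigma n (\<lambda>l. q \<bullet> c l) i) (\<zeta> (q \<bullet> c 0))"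
  by (simp add: polar_map_def polar_vec_def)

lemma line_in_open:
  fixes x v :: "'a::real_normed_vector"
  assumes "open K" "x \<in> K"
  obtains \<delta> where "\<delta> > 0" "\<And>t. \<bar>t\<bar> < \<delta> \<Longrightarrow> x + t *\<^sub>R v \<in> K"
proof -
  obtain r where r: "r > 0" "ball x r \<subseteq> K" using assms open_contains_ball by blast
  show ?thesis
  proof (rule that[of "r / (1 + norm v)"])
    have pos: "1 + norm v > 0" by (smt (verit) norm_ge_zero)
    then show "r / (1 + norm v) > 0" using r by simp
    fix t assume "\<bar>t\<bar> < r / (1 + norm v)"
    then have "\<bar>t\<bar> * (1 + norm v) < r" using pos by (simp add: pos_less_divide_eq)
    then have "\<bar>t\<bar> * norm v < r" by (simp add: algebra_simps)
    then show "x + t *\<^sub>R v \<in> K" using r by (auto simp: dist_norm subset_iff)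
  qed
qed

lemma sum_squares_polar_vec:
  assumes e: "bij_betw e {1..D} Basis" and D: "2*n+1 \<le> D" and n: "n \<ge> 1"
    and x: "x = polar_vec n e (\<lambda>i. \<rho> * sigma n \<phi> i) \<zeta>"
  shows "(\<Sum>i=1..2*n. (x \<bullet> e i)\<^sup>2) = \<rho>\<^sup>2"
proof -
  have "(\<Sum>i=1..2*n. (x \<bullet> e i)\<^sup>2) = (\<Sum>i=1..2*n. (\<rho> * sigma n \<phi> i) * (\<rho> * sigma n \<phi> i))"
    using D by (intro sum.cong) (auto simp: x polar_vec_coord[OF e D] power2_eq_square)
  then show ?thesis unfolding sum_scaled_products using sum_sigma_squares[OF n, of \<phi>]
    by (simp add: power2_eq_square)
qed

section \<open>Orthogonal frames and tangent spaces\<close>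

text \<open>
  The ambient symmetric bilinear forms of the models, with all \<open>s l\<close> equal to \<open>1\<close> or \<open>-1\<close>.
\<close>

definition signed_form :: "nat \<Rightarrow> (nat \<Rightarrow> real) \<Rightarrow> (nat \<Rightarrow> 'a::euclidean_space) \<Rightarrow> 'a \<Rightarrow> 'a \<Rightarrow> real" where
  "signed_form m s \<epsilon> u v = (\<Sum>l<m. s l * (u \<bullet> \<epsilon> l) * (v \<bullet> \<epsilon> l))"

lemma signed_form_commute: "signed_form m s \<epsilon> u v = signed_form m s \<epsilon> v u"
  by (simp add: signed_form_def mult_ac)

lemma linear_signed_form: "linear (signed_form m s \<epsilon> u)"
  by (rule linearI) (simp_all add: signed_form_def inner_left_distrib sum_distrib_left sum.distrib[symmetric] algebra_simps)

lemmas signed_form_right = linear_add[OF linear_signed_form] linear_diff[OF linear_signed_form]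
  linear_scale[OF linear_signed_form] linear_0[OF linear_signed_form] linear_sum[OF linear_signed_form]

lemma bounded_bilinear_signed_form:
  fixes \<epsilon> :: "nat \<Rightarrow> 'a::euclidean_space"
  shows "bounded_bilinear (signed_form m s \<epsilon>)"
proof -
  have "(\<lambda>x. signed_form m s \<epsilon> x y) = signed_form m s \<epsilon> y" for y
    using signed_form_commute by blast
  then have "bilinear (signed_form m s \<epsilon>)"
    unfolding bilinear_def by (simp add: linear_signed_form)
  then show ?thesis by (simp add: bilinear_conv_bounded_bilinear)
qed

text \<open>
  The form may be indefinite, so lengths are not available. Pairing a linear combination with \<open>w j\<close>
  extracts its \<open>j\<close>-th coefficient, since \<open>d j\<close> is not zero, and this is all that is needed.
\<close>

lemma orthogonal_frame:
  fixes w :: "nat \<Rightarrow> 'a::euclidean_space"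
  assumes dim: "DIM('a) = m" and nz: "\<And>i. i < m \<Longrightarrow> d i \<noteq> 0"
    and orth: "\<And>i j. i < m \<Longrightarrow> j < m \<Longrightarrow> signed_form r s \<epsilon> (w i) (w j) = (if i = j then d i else 0)"
  shows "inj_on w {..<m}" and "independent (w ` {..<m})"
    and "(\<And>i. i < p \<Longrightarrow> signed_form r s \<epsilon> (w i) v = 0) \<Longrightarrow> p \<le> m \<Longrightarrow> v \<in> span (w ` {p..<m})"
proof -
  let ?B = "signed_form r s \<epsilon>"
  show inj: "inj_on w {..<m}"
  proof (rule inj_onI)
    fix i j assume ij: "i \<in> {..<m}" "j \<in> {..<m}" "w i = w j"
    then have "?B (w i) (w j) = d i" using orth[of i i] by simp
    then show "i = j" using orth[of i j] nz[of i] ij by (auto split: if_splits)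
  qed
  have coeff: "?B (w j) (\<Sum>u\<in>w ` {..<m}. a u *\<^sub>R u) = a (w j) * d j" if j: "j < m" for a j
  proof -
    have "?B (w j) (\<Sum>u\<in>w ` {..<m}. a u *\<^sub>R u) = (\<Sum>i<m. a (w i) * ?B (w j) (w i))"
      by (simp add: signed_form_right sum.reindex[OF inj])
    also have "\<dots> = (\<Sum>i<m. if i = j then a (w j) * d j else 0)"
      using j by (intro sum.cong) (auto simp: orth)
    finally show ?thesis using j by simp
  qed
  show ind: "independent (w ` {..<m})"
    unfolding independent_explicit
  proof (intro conjI allI impI ballI)
    fix a u assume z: "(\<Sum>v\<in>w ` {..<m}. a v *\<^sub>R v) = 0" and "u \<in> w ` {..<m}"
    then obtain j where j: "j < m" "u = w j" by auto
    show "a u = 0" using coeff[OF j(1), of a] nz[OF j(1)] unfolding z by (simp add: signed_form_right j)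
  qed simp
  show "v \<in> span (w ` {p..<m})" if v: "\<And>i. i < p \<Longrightarrow> ?B (w i) v = 0" and p: "p \<le> m"
  proof -
    have "UNIV \<subseteq> span (w ` {..<m})"
      by (rule card_ge_dim_independent[OF _ ind]) (auto simp: card_image[OF inj] dim)
    then have "v \<in> span (w ` {..<m})" by auto
    then obtain a where a: "v = (\<Sum>u\<in>w ` {..<m}. a u *\<^sub>R u)" by (auto simp: span_finite)
    show ?thesis unfolding a
    proof (rule span_sum)
      fix u assume "u \<in> w ` {..<m}"
      then obtain j where j: "j < m" "u = w j" by auto
      show "a u *\<^sub>R u \<in> span (w ` {p..<m})"
      proof (cases "j < p")
        case True
        then have "a u = 0" using coeff[OF j(1), of a] v[OF True] nz[OF j(1)] a j by auto
        then show ?thesis by (simp add: span_zero)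
      next
        case False
        then show ?thesis using j by (intro span_scale span_base) auto
      qed
    qed
  qed
qed

text \<open>
  The first \<open>p\<close> vectors of the frame are the normal directions of \<open>S\<close> in the ambient space, and the
  remaining \<open>m\<close> span the tangent space.
\<close>

lemma frame_at_orthogonal:
  fixes w :: "nat \<Rightarrow> 'a::euclidean_space"
  assumes dim: "DIM('a) = p + m" and nz: "\<And>i. i < p + m \<Longrightarrow> d i \<noteq> 0"
    and orth: "\<And>i j. i < p + m \<Longrightarrow> j < p + m \<Longrightarrow> signed_form r s \<epsilon> (w i) (w j) = (if i = j then d i else 0)"
    and T: "tangent_space S x = {v. \<forall>i<p. signed_form r s \<epsilon> (w i) v = 0}"
  shows "frame_at m S x (\<lambda>i. w (p + i))"
proof -
  note frame = orthogonal_frame[OF dim nz orth]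
  have img: "(\<lambda>i. w (p + i)) ` {..<m} = w ` {p..<p+m}"
  proof -
    have "(\<lambda>i. p + i) ` {..<m} = {p..<p+m}"
      using image_add_atLeastLessThan[of p 0 m] by (simp add: lessThan_atLeast0 add.commute)
    then show ?thesis by (metis image_image)
  qed
  have "inj_on (\<lambda>i. w (p + i)) {..<m}"
    by (rule inj_onI) (use inj_onD[OF frame(1)] in fastforce)
  moreover have "independent (w ` {p..<p+m})"
    by (rule independent_mono[OF frame(2)]) auto
  moreover have "span (w ` {p..<p+m}) = tangent_space S x"
  proof
    show "tangent_space S x \<subseteq> span (w ` {p..<p+m})"
      unfolding T using frame(3)[of p] by auto
    have "subspace (tangent_space S x)"
      unfolding T subspace_def by (auto simp: signed_form_right)
    then show "span (w ` {p..<p+m}) \<subseteq> tangent_space S x"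
      by (intro span_minimal) (auto simp: T orth)
  qed
  ultimately show ?thesis unfolding frame_at_def img by simp
qed

lemma tangent_space_linear_constraint:
  assumes f: "bounded_linear f" and S: "S \<subseteq> {x. f x = (0::real)}" and v: "v \<in> tangent_space S x"
  shows "f v = 0"
proof -
  obtain \<gamma> \<delta> where \<gamma>: "0 < \<delta>" "\<forall>t\<in>{-\<delta><..<\<delta>}. \<gamma> t \<in> S" "(\<gamma> has_vector_derivative v) (at (0::real))"
    using v unfolding tangent_space_def by auto
  have "((\<lambda>t. f (\<gamma> t)) has_vector_derivative f v) (at 0)"
    by (rule bounded_linear.has_vector_derivative[OF f \<gamma>(3)])
  moreover have "((\<lambda>t. f (\<gamma> t)) has_vector_derivative 0) (at 0)"
    by (rule has_vector_derivative_transform_within_open[OF has_vector_derivative_const[of 0], where S = "{-\<delta><..<\<delta>}"])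
       (use \<gamma> S in auto)
  ultimately show ?thesis by (rule vector_derivative_unique_at)
qed

lemma tangent_space_quadric_constraint:
  fixes B :: "'a::euclidean_space \<Rightarrow> 'a \<Rightarrow> real"
  assumes B: "bounded_bilinear B" and sym: "\<And>u v. B u v = B v u"
    and S: "S \<subseteq> {x. B x x = k}" and v: "v \<in> tangent_space S x"
  shows "B x v = 0"
proof -
  obtain \<gamma> \<delta> where \<gamma>: "0 < \<delta>" "\<forall>t\<in>{-\<delta><..<\<delta>}. \<gamma> t \<in> S" "\<gamma> 0 = x" "(\<gamma> has_vector_derivative v) (at (0::real))"
    using v unfolding tangent_space_def by auto
  have "((\<lambda>t. B (\<gamma> t) (\<gamma> t)) has_vector_derivative (B (\<gamma> 0) v + B v (\<gamma> 0))) (at 0)"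
    by (rule bounded_bilinear.has_vector_derivative[OF B \<gamma>(4) \<gamma>(4)])
  moreover have "((\<lambda>t. B (\<gamma> t) (\<gamma> t)) has_vector_derivative 0) (at 0)"
    by (rule has_vector_derivative_transform_within_open[OF has_vector_derivative_const[of k], where S = "{-\<delta><..<\<delta>}"])
       (use \<gamma> S in auto)
  ultimately have "B (\<gamma> 0) v + B v (\<gamma> 0) = 0" by (rule vector_derivative_unique_at)
  then show ?thesis using sym[of v x] \<gamma>(3) by simp
qed

lemma tangent_space_straight:
  assumes "\<delta> > 0" "\<And>t. \<bar>t\<bar> < \<delta> \<Longrightarrow> x + t *\<^sub>R v \<in> S"
  shows "v \<in> tangent_space S x"
  unfolding tangent_space_def
  by (rule CollectI, rule exI[of _ "\<lambda>t. x + t *\<^sub>R v"], rule exI[of _ \<delta>])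
     (use assms in \<open>auto intro!: derivative_eq_intros\<close>)

text \<open>
  The line \<open>x + t v\<close> leaves the quadric only to second order. Dividing it by
  \<open>sqrt (1 + t\<^sup>2 B v v / k)\<close> brings it back without changing the velocity at \<open>t = 0\<close>. Scaling preserves \<open>K\<close>
  when \<open>K\<close> is a cone, which is how the further conditions on the hypersurface are met.
\<close>

lemma tangent_space_quadric_cone:
  fixes x v :: "'a::euclidean_space" and B :: "'a \<Rightarrow> 'a \<Rightarrow> real"
  assumes B: "bounded_bilinear B" and sym: "\<And>u v. B u v = B v u"
    and k: "B x x = k" "k \<noteq> 0" and v: "B x v = 0"
    and \<delta>: "\<delta> > 0" and K: "\<And>t a. \<bar>t\<bar> < \<delta> \<Longrightarrow> a > 0 \<Longrightarrow> a *\<^sub>R (x + t *\<^sub>R v) \<in> K"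
  shows "v \<in> tangent_space ({x. B x x = k} \<inter> K) x"
proof -
  interpret B: bounded_bilinear B by (rule B)
  define b where "b = B v v / k"
  define a where "a = (\<lambda>t. 1 / sqrt (1 + t\<^sup>2 * b))"
  \<comment> \<open>For times below this bound the quantity under the root is positive.\<close>
  define \<eta> where "\<eta> = min \<delta> (1 / (1 + \<bar>b\<bar>))"
  have \<eta>: "\<eta> > 0" "\<eta> \<le> \<delta>" using \<delta> by (auto simp: \<eta>_def)
  have pos: "1 + t\<^sup>2 * b > 0" if t: "\<bar>t\<bar> < \<eta>" for t
  proof -
    have t1: "\<bar>t\<bar> * (1 + \<bar>b\<bar>) < 1" using t by (simp add: \<eta>_def field_simps)
    have "\<bar>t\<bar> \<le> \<bar>t\<bar> * (1 + \<bar>b\<bar>)" by (simp add: algebra_simps)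
    then have "\<bar>t\<bar> \<le> 1" using t1 by linarith
    then have "\<bar>t\<bar> * \<bar>t\<bar> \<le> 1 * \<bar>t\<bar>" by (intro mult_right_mono) auto
    then have "\<bar>t\<^sup>2 * b\<bar> \<le> \<bar>t\<bar> * \<bar>b\<bar>"
      unfolding abs_mult power2_eq_square by (intro mult_right_mono) auto
    also have "\<dots> < 1" using t1 by (simp add: algebra_simps)
    finally show ?thesis by linarith
  qed
  show ?thesis unfolding tangent_space_def
  proof (rule CollectI, rule exI[of _ "\<lambda>t. a t *\<^sub>R (x + t *\<^sub>R v)"], rule exI[of _ \<eta>], intro conjI ballI)
    fix t assume "t \<in> {-\<eta><..<\<eta>}"
    then have t: "\<bar>t\<bar> < \<eta>" by auto
    have a: "a t > 0" "(a t)\<^sup>2 = 1 / (1 + t\<^sup>2 * b)" using pos[OF t] by (auto simp: a_def power_divide)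
    have "B (a t *\<^sub>R (x + t *\<^sub>R v)) (a t *\<^sub>R (x + t *\<^sub>R v)) = (a t)\<^sup>2 * (k + t\<^sup>2 * B v v)"
      using k v sym[of v x] by (simp add: B.scaleR_left B.scaleR_right B.add_left B.add_right power2_eq_square algebra_simps)
    also have "k + t\<^sup>2 * B v v = k * (1 + t\<^sup>2 * b)" using k by (simp add: b_def algebra_simps)
    also have "(a t)\<^sup>2 * (k * (1 + t\<^sup>2 * b)) = k" using pos[OF t] unfolding a(2) by simp
    finally show "a t *\<^sub>R (x + t *\<^sub>R v) \<in> {x. B x x = k} \<inter> K"
      using K[of t "a t"] a t \<eta> by auto
  next
    have "(a has_real_derivative 0) (at 0)"
      unfolding a_def by (auto intro!: derivative_eq_intros)
    then show "((\<lambda>t. a t *\<^sub>R (x + t *\<^sub>R v)) has_vector_derivative v) (at 0)"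
      by (auto intro!: derivative_eq_intros simp: a_def)
  qed (auto simp: \<eta> a_def)
qed

text \<open>
  The vector \<open>N - (l N / b) E\<close> is the part of \<open>N\<close> in the kernel of \<open>l\<close> when \<open>l E = b\<close>. If \<open>N\<close> is orthogonal
  to it, then \<open>1 = g(N, N)\<close> is \<open>l N / b\<close> times \<open>g(N, E) = a l N\<close>.
\<close>

lemma normal_component:
  fixes l :: "'a::real_vector \<Rightarrow> real"
  assumes g: "linear (g N)" and "g N N = 1" and "g N E = a * l N" and "b \<noteq> 0"
    and "g N (N - (l N / b) *\<^sub>R E) = 0"
  shows "a * (l N)\<^sup>2 = b"
proof -
  have "1 - (l N / b) * (a * l N) = 0"
    using assms by (simp add: linear_diff[OF g] linear_scale[OF g])
  then show ?thesis using \<open>b \<noteq> 0\<close> by (simp add: field_simps power2_eq_square)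
qed

text \<open>
  Here \<open>l\<close> is the function whose kernel in the contact plane is the characteristic foliation. The
  vector \<open>E\<close> of the plane with \<open>l E \<noteq> 0\<close> also shows that \<open>x\<close> is not a characteristic point.
\<close>

lemma sub_riemannian_normal_facts:
  assumes N: "sub_riemannian_normal n M \<omega> g S \<nu> N" and x: "x \<in> S"
    and Z: "frame_at (2 * n) S x Z" "\<nu> x Z > 0"
    and plane: "subspace (contact_plane M \<omega> x)" and E: "E \<in> contact_plane M \<omega> x"
    and l: "linear l" "l E = b" "b \<noteq> 0"
    and S0: "\<And>Y. Y \<in> tangent_space S x \<Longrightarrow> l Y = 0"
    and S1: "\<And>Y. Y \<in> contact_plane M \<omega> x \<Longrightarrow> l Y = 0 \<Longrightarrow> Y \<in> tangent_space S x"
    and g: "linear (g (N x))" "\<And>Y. Y \<in> contact_plane M \<omega> x \<Longrightarrow> g Y E = a * l Y"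
  shows "contact_volume n \<omega> x (case_nat (N x) Z) > 0 \<and> a * (l (N x))\<^sup>2 = b"
proof

  have "E \<notin> tangent_space S x" using S0[of E] l by auto
  then have "x \<in> S - characteristic_points M \<omega> S"
    using x E by (auto simp: characteristic_points_def)
  then have *: "N x \<in> tangent_space M x" "\<omega> x (\<lambda>_. N x) = 0" "g (N x) (N x) = 1"
      "\<And>Y. Y \<in> characteristic_foliation M \<omega> S x \<Longrightarrow> g (N x) Y = 0"
      "\<And>Z. positive_frame_at (2 * n) S \<nu> x Z \<Longrightarrow>
             positive_frame_at (2 * n + 1) M (contact_volume n \<omega>) x (case_nat (N x) Z)"
    using N unfolding sub_riemannian_normal_def by blast+
  show "contact_volume n \<omega> x (case_nat (N x) Z) > 0"
    using *(5)[of Z] Z by (simp add: positive_frame_at_def)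
  have Np: "N x \<in> contact_plane M \<omega> x" using * by (simp add: contact_plane_def)
  let ?Y = "N x - (l (N x) / b) *\<^sub>R E"
  have Y: "?Y \<in> contact_plane M \<omega> x"
    using plane Np E by (intro subspace_diff subspace_scale)
  moreover have "l ?Y = 0" using l by (simp add: linear_diff linear_scale)
  ultimately have "g (N x) ?Y = 0"
    using S1 by (intro *(4)) (simp add: characteristic_foliation_def)
  then show "a * (l (N x))\<^sup>2 = b"
    using *(3) g Np l by (intro normal_component[where g = g and E = E]) auto
qed
lemma sum_pairs: "(\<Sum>i=1..2*n. f i) = (\<Sum>m=1..n. f (2*m-1) + f (2*m))" for f :: "nat \<Rightarrow> real"
  by (induction n) simp_all

text \<open>
  The vector dual to the rotation form at \<open>x\<close>: the image of \<open>x\<close> under the complex structure of the first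
  \<open>2n\<close> coordinates.
\<close>

definition rotation_vector :: "nat \<Rightarrow> (nat \<Rightarrow> 'a::euclidean_space) \<Rightarrow> 'a \<Rightarrow> 'a" where
  "rotation_vector n e x = (\<Sum>m=1..n. (x \<bullet> e (2*m-1)) *\<^sub>R e (2*m) - (x \<bullet> e (2*m)) *\<^sub>R e (2*m-1))"

lemma rotation_vector_coord:
  assumes e: "bij_betw e {1..D} Basis" and D: "2*n \<le> D"
  shows "m \<in> {1..n} \<Longrightarrow> rotation_vector n e x \<bullet> e (2*m) = x \<bullet> e (2*m-1)"
    and "m \<in> {1..n} \<Longrightarrow> rotation_vector n e x \<bullet> e (2*m-1) = - (x \<bullet> e (2*m))"
    and "2*n < k \<Longrightarrow> k \<le> D \<Longrightarrow> rotation_vector n e x \<bullet> e k = 0"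
proof -
  have on: "e i \<bullet> e k = (if i = k then 1 else 0)" if "1 \<le> i" "i \<le> D" "1 \<le> k" "k \<le> D" for i k
    using orthonormal_enumeration[OF e, of i k] that by simp
  have gen: "rotation_vector n e x \<bullet> e k = (\<Sum>m=1..n. (x \<bullet> e (2*m-1)) * (if 2*m = k then 1 else 0) - (x \<bullet> e (2*m)) * (if 2*m-1 = k then 1 else 0))"
    if "1 \<le> k" "k \<le> D" for k
    unfolding rotation_vector_def inner_sum_left using D that
    by (intro sum.cong) (auto simp: inner_diff_left on)
  show "rotation_vector n e x \<bullet> e (2*m) = x \<bullet> e (2*m-1)" if m: "m \<in> {1..n}"
  proof -
    have m': "1 \<le> 2*m" "2*m \<le> D" using m D by auto
    have "rotation_vector n e x \<bullet> e (2*m) = (\<Sum>l=1..n. if l = m then x \<bullet> e (2*m-1) else 0)"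
      unfolding gen[OF m']
    proof (intro sum.cong refl)
      fix l assume "l \<in> {1..n}"
      then have "2*l - 1 \<noteq> 2*m" by (simp, presburger)
      then show "(x \<bullet> e (2*l-1)) * (if 2*l = 2*m then 1 else 0) - (x \<bullet> e (2*l)) * (if 2*l-1 = 2*m then 1 else 0)
          = (if l = m then x \<bullet> e (2*m-1) else 0)" by simp
    qed
    then show ?thesis using m by simp
  qed
  show "rotation_vector n e x \<bullet> e (2*m-1) = - (x \<bullet> e (2*m))" if m: "m \<in> {1..n}"
  proof -
    have m': "1 \<le> 2*m-1" "2*m-1 \<le> D" using m D by auto
    have "rotation_vector n e x \<bullet> e (2*m-1) = (\<Sum>l=1..n. if l = m then - (x \<bullet> e (2*m)) else 0)"
      unfolding gen[OF m']
    proof (intro sum.cong refl)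
      fix l assume l: "l \<in> {1..n}"
      have "2*l \<noteq> 2*m-1" using m by (simp, presburger)
      moreover have "2*l-1 = 2*m-1 \<longleftrightarrow> l = m" using l m by auto
      ultimately show "(x \<bullet> e (2*l-1)) * (if 2*l = 2*m-1 then 1 else 0) - (x \<bullet> e (2*l)) * (if 2*l-1 = 2*m-1 then 1 else 0)
          = (if l = m then - (x \<bullet> e (2*m)) else 0)" by simp
    qed
    then show ?thesis using m by simp
  qed
  show "rotation_vector n e x \<bullet> e k = 0" if "2*n < k" "k \<le> D"
    using that by (subst gen) (auto intro!: sum.neutral)
qed

lemma rotation_vector_inner:
  assumes e: "bij_betw e {1..D} Basis" and D: "2*n \<le> D"
  shows "(\<Sum>i=1..2*n. (v \<bullet> e i) * (rotation_vector n e x \<bullet> e i)) = rotation_form n e x (\<lambda>_. v)"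
  unfolding sum_pairs rotation_form_def coord_form_def
  by (intro sum.cong refl) (simp add: rotation_vector_coord[OF e D] rotation_vector_coord(2)[OF e D, unfolded One_nat_def])

lemma rotation_form_rotation_vector:
  assumes e: "bij_betw e {1..D} Basis" and D: "2*n \<le> D"
  shows "rotation_form n e x (\<lambda>_. rotation_vector n e x) = (\<Sum>i=1..2*n. (x \<bullet> e i)\<^sup>2)"
  unfolding sum_pairs rotation_form_def coord_form_def
  by (intro sum.cong refl) (simp add: rotation_vector_coord[OF e D] rotation_vector_coord(2)[OF e D, unfolded One_nat_def] power2_eq_square)

lemma rotation_form_self: "rotation_form n e x (\<lambda>_. x) = 0"
  unfolding rotation_form_def coord_form_def by (simp add: mult.commute)

lemma linear_rotation_form: "linear (\<lambda>v. rotation_form n e x (\<lambda>_. v))"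
  by (rule linearI)
     (simp_all add: rotation_form_def coord_form_def inner_left_distrib sum_distrib_left sum.distrib[symmetric] algebra_simps)
section \<open>The volume of the model hypersurfaces\<close>

text \<open>
  The form \<open>\<Omega>\<close> is a multiple of the determinant on the coordinate space, so only \<open>\<Omega> c\<close> has to be found.
  Its square follows from the Gram determinant of the frame \<open>w\<close> and from the square \<open>h\<^sup>2\<close> of the last
  coordinate \<open>Nd\<close> of the normal, and its sign from the orientation. Where the coordinates degenerate, the
  Gram determinant and with it \<open>\<Omega>\<close> vanish.
\<close>

lemma volume_from_normal:
  fixes L :: "'p::euclidean_space \<Rightarrow> 'a::euclidean_space"
  assumes n: "n \<ge> 1" and c: "bij_betw c {0..<2*n} Basis" and L: "linear L"
    and w: "w = (\<lambda>i. if i < p then u i else L (c (i - p)))"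
    and s: "\<And>l. l < p + 2*n \<Longrightarrow> \<bar>s l\<bar> = 1"
    and orth: "\<And>i j. i < p + 2*n \<Longrightarrow> j < p + 2*n \<Longrightarrow>
       signed_form (p + 2*n) s \<epsilon> (w i) (w j) = (if i = j then d i else 0)"
    and d: "\<And>i. i < p \<Longrightarrow> \<bar>d i\<bar> = 1" "d p = \<kappa>\<^sup>2"
      "\<And>j. 1 \<le> j \<Longrightarrow> j < 2*n \<Longrightarrow> d (p + j) = (\<rho> * sine_product \<phi> j)\<^sup>2"
    and pos: "\<kappa> > 0" "\<rho> > 0" "h \<ge> 0" "C > 0" "\<And>l. l \<in> {1..2*n-2} \<Longrightarrow> sin (\<phi> l) \<ge> 0"
    and \<Omega>: "\<And>v. \<Omega> v = a * (Nd * frame_det (p + 2*n) \<epsilon> (\<lambda>i. if i < p then u i else L (v (i - p))))"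
    and a: "\<bar>a\<bar> = C"
    and normal: "(\<And>l. l \<in> {1..2*n-2} \<Longrightarrow> sin (\<phi> l) \<noteq> 0) \<Longrightarrow> \<Omega> c > 0 \<and> Nd\<^sup>2 = h\<^sup>2"
  shows "\<Omega> v = C * h * \<kappa> * \<rho> ^ (2*n-1) * (\<Prod>l=1..2*n-2. sin (\<phi> l) ^ (2*n-l-1)) * frame_det (2*n) c v"
proof -
  define P where "P = (\<Prod>l=1..2*n-2. sin (\<phi> l) ^ (2*n-l-1))"
  have "P = (\<Prod>l=1..2*n-1-1. sin (\<phi> l) ^ (2*n-1-l))"
    unfolding P_def using n by (intro prod.cong) auto
  then have P: "P = (\<Prod>j=1..2*n-1. sine_product \<phi> j)"
    by (simp only: prod_sine_product)
  have P0: "P \<ge> 0" unfolding P_def using pos by (intro prod_nonneg) auto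
  let ?f = "frame_det (p + 2*n) \<epsilon> w"
  have \<Omega>v: "\<Omega> v = \<Omega> c * frame_det (2*n) c v" for v
    using frame_det_linear_image[OF L c, of p \<epsilon> u v] by (simp add: \<Omega>)
  have "\<bar>\<Prod>i<p + 2*n. d i\<bar> = (\<kappa> * \<rho> ^ (2*n-1) * P)\<^sup>2"
  proof -
    have split: "(\<Prod>i<p+r. d i) = (\<Prod>i<p. d i) * (\<Prod>i<r. d (p + i))" for r
      by (induction r) (simp_all add: mult_ac)
    obtain m where m: "2*n = Suc m" using n by (cases "2*n") auto
    have "(\<Prod>i<2*n. d (p + i)) = d p * (\<Prod>j=1..2*n-1. d (p + j))"
      unfolding m by (simp add: prod.lessThan_Suc_shift prod.atLeast1_atMost_eq del: prod.lessThan_Suc)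
    also have "(\<Prod>j=1..2*n-1. d (p + j)) = (\<Prod>j=1..2*n-1. (\<rho> * sine_product \<phi> j)\<^sup>2)"
      by (intro prod.cong refl d(3)) auto
    also have "\<dots> = (\<rho> ^ (2*n-1) * P)\<^sup>2"
      unfolding P by (simp add: prod_power_distrib[symmetric] prod.distrib)
    also have "d p * \<dots> = (\<kappa> * \<rho> ^ (2*n-1) * P)\<^sup>2" by (simp add: d power_mult_distrib)
    finally show ?thesis
      unfolding split abs_mult abs_prod[of d] using d(1) by simp
  qed
  then have gram: "?f\<^sup>2 = (\<kappa> * \<rho> ^ (2*n-1) * P)\<^sup>2"
    using frame_det_Gram[of "p + 2*n" s w \<epsilon> d] s orth by (simp add: signed_form_def)
  have \<Omega>c: "\<Omega> c = a * (Nd * ?f)" unfolding \<Omega> w ..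
  have "\<Omega> c = C * h * \<kappa> * \<rho> ^ (2*n-1) * P"
  proof (cases "\<forall>l\<in>{1..2*n-2}. sin (\<phi> l) \<noteq> 0")
    case True
    then have "\<Omega> c > 0" and Nd: "Nd\<^sup>2 = h\<^sup>2" using normal by auto
    moreover have "(\<Omega> c)\<^sup>2 = (C * h * \<kappa> * \<rho> ^ (2*n-1) * P)\<^sup>2"
    proof -
      have "(\<Omega> c)\<^sup>2 = a\<^sup>2 * (Nd\<^sup>2 * ?f\<^sup>2)" unfolding \<Omega>c by (simp only: power_mult_distrib)
      also have "a\<^sup>2 = C\<^sup>2" using power2_abs[of a] by (simp add: a)
      also have "C\<^sup>2 * (Nd\<^sup>2 * ?f\<^sup>2) = (C * h * \<kappa> * \<rho> ^ (2*n-1) * P)\<^sup>2"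
        unfolding Nd gram by (simp only: power_mult_distrib mult_ac)
      finally show ?thesis .
    qed
    ultimately show ?thesis using pos P0 by - (rule power2_eq_imp_eq, simp_all)
  next
    case False
    then obtain l where l: "l \<in> {1..2*n-2}" "sin (\<phi> l) = 0" by auto
    then have "sin (\<phi> l) ^ (2*n-l-1) = 0" by (auto simp: zero_power)
    then have "P = 0" unfolding P_def using l by (intro prod_zero) auto
    then show ?thesis using gram by (simp add: \<Omega>c)
  qed
  then show ?thesis unfolding \<Omega>v[of v] P_def by (simp only:)
qed

lemma signed_form_curved:
  "signed_form (2 + 2*n) (\<lambda>l. if l < 2*n then 1 else s) (\<lambda>i. e (Suc i)) u v =
     (\<Sum>i=1..2*n. (u \<bullet> e i) * (v \<bullet> e i)) +
     s * ((u \<bullet> e (2*n+1)) * (v \<bullet> e (2*n+1)) + (u \<bullet> e (2*n+2)) * (v \<bullet> e (2*n+2)))"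
proof -
  have "(\<Sum>l<2*n. (if l < 2*n then 1 else s) * (u \<bullet> e (Suc l)) * (v \<bullet> e (Suc l))) = (\<Sum>i=1..2*n. (u \<bullet> e i) * (v \<bullet> e i))"
    by (simp add: sum.atLeast1_atMost_eq)
  then show ?thesis by (simp add: signed_form_def algebra_simps)
qed

lemma signed_form_flat:
  "signed_form (1 + 2*n) (\<lambda>_. 1) (case_nat (e (2*n+1)) (\<lambda>i. e (Suc i))) u v =
     (\<Sum>i=1..2*n. (u \<bullet> e i) * (v \<bullet> e i)) + (u \<bullet> e (2*n+1)) * (v \<bullet> e (2*n+1))"
  by (simp add: signed_form_def sum.lessThan_Suc_shift sum.atLeast1_atMost_eq del: sum.lessThan_Suc)

lemma linear_image_constraint:
  fixes c :: "nat \<Rightarrow> 'p::euclidean_space" and L :: "'p \<Rightarrow> 'a::euclidean_space"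
  assumes L: "linear L" and c: "bij_betw c {0..<m} Basis" and z: "\<And>j. j < m \<Longrightarrow> L (c j) \<bullet> a = 0"
  shows "L y \<bullet> a = 0"
proof -
  have "linear (\<lambda>y. L y \<bullet> a)"
    by (rule linearI) (simp_all add: linear_add[OF L] linear_scale[OF L] inner_left_distrib)
  moreover have "linear (\<lambda>y::'p. 0::real)" by (rule linearI) simp_all
  ultimately have "(\<lambda>y. L y \<bullet> a) = (\<lambda>y. 0)"
    by (rule linear_eq_stdbasis) (use c z in \<open>force simp: bij_betw_def\<close>)
  then show ?thesis by meson
qed

text \<open>
  The sphere is the case \<open>s = 1\<close> and anti-de Sitter space the case \<open>s = -1\<close>. The open cone \<open>K\<close> is the
  half-space that selects one sheet in the latter case. The vector \<open>E\<close> in the proof is, up to a factor, the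
  projection of the last basis vector \<open>eD\<close> to the contact plane. For \<open>y\<close> in the contact plane it satisfies
  \<open>B y E = y \<bullet> eD\<close>, so that the last coordinate of the normal is \<open>k \<rho>\<close> up to sign.
\<close>

lemma curved_volume:
  fixes e :: "nat \<Rightarrow> 'a::euclidean_space" and c :: "nat \<Rightarrow> 'p::euclidean_space"
  assumes n: "n \<ge> 1" and k: "k > 0" and s: "s = 1 \<or> s = -1"
    and e: "bij_betw e {1..2*n+2} Basis" and c: "bij_betw c {0..<2*n} Basis"
    and B: "B = signed_form (2 + 2*n) (\<lambda>l. if l < 2*n then 1 else s) (\<lambda>i. e (Suc i))"
    and K: "open K" "\<And>a x. a > 0 \<Longrightarrow> x \<in> K \<Longrightarrow> a *\<^sub>R x \<in> K"
    and M: "M = {x. B x x = s}" and S: "S = M \<inter> ({x. x \<bullet> e (2*n+2) = 0} \<inter> K)"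
    and \<omega>: "\<omega> = (\<lambda>x v. 1 / (2 * k\<^sup>2) * rotation_form (n+1) e x v)"
    and g: "g = (\<lambda>u v. 1 / k\<^sup>2 * B u v)"
    and \<Phi>: "\<Phi> = polar_map \<rho> \<zeta> n e c" and r: "r = q \<bullet> c 0"
    and \<rho>: "(\<rho> has_real_derivative k * \<zeta> r) (at r)" and \<zeta>: "(\<zeta> has_real_derivative - s * k * \<rho> r) (at r)"
    and profile: "(\<rho> r)\<^sup>2 + s * (\<zeta> r)\<^sup>2 = s" and \<rho>0: "\<rho> r > 0" and xK: "\<Phi> q \<in> K"
    and sin0: "\<And>l. l \<in> {1..2*n-2} \<Longrightarrow> sin (q \<bullet> c l) \<ge> 0"
    and pos: "(\<And>l. l \<in> {1..2*n-2} \<Longrightarrow> sin (q \<bullet> c l) \<noteq> 0) \<Longrightarrow> pullback \<Phi> \<nu> q c > 0"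
    and N: "sub_riemannian_normal n M \<omega> g S \<nu> N"
  shows "pullback \<Phi> (hypersurface_volume n \<omega> N) q v =
    fact n / 2 * (\<rho> r / k) ^ (2*n) * (\<Prod>l=1..2*n-2. sin (q \<bullet> c l) ^ (2*n-l-1)) * frame_det (2*n) c v"
proof -
  define \<phi> where "\<phi> = (\<lambda>l. q \<bullet> c l)"
  define x where "x = \<Phi> q"
  define L where "L = frechet_derivative \<Phi> (at q)"
  define J where "J = rotation_vector n e x"
  define eD where "eD = e (2*n+2)"
  define eC where "eC = e (2*n+1)"
  let ?\<epsilon> = "\<lambda>i. e (Suc i)" and ?sg = "\<lambda>l. if l < 2*n then 1 else s"
  define u where "u = case_nat x (\<lambda>_. eD)"
  \<comment> \<open>The position vector, the last basis vector and the coordinate frame of the hypersurface. They are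
    orthogonal for \<open>B\<close> with the squared lengths \<open>d i\<close>.\<close>
  define w where "w = (\<lambda>i. if i < 2 then u i else L (c (i - 2)))"
  define d where "d = (\<lambda>i. if i < 2 then s else if i = 2 then k\<^sup>2 else (\<rho> r * sine_product \<phi> (i - 2))\<^sup>2)"
  have s2: "s * s = 1" using s by auto
  \<comment> \<open>The profile equation multiplied by \<open>s\<close>, as \<open>s\<^sup>2 = 1\<close>. It is used for the length of the radial vector and
    for the pairing with \<open>E\<close>.\<close>
  have conj: "(\<zeta> r)\<^sup>2 + s * (\<rho> r)\<^sup>2 = 1"
    using profile s by auto
  have \<rho>q: "(\<rho> has_real_derivative k * \<zeta> r) (at (q \<bullet> c 0))" and \<zeta>q: "(\<zeta> has_real_derivative - s * k * \<rho> r) (at (q \<bullet> c 0))"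
    using \<rho> \<zeta> r by auto
  have L: "linear L"
    unfolding L_def \<Phi>
    by (intro linear_frechet_derivative differentiable_polar_map[where q = q and c = c, OF \<rho>q \<zeta>q])
  have x_vec: "x = polar_vec n e (\<lambda>i. \<rho> r * sigma n \<phi> i) (\<zeta> r)"
    unfolding x_def \<Phi> polar_map_eq_vec \<phi>_def r ..
  have L_vec: "L (c j) = polar_vec n e (frame_coeff (\<rho> r) (k * \<zeta> r) n \<phi> j) (if j = 0 then - s * k * \<rho> r else 0)"
    if "j < 2*n" for j
    unfolding L_def \<Phi> \<phi>_def r
    by (rule polar_map_frame[where q = q and c = c]) (use \<rho>q \<zeta>q c n that r in auto)
  have D: "2*n+1 \<le> 2*n+2" by simp
  have on: "eD \<bullet> e i = (if i = 2*n+2 then 1 else 0)" if "1 \<le> i" "i \<le> 2*n+2" for i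
    unfolding eD_def using orthonormal_enumeration[OF e, of "2*n+2" i] that by auto
  have onD: "eD \<bullet> eD = 1" "eD \<bullet> eC = 0"
    using on[of "2*n+2"] on[of "2*n+1"] unfolding eD_def[symmetric] eC_def[symmetric] by auto
  have onI: "eD \<bullet> e i = 0" if "i \<in> {1..2*n}" for i using on[of i] that by auto
  have coordI: "polar_vec n e a \<alpha> \<bullet> e i = a i" if "i \<in> {1..2*n}" for a \<alpha> i
    using that by (subst polar_vec_coord[OF e D]; simp)+
  have coordCD: "polar_vec n e a \<alpha> \<bullet> eC = \<alpha>" "polar_vec n e a \<alpha> \<bullet> eD = 0" for a \<alpha>
    unfolding eC_def eD_def by (subst polar_vec_coord[OF e D]; simp)+
  have S': "S = M \<inter> ({x. x \<bullet> eD = 0} \<inter> K)" unfolding S eD_def ..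
  have Bexp: "B y z = (\<Sum>i=1..2*n. (y \<bullet> e i) * (z \<bullet> e i)) +
     s * ((y \<bullet> eC) * (z \<bullet> eC) + (y \<bullet> eD) * (z \<bullet> eD))" for y z
    unfolding B eC_def eD_def by (rule signed_form_curved)
  have B_vec: "B (polar_vec n e a \<alpha>) (polar_vec n e b \<beta>) = (\<Sum>i=1..2*n. a i * b i) + s * (\<alpha> * \<beta>)" for a \<alpha> b \<beta>
  proof -
    have "(\<Sum>i=1..2*n. (polar_vec n e a \<alpha> \<bullet> e i) * (polar_vec n e b \<beta> \<bullet> e i)) = (\<Sum>i=1..2*n. a i * b i)"
      by (intro sum.cong refl) (simp only: coordI)
    then show ?thesis unfolding Bexp coordCD by simp
  qed
  have B_eD: "B eD y = s * (y \<bullet> eD)" for y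
  proof -
    have "(\<Sum>i=1..2*n. (eD \<bullet> e i) * (y \<bullet> e i)) = 0" by (intro sum.neutral ballI) (simp only: onI mult_zero_left)
    then show ?thesis unfolding Bexp onD by simp
  qed
  have Bsym: "B y z = B z y" for y z unfolding B by (rule signed_form_commute)
  have Blin: "linear (B y)" for y unfolding B by (rule linear_signed_form)
  note vec_eD = coordCD(2)
  have xeD: "x \<bullet> eD = 0" and xe: "x \<bullet> eC = \<zeta> r" unfolding x_vec by (rule coordCD)+
  have Bxx: "B x x = s"
    unfolding x_vec B_vec sum_scaled_products using sum_sigma_squares[OF n, of \<phi>] profile
    by (simp add: power2_eq_square)
  have BxL: "B x (L (c j)) = 0" if "j < 2*n" for j
    unfolding L_vec[OF that] unfolding x_vec B_vec sum_sigma_frame_coeff[OF n that] using s2 by simp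
  have BLL: "B (L (c i)) (L (c j)) = (if i = j then d (2 + i) else 0)" if "i < 2*n" "j < 2*n" for i j
  proof -
    have "(k * \<zeta> r)\<^sup>2 + s * ((- s * k * \<rho> r) * (- s * k * \<rho> r)) = k\<^sup>2 * ((\<zeta> r)\<^sup>2 + (s * s) * s * (\<rho> r)\<^sup>2)"
      by (simp add: power2_eq_square algebra_simps)
    then have "(k * \<zeta> r)\<^sup>2 + s * ((- s * k * \<rho> r) * (- s * k * \<rho> r)) = k\<^sup>2"
      unfolding s2 using conj by simp
    then show ?thesis
      unfolding L_vec[OF that(1)] L_vec[OF that(2)] B_vec frame_coeff_products[OF n that] by (simp add: d_def)
  qed
  have BeL: "B eD (L (c j)) = 0" if "j < 2*n" for j unfolding B_eD L_vec[OF that] vec_eD by simp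
  have orth: "B (w i) (w j) = (if i = j then d i else 0)" if ij: "i < 2 + 2*n" "j < 2 + 2*n" for i j
  proof -
    have cases: "i = 0 \<or> i = 1 \<or> (\<exists>i'. i = 2 + i' \<and> i' < 2*n)" if "i < 2 + 2*n" for i
      using that by presburger
    have w0: "w 0 = x" and w1: "w 1 = eD" and w2: "w (2 + i) = L (c i)" for i by (simp_all add: w_def u_def)
    have d01: "d 0 = s" "d 1 = s" by (simp_all add: d_def)
    have BxeD: "B x eD = 0" "B eD x = 0" "B eD eD = s" using Bsym[of x eD] xeD onD by (simp_all add: B_eD)
    show ?thesis
      using cases[OF ij(1)] cases[OF ij(2)] 
      by (elim disjE exE conjE; simp only: w0 w1 w2 d01 BxeD Bxx BLL BxL BeL Bsym[of "L (c _)" x] Bsym[of "L (c _)" eD])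
         simp_all
  qed
  define C where "C = fact n * (1 / (2 * k\<^sup>2)) * (2 * (1 / (2 * k\<^sup>2))) ^ n"
  have LeD: "L y \<bullet> eD = 0" for y
    by (rule linear_image_constraint[OF L c]) (simp add: L_vec vec_eD)
  have vol: "pullback \<Phi> (hypersurface_volume n \<omega> N) q v =
      C * ((N x \<bullet> eD) * frame_det (2 + 2*n) ?\<epsilon> (\<lambda>i. if i < 2 then u i else L (v (i - 2))))" for v
  proof -
    have \<epsilon>D: "eD = e (Suc (2*n+1))" by (simp add: eD_def)
    let ?W = "case_nat x (case_nat (N x) (\<lambda>i. L (v i)))"
    have "pullback \<Phi> (hypersurface_volume n \<omega> N) q v = contact_volume n \<omega> x (case_nat (N x) (\<lambda>i. L (v i)))"
      by (simp add: pullback_def hypersurface_volume_def interior_product_def x_def L_def)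
    also have "\<dots> = C * frame_det (2 + 2*n) ?\<epsilon> ?W"
      unfolding contact_volume_homogeneous[OF \<omega>] C_def by (simp only: add.commute)
    also have "frame_det (2 + 2*n) ?\<epsilon> ?W = (?W 1 \<bullet> eD) * frame_det (2 + 2*n) ?\<epsilon> (?W(1 := eD))"
    proof (rule frame_det_column[where \<epsilon> = ?\<epsilon> and d = "2*n+1" and p = 1 and w = ?W, folded \<epsilon>D])
      show "eD \<bullet> ?\<epsilon> i = (if i = 2*n+1 then 1 else 0)" if "i < 2 + 2*n" for i
        using on[of "Suc i"] that by auto
      show "?W j \<bullet> eD = 0" if "j < 2 + 2*n" "j \<noteq> 1" for j
        using that xeD LeD by (auto split: nat.split)
    qed auto
    also have "?W(1 := eD) = (\<lambda>i. if i < 2 then u i else L (v (i - 2)))"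
    proof
      fix i :: nat
      consider "i = 0" | "i = 1" | i' where "i = Suc (Suc i')" by (metis One_nat_def old.nat.exhaust)
      then show "(?W(1 := eD)) i = (if i < 2 then u i else L (v (i - 2)))"
        by cases (simp_all add: u_def)
    qed
    finally show ?thesis by simp
  qed
  have sumx: "(\<Sum>i=1..2*n. (x \<bullet> e i)\<^sup>2) = (\<rho> r)\<^sup>2"
    by (rule sum_squares_polar_vec[OF e D n x_vec])
  have nD: "2*n \<le> 2*n+2" by simp
  note Jc = rotation_vector_coord[OF e nD, of _ x, folded J_def]
  note Ji = rotation_vector_inner[OF e nD, of _ x, folded J_def]
  have JeD: "J \<bullet> eD = 0" "J \<bullet> eC = 0" unfolding eD_def eC_def by (rule Jc(3); simp)+
  let ?rot = "\<lambda>v. rotation_form n e x (\<lambda>_. v)"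
  have B_J: "B y J = ?rot y" for y unfolding Bexp Ji by (simp add: JeD)
  have rot_Suc: "rotation_form (n+1) e x (\<lambda>_. y) = ?rot y + \<zeta> r * (y \<bullet> eD)" for y
    using xeD xe by (simp add: rotation_form_def coord_form_def eC_def eD_def)
  \<comment> \<open>Chosen such that the rotation form of all \<open>2n + 2\<close> coordinates vanishes on it.\<close>
  define E where "E = (\<rho> r)\<^sup>2 *\<^sub>R eD - \<zeta> r *\<^sub>R J"
  have EeD: "E \<bullet> eD = (\<rho> r)\<^sup>2" by (simp add: E_def inner_diff_left JeD onD)
  have B_E: "B y E = s * (\<rho> r)\<^sup>2 * (y \<bullet> eD) - \<zeta> r * ?rot y" for y
    unfolding E_def linear_diff[OF Blin] linear_scale[OF Blin] B_J Bsym[of y eD] B_eD by simp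
  have rot_E: "?rot E = - \<zeta> r * (\<rho> r)\<^sup>2"
  proof -
    have "?rot eD = 0" unfolding Ji[symmetric] by (intro sum.neutral ballI) (simp only: onI mult_zero_left)
    moreover have "?rot J = (\<rho> r)\<^sup>2"
      unfolding J_def rotation_form_rotation_vector[OF e nD] sumx ..
    ultimately show ?thesis
      unfolding E_def linear_diff[OF linear_rotation_form] linear_scale[OF linear_rotation_form] by simp
  qed
  have bb: "bounded_bilinear B" unfolding B by (rule bounded_bilinear_signed_form)
  have s0: "s \<noteq> 0" using s by auto
  have xS: "x \<in> S" using Bxx xeD xK unfolding M S' x_def by auto
  have TM: "y \<in> tangent_space M x \<longleftrightarrow> B x y = 0" for y
  proof
    assume "y \<in> tangent_space M x"
    then show "B x y = 0" using M by (intro tangent_space_quadric_constraint[OF bb Bsym, of M s]) auto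
  next
    assume "B x y = 0"
    then have "y \<in> tangent_space ({x. B x x = s} \<inter> UNIV) x"
      by (intro tangent_space_quadric_cone[OF bb Bsym Bxx s0, of y 1]) auto
    then show "y \<in> tangent_space M x" using M by simp
  qed
  have TS: "y \<in> tangent_space S x \<longleftrightarrow> B x y = 0 \<and> y \<bullet> eD = 0" for y
  proof (intro iffI conjI)
    assume y: "y \<in> tangent_space S x"
    then show "B x y = 0" using M S' by (intro tangent_space_quadric_constraint[OF bb Bsym, of S s]) auto
    show "y \<bullet> eD = 0"
      by (rule tangent_space_linear_constraint[OF bounded_linear_inner_left[of eD] _ y]) (auto simp: S')
  next
    assume y: "B x y = 0 \<and> y \<bullet> eD = 0"
    obtain \<delta> where \<delta>: "\<delta> > 0" "\<And>t. \<bar>t\<bar> < \<delta> \<Longrightarrow> x + t *\<^sub>R y \<in> K"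
      using line_in_open[OF K(1) xK, of y] x_def by metis
    have "y \<in> tangent_space ({x. B x x = s} \<inter> ({x. x \<bullet> eD = 0} \<inter> K)) x"
      using y \<delta> K(2) xeD
      by (intro tangent_space_quadric_cone[OF bb Bsym Bxx s0, of y \<delta>]) (auto simp: inner_left_distrib)
    then show "y \<in> tangent_space S x" unfolding S' M .
  qed
  have plane: "y \<in> contact_plane M \<omega> x \<longleftrightarrow> B x y = 0 \<and> ?rot y + \<zeta> r * (y \<bullet> eD) = 0" for y
    using k rot_Suc[of y] by (simp add: contact_plane_def TM \<omega>)
  have result: "pullback \<Phi> (hypersurface_volume n \<omega> N) q v =
    C * (k * \<rho> r) * k * \<rho> r ^ (2*n-1) * (\<Prod>l=1..2*n-2. sin (\<phi> l) ^ (2*n-l-1)) * frame_det (2*n) c v"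
  proof (rule volume_from_normal[OF n c L w_def, where \<Omega> = "pullback \<Phi> (hypersurface_volume n \<omega> N) q"
        and s = ?sg and \<epsilon> = ?\<epsilon> and d = d and Nd = "N x \<bullet> eD" and a = C])
    show "\<bar>?sg l\<bar> = 1" for l using s by auto
    show "signed_form (2 + 2*n) ?sg ?\<epsilon> (w i) (w j) = (if i = j then d i else 0)" if "i < 2 + 2*n" "j < 2 + 2*n" for i j
      using orth[OF that] unfolding B .
    show "\<bar>d i\<bar> = 1" if "i < 2" for i using that s by (auto simp: d_def)
    show "d 2 = k\<^sup>2" by (simp add: d_def)
    show "d (2 + j) = (\<rho> r * sine_product \<phi> j)\<^sup>2" if "1 \<le> j" "j < 2*n" for j using that by (simp add: d_def)
    show "C > 0" "k * \<rho> r \<ge> 0" "\<bar>C\<bar> = C" using k \<rho>0 by (auto simp: C_def)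
    show "k > 0" "\<rho> r > 0" by fact+
    show "sin (\<phi> l) \<ge> 0" if "l \<in> {1..2*n-2}" for l using sin0[OF that] by (simp add: \<phi>_def)
    show "pullback \<Phi> (hypersurface_volume n \<omega> N) q v =
      C * ((N x \<bullet> eD) * frame_det (2 + 2*n) ?\<epsilon> (\<lambda>i. if i < 2 then u i else L (v (i - 2))))" for v
      by (rule vol)
    assume nd: "\<And>l. l \<in> {1..2*n-2} \<Longrightarrow> sin (\<phi> l) \<noteq> 0"
    let ?Z = "\<lambda>i. L (c i)"
    have P: "sine_product \<phi> j \<noteq> 0" if "j < 2*n" for j
      unfolding sine_product_def using nd that by (subst prod_zero_iff) auto
    have frame: "frame_at (2*n) S x (\<lambda>i. w (2 + i))"
    proof (rule frame_at_orthogonal[where d = d])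
      have "DIM('a) = card {1..2*n+2}" using bij_betw_same_card[OF e] by simp
      then show "DIM('a) = 2 + 2*n" by simp
      show "d i \<noteq> 0" if "i < 2 + 2*n" for i using that P[of "i - 2"] s0 k \<rho>0 by (auto simp: d_def)
      show "signed_form (2 + 2*n) ?sg ?\<epsilon> (w i) (w j) = (if i = j then d i else 0)" if "i < 2 + 2*n" "j < 2 + 2*n" for i j
        using orth[OF that] unfolding B .
      have "(\<forall>i<2. B (w i) y = 0) \<longleftrightarrow> B x y = 0 \<and> y \<bullet> eD = 0" for y
        using s0 B_eD[of y] by (auto simp: w_def u_def less_2_cases_iff)
      then show "tangent_space S x = {v. \<forall>i<2. signed_form (2 + 2*n) ?sg ?\<epsilon> (w i) v = 0}"
        using TS unfolding B by blast
    qed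
    have frame': "frame_at (2*n) S x ?Z" using frame by (simp add: w_def)
    have \<nu>: "\<nu> x ?Z > 0" using pos nd by (simp add: \<phi>_def pullback_def x_def L_def)
    have facts: "contact_volume n \<omega> x (case_nat (N x) ?Z) > 0 \<and> 1 / k\<^sup>2 * (N x \<bullet> eD)\<^sup>2 = (\<rho> r)\<^sup>2"
    proof (rule sub_riemannian_normal_facts[OF N xS frame' \<nu>, where l = "\<lambda>y. y \<bullet> eD" and E = E])
      show "subspace (contact_plane M \<omega> x)"
      proof -
        have "contact_plane M \<omega> x = {y. B x y = 0} \<inter> {y. rotation_form (n+1) e x (\<lambda>_. y) = 0}"
          using plane rot_Suc by auto
        then show ?thesis
          by (simp only: subspace_inter linear_subspace_kernel Blin linear_rotation_form)
      qed
      show "E \<in> contact_plane M \<omega> x"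
        unfolding plane B_E EeD rot_E using xeD by (simp add: rotation_form_self)
      show "linear (\<lambda>y. y \<bullet> eD)" by (rule linearI) (simp_all add: inner_left_distrib)
      show "E \<bullet> eD = (\<rho> r)\<^sup>2" by (rule EeD)
      show "(\<rho> r)\<^sup>2 \<noteq> 0" using \<rho>0 by simp
      show "y \<bullet> eD = 0" if "y \<in> tangent_space S x" for y using that TS by blast
      show "y \<in> tangent_space S x" if "y \<in> contact_plane M \<omega> x" "y \<bullet> eD = 0" for y using that TS plane by blast
      show "linear (g (N x))" unfolding g
        by (rule linearI) (simp_all add: linear_add[OF Blin] linear_scale[OF Blin] algebra_simps add_divide_distrib)
      show "g y E = 1 / k\<^sup>2 * (y \<bullet> eD)" if "y \<in> contact_plane M \<omega> x" for y
      proof -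
        have "?rot y = - \<zeta> r * (y \<bullet> eD)" using that plane[of y] by linarith
        then have "B y E = ((\<zeta> r)\<^sup>2 + s * (\<rho> r)\<^sup>2) * (y \<bullet> eD)"
          unfolding B_E by (simp add: algebra_simps power2_eq_square)
        then show ?thesis unfolding g conj by simp
      qed
    qed
    have "pullback \<Phi> (hypersurface_volume n \<omega> N) q c = contact_volume n \<omega> x (case_nat (N x) ?Z)"
      by (simp add: pullback_def hypersurface_volume_def interior_product_def x_def L_def)
    then show "pullback \<Phi> (hypersurface_volume n \<omega> N) q c > 0 \<and> (N x \<bullet> eD)\<^sup>2 = (k * \<rho> r)\<^sup>2"
      using facts k by (simp add: field_simps power_mult_distrib)
  qed
  have "C * (k * \<rho> r) * k * \<rho> r ^ (2*n-1) = fact n / 2 * (\<rho> r / k) ^ (2*n)"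
  proof -
    have "\<rho> r ^ (2*n) = \<rho> r * \<rho> r ^ (2*n-1)" using n by (simp add: power_eq_if)
    moreover have "(2 * (1 / (2 * k\<^sup>2))) ^ n = 1 / k ^ (2*n)" by (simp add: power_one_over power_mult)
    ultimately show ?thesis using k by (simp add: C_def power_divide field_simps power2_eq_square)
  qed
  then show ?thesis using result unfolding \<phi>_def by simp
qed

text \<open>
  The Gram determinant is taken for the Euclidean metric of the ambient space, although the metric on the contact
  planes forgets the vertical coordinate. For \<open>y\<close> in the contact plane, \<open>g y E\<close> is the value of the
  rotation form on \<open>y\<close> and hence twice the vertical coordinate, so the last coordinate of the normal is
  \<open>r / 2\<close> up to sign.
\<close>

lemma Heisenberg_volume:
  fixes e :: "nat \<Rightarrow> 'a::euclidean_space" and c :: "nat \<Rightarrow> 'p::euclidean_space"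
  assumes n: "n \<ge> 1"
    and e: "bij_betw e {1..2*n+1} Basis" and c: "bij_betw c {0..<2*n} Basis"
    and S: "S = {x. x \<bullet> e (2*n+1) = 0}"
    and \<omega>: "\<omega> = (\<lambda>x v. 1/2 * rotation_form n e x v - coord_form e (2*n+1) x v)"
    and g: "g = (\<lambda>u v. \<Sum>i=1..2*n. (u \<bullet> e i) * (v \<bullet> e i))"
    and \<Phi>: "\<Phi> = polar_map (\<lambda>r. r) (\<lambda>_. 0) n e c" and r: "r = q \<bullet> c 0" "r > 0"
    and sin0: "\<And>l. l \<in> {1..2*n-2} \<Longrightarrow> sin (q \<bullet> c l) \<ge> 0"
    and pos: "(\<And>l. l \<in> {1..2*n-2} \<Longrightarrow> sin (q \<bullet> c l) \<noteq> 0) \<Longrightarrow> pullback \<Phi> \<nu> q c > 0"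
    and N: "sub_riemannian_normal n UNIV \<omega> g S \<nu> N"
  shows "pullback \<Phi> (hypersurface_volume n \<omega> N) q v =
    fact n / 2 * r ^ (2*n) * (\<Prod>l=1..2*n-2. sin (q \<bullet> c l) ^ (2*n-l-1)) * frame_det (2*n) c v"
proof -
  define \<phi> where "\<phi> = (\<lambda>l. q \<bullet> c l)"
  define x where "x = \<Phi> q"
  define L where "L = frechet_derivative \<Phi> (at q)"
  define J where "J = rotation_vector n e x"
  define eD where "eD = e (2*n+1)"
  let ?\<epsilon> = "case_nat (e (2*n+1)) (\<lambda>i. e (Suc i))"
  define B where "B = signed_form (1 + 2*n) (\<lambda>_. 1) ?\<epsilon>"
  define u where "u = (\<lambda>_::nat. eD)"
  define w where "w = (\<lambda>i. if i < 1 then u i else L (c (i - 1)))"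
  define d where "d = (\<lambda>i. if i < 2 then 1 else (r * sine_product \<phi> (i - 1))\<^sup>2)"
  have \<rho>: "((\<lambda>r. r) has_real_derivative 1) (at (q \<bullet> c 0))" and \<zeta>: "((\<lambda>_. 0) has_real_derivative 0) (at (q \<bullet> c 0))"
    by (auto intro!: derivative_eq_intros)
  have L: "linear L"
    unfolding L_def \<Phi>
    by (intro linear_frechet_derivative differentiable_polar_map[where q = q and c = c, OF \<rho> \<zeta>])
  have x_vec: "x = polar_vec n e (\<lambda>i. r * sigma n \<phi> i) 0"
    unfolding x_def \<Phi> polar_map_eq_vec \<phi>_def r ..
  have L_vec: "L (c j) = polar_vec n e (frame_coeff r 1 n \<phi> j) 0" if "j < 2*n" for j
    using polar_map_frame[where q = q and c = c and e = e, OF \<rho> \<zeta> c n that]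
    unfolding L_def \<Phi> \<phi>_def r by simp
  have D: "2*n+1 \<le> 2*n+1" by simp
  have on: "eD \<bullet> e i = (if i = 2*n+1 then 1 else 0)" if "1 \<le> i" "i \<le> 2*n+1" for i
    unfolding eD_def using orthonormal_enumeration[OF e, of "2*n+1" i] that by auto
  have onD: "eD \<bullet> eD = 1" using on[of "2*n+1"] unfolding eD_def[symmetric] by simp
  have onI: "eD \<bullet> e i = 0" if "i \<in> {1..2*n}" for i using on[of i] that by auto
  have coord: "polar_vec n e a \<alpha> \<bullet> e i = a i" if "i \<in> {1..2*n}" for a \<alpha> i
    using that by (subst polar_vec_coord[OF e D]; simp)+
  have coordD: "polar_vec n e a \<alpha> \<bullet> eD = \<alpha>" for a \<alpha>
    unfolding eD_def by (subst polar_vec_coord[OF e D]; simp)+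
  have Bexp: "B y z = (\<Sum>i=1..2*n. (y \<bullet> e i) * (z \<bullet> e i)) + (y \<bullet> eD) * (z \<bullet> eD)" for y z
    unfolding B_def eD_def by (rule signed_form_flat)
  have B_vec: "B (polar_vec n e a \<alpha>) (polar_vec n e b \<beta>) = (\<Sum>i=1..2*n. a i * b i) + \<alpha> * \<beta>" for a \<alpha> b \<beta>
  proof -
    have "(\<Sum>i=1..2*n. (polar_vec n e a \<alpha> \<bullet> e i) * (polar_vec n e b \<beta> \<bullet> e i)) = (\<Sum>i=1..2*n. a i * b i)"
      by (intro sum.cong refl) (simp only: coord)
    then show ?thesis unfolding Bexp coordD by simp
  qed
  have B_eD: "B eD y = y \<bullet> eD" for y
  proof -
    have "(\<Sum>i=1..2*n. (eD \<bullet> e i) * (y \<bullet> e i)) = 0" by (intro sum.neutral ballI) (simp only: onI mult_zero_left)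
    then show ?thesis unfolding Bexp onD by simp
  qed
  have Bsym: "B y z = B z y" for y z unfolding B_def by (rule signed_form_commute)
  have xeD: "x \<bullet> eD = 0" unfolding x_vec by (rule coordD)
  have BLL: "B (L (c i)) (L (c j)) = (if i = j then d (1 + i) else 0)" if "i < 2*n" "j < 2*n" for i j
    unfolding L_vec[OF that(1)] L_vec[OF that(2)] B_vec frame_coeff_products[OF n that] by (simp add: d_def)
  have BeL: "B eD (L (c j)) = 0" if "j < 2*n" for j unfolding B_eD L_vec[OF that] coordD ..
  have orth: "B (w i) (w j) = (if i = j then d i else 0)" if ij: "i < 1 + 2*n" "j < 1 + 2*n" for i j
  proof -
    have cases: "i = 0 \<or> (\<exists>i'. i = 1 + i' \<and> i' < 2*n)" if "i < 1 + 2*n" for i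
      using that by presburger
    have w0: "w 0 = eD" and w1: "w (1 + i) = L (c i)" for i by (simp_all add: w_def u_def)
    have d0: "d 0 = 1" by (simp add: d_def)
    have Bee: "B eD eD = 1" using onD by (simp add: B_eD)
    show ?thesis
      using cases[OF ij(1)] cases[OF ij(2)]
      by (elim disjE exE conjE; simp only: w0 w1 d0 Bee BLL BeL Bsym[of "L (c _)" eD])
         simp_all
  qed
  have LeD: "L y \<bullet> eD = 0" for y
    by (rule linear_image_constraint[OF L c]) (simp add: L_vec coordD)
  have vol: "pullback \<Phi> (hypersurface_volume n \<omega> N) q v =
      - fact n * ((N x \<bullet> eD) * frame_det (1 + 2*n) ?\<epsilon> (\<lambda>i. if i < 1 then u i else L (v (i - 1))))" for v
  proof -
    let ?W = "case_nat (N x) (\<lambda>i. L (v i))"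
    have "pullback \<Phi> (hypersurface_volume n \<omega> N) q v = contact_volume n \<omega> x ?W"
      by (simp add: pullback_def hypersurface_volume_def interior_product_def x_def L_def)
    also have "\<dots> = - fact n * frame_det (1 + 2*n) ?\<epsilon> ?W"
      unfolding contact_volume_Heisenberg[OF \<omega>] by (simp only: add.commute)
    also have "frame_det (1 + 2*n) ?\<epsilon> ?W = (?W 0 \<bullet> ?\<epsilon> 0) * frame_det (1 + 2*n) ?\<epsilon> (?W(0 := ?\<epsilon> 0))"
    proof (rule frame_det_column)
      show "?\<epsilon> 0 \<bullet> ?\<epsilon> i = (if i = 0 then 1 else 0)" if "i < 1 + 2*n" for i
        using onD onI[of i] that by (cases i) (auto simp: eD_def)
      show "?W j \<bullet> ?\<epsilon> 0 = 0" if "j < 1 + 2*n" "j \<noteq> 0" for j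
        using that LeD by (cases j) (auto simp: eD_def)
    qed auto
    also have "?W(0 := ?\<epsilon> 0) = (\<lambda>i. if i < 1 then u i else L (v (i - 1)))"
    proof
      fix i :: nat
      show "(?W(0 := ?\<epsilon> 0)) i = (if i < 1 then u i else L (v (i - 1)))"
        by (cases i) (simp_all add: u_def eD_def)
    qed
    finally show ?thesis by (simp add: eD_def)
  qed
  have sumx: "(\<Sum>i=1..2*n. (x \<bullet> e i)\<^sup>2) = r\<^sup>2"
    by (rule sum_squares_polar_vec[OF e D n x_vec])
  have nD: "2*n \<le> 2*n+1" by simp
  note Jc = rotation_vector_coord[OF e nD, of _ x, folded J_def]
  note Ji = rotation_vector_inner[OF e nD, of _ x, folded J_def]
  have JeD: "J \<bullet> eD = 0" unfolding eD_def by (rule Jc(3)) auto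
  let ?rot = "\<lambda>v. rotation_form n e x (\<lambda>_. v)"
  define E where "E = J + (r\<^sup>2 / 2) *\<^sub>R eD"
  have EeD: "E \<bullet> eD = r\<^sup>2 / 2" by (simp add: E_def inner_left_distrib JeD onD)
  have rot_E: "?rot E = r\<^sup>2"
  proof -
    have "?rot eD = 0" unfolding Ji[symmetric] by (intro sum.neutral ballI) (simp only: onI mult_zero_left)
    moreover have "?rot J = r\<^sup>2"
      unfolding J_def rotation_form_rotation_vector[OF e nD] sumx ..
    ultimately show ?thesis
      unfolding E_def linear_add[OF linear_rotation_form] linear_scale[OF linear_rotation_form] by simp
  qed
  have g_E: "g y E = ?rot y" for y
  proof -
    have "(y \<bullet> e i) * (E \<bullet> e i) = (y \<bullet> e i) * (J \<bullet> e i)" if "i \<in> {1..2*n}" for i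
      using onI[OF that] by (simp add: E_def inner_left_distrib)
    then have "g y E = (\<Sum>i=1..2*n. (y \<bullet> e i) * (J \<bullet> e i))" unfolding g by (rule sum.cong[OF refl])
    then show ?thesis unfolding Ji .
  qed
  have xS: "x \<in> S" using xeD by (simp add: S eD_def)
  have TM: "y \<in> tangent_space UNIV x" for y by (rule tangent_space_straight[of 1]) auto
  have TS: "y \<in> tangent_space S x \<longleftrightarrow> y \<bullet> eD = 0" for y
  proof
    assume y: "y \<in> tangent_space S x"
    show "y \<bullet> eD = 0"
      by (rule tangent_space_linear_constraint[OF bounded_linear_inner_left[of eD] _ y]) (auto simp: S eD_def)
  next
    assume "y \<bullet> eD = 0"
    then show "y \<in> tangent_space S x"
      using xeD by (intro tangent_space_straight[of 1]) (auto simp: S eD_def inner_left_distrib)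
  qed
  have plane: "y \<in> contact_plane UNIV \<omega> x \<longleftrightarrow> 1/2 * ?rot y - y \<bullet> eD = 0" for y
    by (simp add: contact_plane_def TM \<omega> coord_form_def eD_def)
  have result: "pullback \<Phi> (hypersurface_volume n \<omega> N) q v =
    fact n * (r / 2) * 1 * r ^ (2*n-1) * (\<Prod>l=1..2*n-2. sin (\<phi> l) ^ (2*n-l-1)) * frame_det (2*n) c v"
  proof (rule volume_from_normal[OF n c L w_def, where \<Omega> = "pullback \<Phi> (hypersurface_volume n \<omega> N) q"
        and s = "\<lambda>_. 1" and \<epsilon> = ?\<epsilon> and d = d and Nd = "N x \<bullet> eD" and a = "- fact n"])
    show "\<bar>1::real\<bar> = 1" by simp
    show "signed_form (1 + 2*n) (\<lambda>_. 1) ?\<epsilon> (w i) (w j) = (if i = j then d i else 0)" if "i < 1 + 2*n" "j < 1 + 2*n" for i j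
      using orth[OF that] unfolding B_def .
    show "\<bar>d i\<bar> = 1" if "i < 1" for i using that by (auto simp: d_def)
    show "d 1 = 1\<^sup>2" by (simp add: d_def)
    show "d (1 + j) = (r * sine_product \<phi> j)\<^sup>2" if "1 \<le> j" "j < 2*n" for j using that by (simp add: d_def)
    show "(fact n :: real) > 0" "r / 2 \<ge> 0" "\<bar>- fact n :: real\<bar> = fact n" using r by auto
    show "(1::real) > 0" "r > 0" using r by auto
    show "sin (\<phi> l) \<ge> 0" if "l \<in> {1..2*n-2}" for l using sin0[OF that] by (simp add: \<phi>_def)
    show "pullback \<Phi> (hypersurface_volume n \<omega> N) q v =
      - fact n * ((N x \<bullet> eD) * frame_det (1 + 2*n) ?\<epsilon> (\<lambda>i. if i < 1 then u i else L (v (i - 1))))" for v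
      by (rule vol)
    assume nd: "\<And>l. l \<in> {1..2*n-2} \<Longrightarrow> sin (\<phi> l) \<noteq> 0"
    let ?Z = "\<lambda>i. L (c i)"
    have P: "sine_product \<phi> j \<noteq> 0" if "j < 2*n" for j
      unfolding sine_product_def using nd that by (subst prod_zero_iff) auto
    have frame: "frame_at (2*n) S x (\<lambda>i. w (1 + i))"
    proof (rule frame_at_orthogonal[where d = d])
      have "DIM('a) = card {1..2*n+1}" using bij_betw_same_card[OF e] by simp
      then show "DIM('a) = 1 + 2*n" by simp
      show "d i \<noteq> 0" if "i < 1 + 2*n" for i using that P[of "i - 1"] r by (auto simp: d_def)
      show "signed_form (1 + 2*n) (\<lambda>_. 1) ?\<epsilon> (w i) (w j) = (if i = j then d i else 0)" if "i < 1 + 2*n" "j < 1 + 2*n" for i j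
        using orth[OF that] unfolding B_def .
      have "(\<forall>i<1. B (w i) y = 0) \<longleftrightarrow> y \<bullet> eD = 0" for y
        using B_eD[of y] by (auto simp: w_def u_def)
      then show "tangent_space S x = {v. \<forall>i<1. signed_form (1 + 2*n) (\<lambda>_. 1) ?\<epsilon> (w i) v = 0}"
        using TS unfolding B_def by blast
    qed
    have frame': "frame_at (2*n) S x ?Z" using frame by (simp add: w_def)
    have \<nu>: "\<nu> x ?Z > 0" using pos nd by (simp add: \<phi>_def pullback_def x_def L_def)
    have facts: "contact_volume n \<omega> x (case_nat (N x) ?Z) > 0 \<and> 2 * (N x \<bullet> eD)\<^sup>2 = r\<^sup>2 / 2"
    proof (rule sub_riemannian_normal_facts[OF N xS frame' \<nu>, where l = "\<lambda>y. y \<bullet> eD" and E = E])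
      show "subspace (contact_plane UNIV \<omega> x)"
      proof -
        have "linear (\<lambda>y. 1/2 * ?rot y - y \<bullet> eD)"
          by (rule linearI)
             (simp_all add: linear_add[OF linear_rotation_form] linear_scale[OF linear_rotation_form] inner_left_distrib algebra_simps)
        then have "subspace {y. 1/2 * ?rot y - y \<bullet> eD = 0}" by (rule linear_subspace_kernel)
        moreover have "contact_plane UNIV \<omega> x = {y. 1/2 * ?rot y - y \<bullet> eD = 0}" using plane by blast
        ultimately show ?thesis by (simp only:)
      qed
      show "E \<in> contact_plane UNIV \<omega> x"
        unfolding plane EeD rot_E by simp
      show "linear (\<lambda>y. y \<bullet> eD)" by (rule linearI) (simp_all add: inner_left_distrib)
      show "E \<bullet> eD = r\<^sup>2 / 2" by (rule EeD)
      show "r\<^sup>2 / 2 \<noteq> 0" using r by simp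
      show "y \<bullet> eD = 0" if "y \<in> tangent_space S x" for y using that TS by blast
      show "y \<in> tangent_space S x" if "y \<in> contact_plane UNIV \<omega> x" "y \<bullet> eD = 0" for y using that TS by blast
      show "linear (g (N x))" unfolding g
        by (rule linearI) (simp_all add: inner_left_distrib sum_distrib_left sum.distrib[symmetric] algebra_simps)
      show "g y E = 2 * (y \<bullet> eD)" if "y \<in> contact_plane UNIV \<omega> x" for y
        using that unfolding g_E plane by simp
    qed
    have "pullback \<Phi> (hypersurface_volume n \<omega> N) q c = contact_volume n \<omega> x (case_nat (N x) ?Z)"
      by (simp add: pullback_def hypersurface_volume_def interior_product_def x_def L_def)
    then show "pullback \<Phi> (hypersurface_volume n \<omega> N) q c > 0 \<and> (N x \<bullet> eD)\<^sup>2 = (r / 2)\<^sup>2"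
      using facts by (simp add: field_simps)
  qed
  have "r ^ (2*n) = r * r ^ (2*n-1)" using n by (simp add: power_eq_if)
  then have "fact n * (r / 2) * 1 * r ^ (2*n-1) = fact n / 2 * r ^ (2*n)" by simp
  then show ?thesis using result unfolding \<phi>_def by simp
qed

theorem proposition6:
  fixes X :: model_space and n :: nat
    and e :: "nat \<Rightarrow> 'a::euclidean_space" and c :: "nat \<Rightarrow> 'p::euclidean_space"
    and \<nu> :: "'a form" and N :: "'a \<Rightarrow> 'a"
  defines "M \<equiv> model_manifold X n e"
    and "\<omega> \<equiv> model_form X n e"
    and "g \<equiv> model_metric X n e"
    and "S \<equiv> model_hypersurface X n e"
    and "\<Phi> \<equiv> spherical_coords X n e c"
  assumes "n \<ge> 1" and "valid_model X"
    and "bij_betw e {1..ambient_dim X n} Basis"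
    and "bij_betw c {0..<2*n} Basis"
    and "orientation_form (2*n) S \<nu>"
    and "\<And>q. q \<in> coord_domain X n c - degenerate_locus n c \<Longrightarrow> pullback \<Phi> \<nu> q c > 0"
    and "sub_riemannian_normal n M \<omega> g S \<nu> N"
    and "q \<in> coord_domain X n c"
  shows "pullback \<Phi> (hypersurface_volume n \<omega> N) q =
    (\<lambda>v. fact n / 2 * radial_function X (q \<bullet> c 0) ^ (2*n)
        * (\<Prod>i=1..2*n-2. sin (q \<bullet> c i) ^ (2*n-i-1))
        * wedge_upto (coord_form c) (2*n) q v)"
proof -
  have n: "n \<ge> 1" and c: "bij_betw c {0..<2*n} Basis" and N: "sub_riemannian_normal n M \<omega> g S \<nu> N" by fact+
  have sin0: "sin (q \<bullet> c l) \<ge> 0" if "l \<in> {1..2*n-2}" for l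
    using \<open>q \<in> coord_domain X n c\<close> that by (auto simp: coord_domain_def intro!: sin_ge_zero)
  have pos: "pullback \<Phi> \<nu> q c > 0" if "\<And>l. l \<in> {1..2*n-2} \<Longrightarrow> sin (q \<bullet> c l) \<noteq> 0"
    using assms(11)[of q] \<open>q \<in> coord_domain X n c\<close> that by (auto simp: degenerate_locus_def)
  have rng: "q \<bullet> c 0 \<in> radial_range X" using \<open>q \<in> coord_domain X n c\<close> by (simp add: coord_domain_def)
  define K where "K = (case X of Anti_de_Sitter k \<Rightarrow> {x. x \<bullet> e (2*n+1) > 0} | _ \<Rightarrow> UNIV)"
  have halfspace: "open {x::'a. x \<bullet> a > 0}" for a
    by (intro open_Collect_less continuous_intros)
  have K: "open K" "\<And>a x. a > 0 \<Longrightarrow> x \<in> K \<Longrightarrow> a *\<^sub>R x \<in> K"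
    unfolding K_def
    by (cases X; simp add: halfspace)
       (cases X; simp add: zero_less_mult_iff)
  have "pullback \<Phi> (hypersurface_volume n \<omega> N) q v = fact n / 2 * radial_function X (q \<bullet> c 0) ^ (2*n)
        * (\<Prod>i=1..2*n-2. sin (q \<bullet> c i) ^ (2*n-i-1)) * frame_det (2*n) c v" for v
  proof (cases X)
    case Heisenberg
    have "\<Phi> = polar_map (\<lambda>r. r) (\<lambda>_. 0) n e c"
      unfolding \<Phi>_def Heisenberg by (simp add: polar_map_def fun_eq_iff)
    then have "pullback \<Phi> (hypersurface_volume n \<omega> N) q v = fact n / 2 * (q \<bullet> c 0) ^ (2*n)
        * (\<Prod>l=1..2*n-2. sin (q \<bullet> c l) ^ (2*n-l-1)) * frame_det (2*n) c v"
      using assms(8) rng N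
      by (intro Heisenberg_volume[OF n _ c, of e S \<omega> g \<Phi> _ q \<nu> N v] sin0 pos)
         (simp_all add: Heisenberg M_def S_def \<omega>_def g_def)
    then show ?thesis by (simp add: Heisenberg)
  next
    case (Sphere k)
    have k: "k > 0" using \<open>valid_model X\<close> Sphere by simp
    have e: "bij_betw e {1..2*n+2} Basis" using assms(8) Sphere by simp
    let ?B = "signed_form (2 + 2*n) (\<lambda>l. if l < 2*n then 1 else 1) (\<lambda>i. e (Suc i))"
    let ?r = "q \<bullet> c 0"
    have Bexp: "?B y z = (\<Sum>i=1..2*n+2. (y \<bullet> e i) * (z \<bullet> e i))" for y z
      using signed_form_curved[of n 1 e y z] by simp
    have B: "?B y z = y \<bullet> z" for y z
      unfolding Bexp using sum.reindex_bij_betw[OF e, of "\<lambda>b. (y \<bullet> b) * (z \<bullet> b)"] euclidean_inner[of y z] by simp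
    have \<Phi>: "\<Phi> = polar_map (\<lambda>r. sin (k * r)) (\<lambda>r. cos (k * r)) n e c"
      unfolding \<Phi>_def Sphere by (simp add: polar_map_def fun_eq_iff)
    have "pullback \<Phi> (hypersurface_volume n \<omega> N) q v = fact n / 2 * (sin (k * ?r) / k) ^ (2*n)
        * (\<Prod>l=1..2*n-2. sin (q \<bullet> c l) ^ (2*n-l-1)) * frame_det (2*n) c v"
    proof (rule curved_volume[OF n k _ e c refl K _ _ _ _ \<Phi> refl _ _ _ _ _ sin0 pos N])
      show "M = {x. ?B x x = 1}" unfolding M_def Sphere Bexp by (simp add: power2_eq_square)
      show "S = M \<inter> ({x. x \<bullet> e (2*n+2) = 0} \<inter> K)" unfolding S_def M_def K_def Sphere by simp
      show "g = (\<lambda>u v. 1 / k\<^sup>2 * ?B u v)" unfolding g_def Sphere B by simp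
      show "((\<lambda>r. sin (k * r)) has_real_derivative k * cos (k * ?r)) (at ?r)"
        "((\<lambda>r. cos (k * r)) has_real_derivative - 1 * k * sin (k * ?r)) (at ?r)"
        by (auto intro!: derivative_eq_intros)
      show "(sin (k * ?r))\<^sup>2 + 1 * (cos (k * ?r))\<^sup>2 = 1" by simp
      show "sin (k * ?r) > 0" using rng k Sphere by (intro sin_gt_zero) (auto simp: field_simps)
    qed (simp_all add: Sphere \<omega>_def K_def)
    then show ?thesis by (simp add: Sphere)
  next
    case (Anti_de_Sitter k)
    have k: "k > 0" using \<open>valid_model X\<close> Anti_de_Sitter by simp
    have e: "bij_betw e {1..2*n+2} Basis" using assms(8) Anti_de_Sitter by simp
    let ?B = "signed_form (2 + 2*n) (\<lambda>l. if l < 2*n then 1 else - 1) (\<lambda>i. e (Suc i))"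
    let ?r = "q \<bullet> c 0"
    have \<Phi>: "\<Phi> = polar_map (\<lambda>r. sinh (k * r)) (\<lambda>r. cosh (k * r)) n e c"
      unfolding \<Phi>_def Anti_de_Sitter by (simp add: polar_map_def fun_eq_iff)
    have Bexp: "?B y z = (\<Sum>i=1..2*n. (y \<bullet> e i) * (z \<bullet> e i)) - (y \<bullet> e (2*n+1)) * (z \<bullet> e (2*n+1)) - (y \<bullet> e (2*n+2)) * (z \<bullet> e (2*n+2))" for y z
      unfolding signed_form_curved by simp
    have "pullback \<Phi> (hypersurface_volume n \<omega> N) q v = fact n / 2 * (sinh (k * ?r) / k) ^ (2*n)
        * (\<Prod>l=1..2*n-2. sin (q \<bullet> c l) ^ (2*n-l-1)) * frame_det (2*n) c v"
    proof (rule curved_volume[OF n k _ e c refl K _ _ _ _ \<Phi> refl _ _ _ _ _ sin0 pos N])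
      show "M = {x. ?B x x = - 1}" unfolding M_def Anti_de_Sitter Bexp by (simp add: power2_eq_square)
      show "S = M \<inter> ({x. x \<bullet> e (2*n+2) = 0} \<inter> K)" unfolding S_def M_def K_def Anti_de_Sitter by auto
      show "g = (\<lambda>u v. 1 / k\<^sup>2 * ?B u v)" unfolding g_def Anti_de_Sitter Bexp by simp
      show "((\<lambda>r. sinh (k * r)) has_real_derivative k * cosh (k * ?r)) (at ?r)"
        "((\<lambda>r. cosh (k * r)) has_real_derivative - (- 1) * k * sinh (k * ?r)) (at ?r)"
        by (auto intro!: derivative_eq_intros)
      show "(sinh (k * ?r))\<^sup>2 + (- 1) * (cosh (k * ?r))\<^sup>2 = - 1" by (simp add: cosh_square_eq)
      show "sinh (k * ?r) > 0" using rng k Anti_de_Sitter by simp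
      show "\<Phi> q \<in> K" unfolding K_def \<Phi> polar_map_eq_vec
        using polar_vec_coord[OF e, of n "2*n+1"] by (simp add: Anti_de_Sitter)
    qed (simp_all add: Anti_de_Sitter \<omega>_def)
    then show ?thesis by (simp add: Anti_de_Sitter)
  qed
  then show ?thesis by (intro ext) (simp only: wedge_upto_coord_form)
qed

end
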